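(* Let $\mathfrak n=\mathfrak p^2\mathfrak m$, where $\mathfrak p\lhd A$ is prime and $\mathfrak m\lhd A$ is a proper nonzero ideal (not necessarily coprime to $\mathfrak p$). Then $p$ divides $\#\mathbb T(\mathfrak n)/\mathfrak E(\mathfrak n)$, and hence also $\#\mathbb T(\mathfrak n)^0/\mathfrak E(\mathfrak n)^0$.
   Context: $q$ is a power of the prime $p$, $A=\mathbb F_q[T]$; ideals are identified with monic generators, $|\mathfrak n|=\#A/\mathfrak n$. $\Gamma_0(\mathfrak n)=\{\begin{pmatrix}a&b\\c&d\end{pmatrix}\in\mathrm{GL}_2(A):c\in\mathfrak n\}$. $\mathcal H_0(\mathfrak n,\mathbb Z)$ is the group of $\Gamma_0(\mathfrak n)$-invariant $\mathbb Z$-valued harmonic cochains on the Bruhat–Tits tree of $\mathrm{PGL}_2(\mathbb F_q((1/T)))$ with finite support modulo $\Gamma_0(\mathfrak n)$. Hecke operators: $f|T_\mathfrak m=\sum f|\begin{pmatrix}a&b\\0&d\end{pmatrix}$ over $a,b,d\in A$, $a,d$ monic, $(ad)=\mathfrak m$, $(a)+\mathfrak n=A$, $\deg b<\deg d$, where $(f|\gamma)(e)=f(\gamma e)$. $\mathbb T(\mathfrak n)$ is the $\mathbb Z$-algebra generated by all $T_\mathfrak m$ acting on $\mathcal H_0(\mathfrak n,\mathbb Z)$; $\mathbb T(\mathfrak n)^0$ is the subalgebra generated by $T_\mathfrak m$ with $\mathfrak m$ coprime to $\mathfrak n$. $\mathfrak E(\mathfrak n)$ (resp. $\mathfrak E(\mathfrak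 n)^0$) is the ideal of $\mathbb T(\mathfrak n)$ (resp. $\mathbb T(\mathfrak n)^0$) generated by $T_\mathfrak q-|\mathfrak q|-1$ for primes $\mathfrak q\nmid\mathfrak n$. *)

theory Defs
  imports
    "HOL-Analysis.Analysis"
    "HOL-Computational_Algebra.Computational_Algebra"
    "HOL-Algebra.Generated_Rings"
begin

section \<open>The completion at infinity and the Bruhat--Tits tree\<close>

text \<open>
  Throughout, \<^typ>\<open>'a\<close> is a finite field \<open>F_q\<close> and \<open>A = F_q[T]\<close> is \<^typ>\<open>'a poly\<close>; nonzero ideals of
  \<open>A\<close> are represented by monic generators. The field \<open>F_q((1/T))\<close> is \<^typ>\<open>'a fls\<close>: the Laurent
  variable \<^const>\<open>fls_X\<close> is the uniformizer \<open>1/T\<close>, so that \<open>T\<close> is \<^const>\<open>fls_X_inv\<close>.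
\<close>

definition embed_poly :: "'a::field poly \<Rightarrow> 'a fls" where
  "embed_poly P = poly (map_poly fls_const P) fls_X_inv"

text \<open>As \<^term>\<open>fls_subdegree 0 = 0\<close>, the valuation ring contains 0.\<close>

definition valuation_ring :: "'a::field fls set" where
  "valuation_ring = {x. fls_subdegree x \<ge> 0}"

type_synonym 'a tree_vertex = "('a fls ^ 2) set set"
type_synonym 'a tree_edge = "'a tree_vertex \<times> 'a tree_vertex"
type_synonym 'a cochain = "'a tree_edge \<Rightarrow> int"

definition is_lattice :: "('a::field fls ^ 2) set \<Rightarrow> bool" where
  "is_lattice L \<longleftrightarrow> (\<exists>g :: 'a fls ^ 2 ^ 2. invertible g \<and>
     L = (\<lambda>x. g *v x) ` {x. \<forall>i. x $ i \<in> valuation_ring})"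

definition scale_lattice :: "'a::field fls \<Rightarrow> ('a fls ^ 2) set \<Rightarrow> ('a fls ^ 2) set" where
  "scale_lattice c L = (\<lambda>x. c *s x) ` L"

definition homothety_class :: "('a::field fls ^ 2) set \<Rightarrow> 'a tree_vertex" where
  "homothety_class L = {scale_lattice c L | c. c \<noteq> 0}"

definition tree_vertices :: "'a::field tree_vertex set" where
  "tree_vertices = {homothety_class L | L. is_lattice L}"

text \<open>
  Two classes are adjacent if they have representatives \<open>L' \<subset> L\<close> with \<open>L / L'\<close> of length one, that
  is, with \<open>\<pi> L \<subset> L' \<subset> L\<close> where both inclusions are proper. This relation is symmetric. An oriented
  edge is the pair of its origin and its terminus.
\<close>

definition tree_edges :: "'a::field tree_edge set" where
  "tree_edges = {(v, w). v \<in> tree_vertices \<and> w \<in> tree_vertices \<and>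
     (\<exists>L \<in> v. \<exists>L' \<in> w. scale_lattice fls_X L \<subset> L' \<and> L' \<subset> L)}"

definition act_vertex :: "'a::field poly ^ 2 ^ 2 \<Rightarrow> 'a tree_vertex \<Rightarrow> 'a tree_vertex" where
  "act_vertex g v = (\<lambda>L. (\<lambda>x. map_matrix embed_poly g *v x) ` L) ` v"

definition act_edge :: "'a::field poly ^ 2 ^ 2 \<Rightarrow> 'a tree_edge \<Rightarrow> 'a tree_edge" where
  "act_edge g e = (act_vertex g (fst e), act_vertex g (snd e))"


section \<open>Harmonic cochains\<close>

text \<open>\<^const>\<open>invertible\<close> is invertibility over \<open>A\<close>, so this is a subgroup of \<open>GL_2(A)\<close>.\<close>

definition Gamma0 :: "'a::field poly \<Rightarrow> ('a poly ^ 2 ^ 2) set" where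
  "Gamma0 n = {g. invertible g \<and> n dvd g $ 2 $ 1}"

definition Gamma0_orbit :: "'a::field poly \<Rightarrow> 'a tree_edge \<Rightarrow> 'a tree_edge set" where
  "Gamma0_orbit n e = {act_edge g e | g. g \<in> Gamma0 n}"

text \<open>
  A cochain is a function on the oriented edges; it is extended by 0 to all other pairs, so that
  equal cochains are equal functions.
\<close>

definition harmonic :: "'a::field cochain \<Rightarrow> bool" where
  "harmonic f \<longleftrightarrow>
     (\<forall>e. e \<notin> tree_edges \<longrightarrow> f e = 0) \<and>
     (\<forall>(v, w) \<in> tree_edges. f (w, v) = - f (v, w)) \<and>
     (\<forall>v \<in> tree_vertices. (\<Sum>e | e \<in> tree_edges \<and> snd e = v. f e) = 0)"

definition H0 :: "'a::field poly \<Rightarrow> 'a cochain set" where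
  "H0 n = {f. harmonic f \<and>
     (\<forall>g \<in> Gamma0 n. \<forall>e \<in> tree_edges. f (act_edge g e) = f e) \<and>
     finite (Gamma0_orbit n ` {e \<in> tree_edges. f e \<noteq> 0})}"

definition End_H0 :: "'a::field poly \<Rightarrow> ('a cochain \<Rightarrow> 'a cochain) ring" where
  "End_H0 n =
     \<lparr>carrier = {\<phi> \<in> H0 n \<rightarrow>\<^sub>E H0 n.
        \<forall>f \<in> H0 n. \<forall>g \<in> H0 n. \<phi> (\<lambda>e. f e + g e) = (\<lambda>e. \<phi> f e + \<phi> g e)},
      mult = (\<lambda>\<phi> \<psi>. \<lambda>f\<in>H0 n. \<phi> (\<psi> f)),
      one = (\<lambda>f\<in>H0 n. f),
      zero = (\<lambda>f\<in>H0 n. \<lambda>e. 0),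
      add = (\<lambda>\<phi> \<psi>. \<lambda>f\<in>H0 n. \<lambda>e. \<phi> f e + \<psi> f e)\<rparr>"


section \<open>Hecke algebras and Eisenstein ideals\<close>

definition slash :: "'a::field cochain \<Rightarrow> 'a poly ^ 2 ^ 2 \<Rightarrow> 'a cochain" where
  "slash f g = (\<lambda>e. f (act_edge g e))"

text \<open>
  The disjunct \<^term>\<open>b = 0\<close> implements \<open>deg 0 = -\<infinity>\<close>; it matters when \<open>d = 1\<close>, since
  \<^term>\<open>degree 0 = 0\<close>.
\<close>

definition hecke_index :: "'a::field poly \<Rightarrow> 'a poly \<Rightarrow> ('a poly \<times> 'a poly \<times> 'a poly) set" where
  "hecke_index n m = {(a, b, d). lead_coeff a = 1 \<and> lead_coeff d = 1 \<and> a * d = m \<and>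
     coprime a n \<and> (b = 0 \<or> degree b < degree d)}"

definition hecke :: "'a::field poly \<Rightarrow> 'a poly \<Rightarrow> 'a cochain \<Rightarrow> 'a cochain" where
  "hecke n m = (\<lambda>f\<in>H0 n. \<lambda>e.
     \<Sum>(a, b, d) \<in> hecke_index n m. slash f (vector [vector [a, b], vector [0, d]]) e)"

definition hecke_algebra :: "'a::field poly \<Rightarrow> ('a cochain \<Rightarrow> 'a cochain) ring" where
  "hecke_algebra n =
     (End_H0 n)\<lparr>carrier := generate_ring (End_H0 n) {hecke n m | m. lead_coeff m = 1}\<rparr>"

definition hecke_algebra0 :: "'a::field poly \<Rightarrow> ('a cochain \<Rightarrow> 'a cochain) ring" where
  "hecke_algebra0 n =
     (End_H0 n)\<lparr>carrier :=
        generate_ring (End_H0 n) {hecke n m | m. lead_coeff m = 1 \<and> coprime m n}\<rparr>"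

definition ideal_norm :: "'a::field poly \<Rightarrow> nat" where
  "ideal_norm n = card (UNIV // {(x, y). n dvd x - y})"

definition eisenstein_generators :: "'a::field poly \<Rightarrow> ('a cochain \<Rightarrow> 'a cochain) set" where
  "eisenstein_generators n =
     {hecke n l \<ominus>\<^bsub>End_H0 n\<^esub> [ideal_norm l] \<cdot>\<^bsub>End_H0 n\<^esub> \<one>\<^bsub>End_H0 n\<^esub> \<ominus>\<^bsub>End_H0 n\<^esub> \<one>\<^bsub>End_H0 n\<^esub>
      | l. lead_coeff l = 1 \<and> prime_elem l \<and> \<not> l dvd n}"

definition eisenstein_ideal :: "'a::field poly \<Rightarrow> ('a cochain \<Rightarrow> 'a cochain) set" where
  "eisenstein_ideal n = Idl\<^bsub>hecke_algebra n\<^esub> (eisenstein_generators n)"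

definition eisenstein_ideal0 :: "'a::field poly \<Rightarrow> ('a cochain \<Rightarrow> 'a cochain) set" where
  "eisenstein_ideal0 n = Idl\<^bsub>hecke_algebra0 n\<^esub> (eisenstein_generators n)"

end

theory Submission
  imports Defs "HOL-Algebra.Sylow"
begin

text \<open>
  For a lattice \<open>L\<close> in the plane over the completion, \<open>M d L\<close> denotes the order of the minimal vectors of
  \<open>A + dA\<close> with respect to \<open>L\<close>. Write \<open>n = P D r\<close> with primes \<open>P\<close>, \<open>r\<close> and \<open>P\<close> dividing \<open>D\<close>. Modulo \<open>p\<close>, the
  gradient of \<open>M D - M (D r)\<close> on the tree is harmonic, invariant under \<open>Gamma0 n\<close> and an eigenvector of
  all Hecke operators with Eisenstein eigenvalues, and it is not zero. It vanishes around the vertices fixed by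
  unipotent elements of \<open>Gamma0 n\<close>, and for this reason it lifts to an integral cuspidal harmonic cochain.
  The endomorphisms that annihilate this lift modulo \<open>p\<close>, together with its multiples, form a proper ideal that contains the
  Eisenstein ideal, so that 1 has additive order divisible by \<open>p\<close> in the quotient. The quotient is finite
  since the Hecke ring is a finitely generated group and the generators of the Eisenstein ideal are
  injective by a maximum principle.
\<close>

no_notation fps_nth (infixl "$" 75)
notation fls_nth (infixl "$$" 75)
hide_const (open) Module.smult up_ring.coeff up_ring.monom



lemma vec2_eq_iff: "x = y \<longleftrightarrow> x $ 1 = y $ 1 \<and> x $ 2 = y $ 2" for x y :: "'b ^ 2"
  by (simp add: vec_eq_iff forall_2)

lemma mat2_eq_iff:
  "g = h \<longleftrightarrow> g $ 1 $ 1 = h $ 1 $ 1 \<and> g $ 1 $ 2 = h $ 1 $ 2 \<and> g $ 2 $ 1 = h $ 2 $ 1 \<and> g $ 2 $ 2 = h $ 2 $ 2"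
  for g h :: "'b ^ 2 ^ 2"
  by (auto simp add: vec2_eq_iff)

lemma mat2_mult_component: "(g ** h) $ i $ j = g $ i $ 1 * h $ 1 $ j + g $ i $ 2 * h $ 2 $ j"
  for g h :: "'b::semiring_1 ^ 2 ^ 2"
  by (simp add: matrix_matrix_mult_def sum_2)

lemma mat2_vec_component: "(g *v x) $ i = g $ i $ 1 * x $ 1 + g $ i $ 2 * x $ 2"
  for g :: "'b::semiring_1 ^ 2 ^ 2"
  by (simp add: matrix_vector_mult_def sum_2)

lemma mat2_one_component: "(mat 1 :: 'b::semiring_1 ^ 2 ^ 2) $ 1 $ 1 = 1" "(mat 1 :: 'b ^ 2 ^ 2) $ 1 $ 2 = 0"
  "(mat 1 :: 'b ^ 2 ^ 2) $ 2 $ 1 = 0" "(mat 1 :: 'b ^ 2 ^ 2) $ 2 $ 2 = 1"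
  by (simp_all add: mat_def)

section \<open>Polynomials as Laurent series\<close>

lemma embed_poly_0 [simp]: "embed_poly 0 = 0"
  by (simp add: embed_poly_def)

lemma embed_poly_pCons: "embed_poly (pCons c P) = fls_const c + fls_X_inv * embed_poly P"
  by (simp add: embed_poly_def map_poly_pCons)

lemma embed_poly_1 [simp]: "embed_poly 1 = 1"
  by (simp add: one_pCons embed_poly_pCons)

lemma embed_poly_add: "embed_poly (P + Q) = embed_poly P + embed_poly Q"
  by (induction P Q rule: poly_induct2)
    (simp_all add: embed_poly_pCons algebra_simps flip: fls_plus_const)

lemma embed_poly_smult: "embed_poly (smult c P) = fls_const c * embed_poly P"
  by (induction P) (simp_all add: embed_poly_pCons algebra_simps flip: fls_const_mult_const)

lemma embed_poly_mult: "embed_poly (P * Q) = embed_poly P * embed_poly Q"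
  by (induction P) (simp_all add: embed_poly_pCons embed_poly_add embed_poly_smult algebra_simps)

lemma embed_poly_uminus: "embed_poly (- P) = - embed_poly P"
proof -
  have "embed_poly (- P) + embed_poly P = 0"
    by (simp flip: embed_poly_add)
  then show ?thesis by (simp add: eq_neg_iff_add_eq_0)
qed

lemma embed_poly_diff: "embed_poly (P - Q) = embed_poly P - embed_poly Q"
  using embed_poly_add[of P "- Q"] by (simp add: embed_poly_uminus)

lemma embed_poly_nth: "embed_poly P $$ i = (if i \<le> 0 then coeff P (nat (- i)) else 0)"
proof (induction P arbitrary: i)
  case (pCons c P)
  have "(fls_X_inv * embed_poly P) $$ i = embed_poly P $$ (i + 1)"
    by (simp add: fls_X_inv_times_conv_shift)
  moreover have "nat (- i) = Suc (nat (- (i + 1)))" if "i < 0" using that by simp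
  ultimately show ?case
    by (auto simp add: embed_poly_pCons pCons.IH coeff_pCons split: nat.splits)
qed simp

lemma embed_poly_eq_iff [simp]: "embed_poly P = embed_poly Q \<longleftrightarrow> P = Q"
proof
  assume eq: "embed_poly P = embed_poly Q"
  show "P = Q"
  proof (rule poly_eqI)
    fix k
    show "coeff P k = coeff Q k"
      using embed_poly_nth[of P "- int k"] embed_poly_nth[of Q "- int k"] eq by simp
  qed
qed simp

lemma embed_poly_eq_0_iff [simp]: "embed_poly P = 0 \<longleftrightarrow> P = 0"
  using embed_poly_eq_iff[of P 0] by (simp del: embed_poly_eq_iff)

lemma embed_poly_subdegree: "fls_subdegree (embed_poly P) = - int (degree P)"
proof (cases "P = 0")
  case False
  show ?thesis
  proof (rule fls_subdegree_eqI)
    show "embed_poly P $$ - int (degree P) \<noteq> 0"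
      using False by (simp add: embed_poly_nth)
    show "embed_poly P $$ k = 0" if "k < - int (degree P)" for k
      using that by (simp add: embed_poly_nth coeff_eq_0)
  qed
qed simp

lemma embed_poly_const [simp]: "embed_poly [:c:] = fls_const c"
  by (simp add: embed_poly_pCons)

section \<open>The valuation ring\<close>

lemma valuation_ring_iff: "x \<in> valuation_ring \<longleftrightarrow> (\<forall>k<0. x $$ k = 0)"
proof
  assume "\<forall>k<0. x $$ k = 0"
  then show "x \<in> valuation_ring"
    unfolding valuation_ring_def by (auto intro: fls_subdegree_ge0I)
qed (auto simp add: valuation_ring_def)

lemma valuation_ring_0 [simp]: "0 \<in> valuation_ring"
  and valuation_ring_1 [simp]: "1 \<in> valuation_ring"
  and valuation_ring_const [simp]: "fls_const c \<in> valuation_ring"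
  and valuation_ring_X [simp]: "fls_X \<in> valuation_ring"
  by (simp_all add: valuation_ring_def)

lemma valuation_ring_add [intro]: "x \<in> valuation_ring \<Longrightarrow> y \<in> valuation_ring \<Longrightarrow> x + y \<in> valuation_ring"
  and valuation_ring_diff [intro]: "x \<in> valuation_ring \<Longrightarrow> y \<in> valuation_ring \<Longrightarrow> x - y \<in> valuation_ring"
  and valuation_ring_uminus [intro]: "x \<in> valuation_ring \<Longrightarrow> - x \<in> valuation_ring"
  by (simp_all add: valuation_ring_iff)

lemma valuation_ring_uminus_iff [simp]: "- x \<in> valuation_ring \<longleftrightarrow> x \<in> valuation_ring"
  by (simp add: valuation_ring_iff)

lemma valuation_ring_mult [intro]: "x \<in> valuation_ring \<Longrightarrow> y \<in> valuation_ring \<Longrightarrow> x * y \<in> valuation_ring"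
  by (cases "x = 0 \<or> y = 0") (auto simp add: valuation_ring_def)

definition pw :: "int \<Rightarrow> 'a::field fls" where "pw i = fls_X powi i"

lemma pw_nonzero [simp]: "pw i \<noteq> 0"
  and pw_0 [simp]: "pw 0 = 1"
  and pw_1: "pw 1 = fls_X"
  and subdegree_pw [simp]: "fls_subdegree (pw i) = i"
  by (simp_all add: pw_def)

lemma pw_add: "pw (i + j) = pw i * pw j"
  unfolding pw_def by (rule power_int_add) simp

lemma pw_uminus: "pw (- i) = inverse (pw i)"
  unfolding pw_def by (rule power_int_minus)

lemma pw_in_valuation_ring [simp]: "pw i \<in> valuation_ring \<longleftrightarrow> 0 \<le> i"
  by (simp add: valuation_ring_def)

lemma pw_diff: "pw (i - j) = pw i / pw j"
  using pw_add[of i "- j"] by (simp add: pw_uminus field_simps)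

lemma divide_pw_in_valuation_ring: "x / pw i \<in> valuation_ring \<longleftrightarrow> x = 0 \<or> i \<le> fls_subdegree x"
  by (cases "x = 0") (auto simp add: valuation_ring_def fls_divide_subdegree)

lemma valuation_ring_residue:
  assumes "x \<in> valuation_ring"
  shows "(x - fls_const (x $$ 0)) / pw 1 \<in> valuation_ring"
proof (cases "x = fls_const (x $$ 0)")
  case False
  have "1 \<le> fls_subdegree (x - fls_const (x $$ 0))"
  proof (rule fls_subdegree_geI)
    show "(x - fls_const (x $$ 0)) $$ k = 0" if "k < 1" for k
      using that assms by (cases "k = 0") (auto simp add: valuation_ring_iff)
  qed (use False in simp)
  then show ?thesis
    using divide_pw_in_valuation_ring[of "x - fls_const (x $$ 0)" 1] by simp
qed simp

lemma divide_X_in_valuation_ring_iff: "x / pw 1 \<in> valuation_ring \<longleftrightarrow> (\<forall>k\<le>0. x $$ k = 0)"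
proof -
  have e: "(x / pw 1) $$ k = x $$ (k + 1)" for k
    by (simp add: pw_1)
  have "x $$ k = 0" if "\<forall>k<0. x $$ (k + 1) = 0" "k \<le> 0" for k
    using that(1)[rule_format, of "k - 1"] that(2) by simp
  then show ?thesis unfolding valuation_ring_iff e by auto
qed

lemma divide_X_imp: "x / pw 1 \<in> valuation_ring \<Longrightarrow> x \<in> valuation_ring"
  unfolding divide_X_in_valuation_ring_iff by (simp add: valuation_ring_iff)

lemma unit_iff: "x \<in> valuation_ring \<Longrightarrow> x / pw 1 \<notin> valuation_ring \<longleftrightarrow> x \<noteq> 0 \<and> inverse x \<in> valuation_ring"
proof -
  assume "x \<in> valuation_ring"
  then show ?thesis
    using divide_pw_in_valuation_ring[of x 1]
    by (cases "x = 0") (auto simp add: valuation_ring_def)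
qed

lemma embed_poly_part: "\<exists>P. (x - embed_poly P) / pw 1 \<in> valuation_ring"
proof -
  define N where "N = nat (- fls_subdegree x)"
  define P where "P = Poly (map (\<lambda>k. x $$ (- int k)) [0..<Suc N])"
  have c: "coeff P k = x $$ (- int k)" for k
  proof (cases "k < Suc N")
    case True
    then show ?thesis unfolding P_def by (simp add: coeff_Poly_eq nth_default_def del: upt_Suc)
  next
    case False
    then have "- int k < fls_subdegree x" by (auto simp add: N_def)
    with False show ?thesis unfolding P_def by (simp add: coeff_Poly_eq nth_default_def del: upt_Suc)
  qed
  show ?thesis
    by (rule exI[of _ P]) (simp add: divide_X_in_valuation_ring_iff embed_poly_nth c)
qed

section \<open>Lattices\<close>

definition dt :: "'a::comm_ring ^ 2 \<Rightarrow> 'a ^ 2 \<Rightarrow> 'a" where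
  "dt x y = x $ 1 * y $ 2 - x $ 2 * y $ 1"

definition lat :: "'a::field fls ^ 2 \<Rightarrow> 'a fls ^ 2 \<Rightarrow> ('a fls ^ 2) set" where
  "lat x y = {s *s x + t *s y | s t. s \<in> valuation_ring \<and> t \<in> valuation_ring}"

lemma
  fixes x y z :: "'b::comm_ring_1 ^ 2"
  shows dt_add_left: "dt (x + y) z = dt x z + dt y z"
  and dt_add_right: "dt z (x + y) = dt z x + dt z y"
  and dt_diff_left: "dt (x - y) z = dt x z - dt y z"
  and dt_diff_right: "dt z (x - y) = dt z x - dt z y"
  and dt_scale_left: "dt (c *s x) z = c * dt x z"
  and dt_scale_right: "dt z (c *s x) = c * dt z x"
  and dt_self [simp]: "dt x x = 0"
  and dt_zero_left [simp]: "dt 0 x = 0"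
  and dt_zero_right [simp]: "dt x 0 = 0"
  by (simp_all add: dt_def algebra_simps)

lemma dt_swap: "dt x y = - dt y x" for x y :: "'b::comm_ring_1 ^ 2"
  by (simp add: dt_def algebra_simps)

lemmas dt_simps = dt_add_left dt_add_right dt_diff_left dt_diff_right dt_scale_left dt_scale_right

lemma dt_matrix: "dt (g *v x) (g *v y) = det g * dt x y" for x y :: "'b::comm_ring_1 ^ 2"
  by (simp add: dt_def mat2_vec_component det_2 algebra_simps)

lemma cramer: "dt x y *s z = dt z y *s x + dt x z *s y" for x y z :: "'b::comm_ring_1 ^ 2"
  by (simp add: vec2_eq_iff dt_def algebra_simps)

lemma cramer_field:
  fixes x y z :: "'b::field ^ 2"
  assumes "dt x y \<noteq> 0"
  shows "z = (dt z y / dt x y) *s x + (dt x z / dt x y) *s y"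
proof -
  have "z = inverse (dt x y) *s (dt x y *s z)"
    using assms by (simp add: vector_smult_assoc)
  also have "\<dots> = (dt z y / dt x y) *s x + (dt x z / dt x y) *s y"
    unfolding cramer[of x y z]
    by (simp add: vector_add_ldistrib vector_smult_assoc field_simps)
  finally show ?thesis .
qed

lemma in_lat_iff:
  assumes "dt x y \<noteq> 0"
  shows "z \<in> lat x y \<longleftrightarrow> dt z y / dt x y \<in> valuation_ring \<and> dt x z / dt x y \<in> valuation_ring"
proof
  assume "z \<in> lat x y"
  then obtain s t where z: "z = s *s x + t *s y" "s \<in> valuation_ring" "t \<in> valuation_ring"
    by (auto simp add: lat_def)
  have "dt z y = s * dt x y" "dt x z = t * dt x y"
    unfolding z by (simp_all add: dt_simps)
  with z assms show "dt z y / dt x y \<in> valuation_ring \<and> dt x z / dt x y \<in> valuation_ring" by simp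
next
  assume "dt z y / dt x y \<in> valuation_ring \<and> dt x z / dt x y \<in> valuation_ring"
  then show "z \<in> lat x y"
    using cramer_field[OF assms, of z] unfolding lat_def by blast
qed

lemma lat_comb: "s \<in> valuation_ring \<Longrightarrow> t \<in> valuation_ring \<Longrightarrow> s *s x + t *s y \<in> lat x y"
  by (auto simp add: lat_def)

lemma is_lattice_iff: "is_lattice L \<longleftrightarrow> (\<exists>x y. dt x y \<noteq> 0 \<and> L = lat x y)"
proof
  assume "is_lattice L"
  then obtain g :: "'a fls ^ 2 ^ 2" where g: "invertible g"
    "L = (\<lambda>x. g *v x) ` {x. \<forall>i. x $ i \<in> valuation_ring}"
    by (auto simp add: is_lattice_def)
  define x y where "x = column 1 g" and "y = column 2 g"
  have "dt x y = det g" by (simp add: x_def y_def dt_def column_def det_2)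
  then have "dt x y \<noteq> 0" using g(1) by (simp add: invertible_det_nz)
  moreover have "L = lat x y"
  proof (rule Set.set_eqI)
    fix z
    have "z \<in> L \<longleftrightarrow> (\<exists>u. z = g *v u \<and> u $ 1 \<in> valuation_ring \<and> u $ 2 \<in> valuation_ring)"
      by (auto simp add: g(2) forall_2)
    also have "\<dots> \<longleftrightarrow> (\<exists>s t. z = g *v vector [s, t] \<and> s \<in> valuation_ring \<and> t \<in> valuation_ring)"
    proof -
      have "u = vector [u $ 1, u $ 2]" for u :: "'a fls ^ 2" by (simp add: vec2_eq_iff)
      then show ?thesis by (metis vector_2)
    qed
    also have "\<dots> \<longleftrightarrow> z \<in> lat x y"
    proof -
      have "g *v vector [s, t] = s *s x + t *s y" for s t
        by (simp add: vec2_eq_iff mat2_vec_component x_def y_def column_def mult.commute)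
      then show ?thesis by (simp add: lat_def)
    qed
    finally show "z \<in> L \<longleftrightarrow> z \<in> lat x y" .
  qed
  ultimately show "\<exists>x y. dt x y \<noteq> 0 \<and> L = lat x y" by blast
next
  assume "\<exists>x y. dt x y \<noteq> 0 \<and> L = lat x y"
  then obtain x y where xy: "dt x y \<noteq> 0" "L = lat x y" by blast
  define g :: "'a fls ^ 2 ^ 2" where "g = vector [vector [x $ 1, y $ 1], vector [x $ 2, y $ 2]]"
  have "det g = dt x y" by (simp add: g_def det_2 dt_def)
  then have "invertible g" using xy(1) by (simp add: invertible_det_nz)
  moreover have "L = (\<lambda>x. g *v x) ` {x. \<forall>i. x $ i \<in> valuation_ring}"
  proof (rule Set.set_eqI)
    fix z
    have eq: "g *v u = u $ 1 *s x + u $ 2 *s y" for u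
      by (simp add: vec2_eq_iff mat2_vec_component g_def mult.commute)
    show "z \<in> L \<longleftrightarrow> z \<in> (\<lambda>x. g *v x) ` {x. \<forall>i. x $ i \<in> valuation_ring}"
    proof
      assume "z \<in> L"
      then obtain s t where "z = s *s x + t *s y" "s \<in> valuation_ring" "t \<in> valuation_ring"
        by (auto simp add: xy(2) lat_def)
      then show "z \<in> (\<lambda>x. g *v x) ` {x. \<forall>i. x $ i \<in> valuation_ring}"
        by (intro image_eqI[of _ _ "vector [s, t]"]) (auto simp add: eq forall_2)
    next
      assume "z \<in> (\<lambda>x. g *v x) ` {x. \<forall>i. x $ i \<in> valuation_ring}"
      then show "z \<in> L" by (auto simp add: xy(2) eq forall_2 lat_def)
    qed
  qed
  ultimately show "is_lattice L" by (auto simp add: is_lattice_def)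
qed

lemma is_lattice_lat [intro]: "dt x y \<noteq> 0 \<Longrightarrow> is_lattice (lat x y)"
  by (auto simp add: is_lattice_iff)

lemma lattice_0: "is_lattice L \<Longrightarrow> 0 \<in> L"
  by (auto simp add: is_lattice_iff in_lat_iff)

lemma lattice_add: "is_lattice L \<Longrightarrow> x \<in> L \<Longrightarrow> y \<in> L \<Longrightarrow> x + y \<in> L"
  by (auto simp add: is_lattice_iff in_lat_iff dt_simps add_divide_distrib)

lemma lattice_diff: "is_lattice L \<Longrightarrow> x \<in> L \<Longrightarrow> y \<in> L \<Longrightarrow> x - y \<in> L"
  by (auto simp add: is_lattice_iff in_lat_iff dt_simps diff_divide_distrib)

lemma lattice_scale: "is_lattice L \<Longrightarrow> c \<in> valuation_ring \<Longrightarrow> x \<in> L \<Longrightarrow> c *s x \<in> L"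
  by (auto simp add: is_lattice_iff in_lat_iff dt_simps simp flip: times_divide_eq_right)

lemma lat_subset: "is_lattice L \<Longrightarrow> x \<in> L \<Longrightarrow> y \<in> L \<Longrightarrow> lat x y \<subseteq> L"
  by (auto simp add: lat_def lattice_add lattice_scale)

lemma lat_gen1: "x \<in> lat x y" and lat_gen2: "y \<in> lat x y"
  using lat_comb[of 1 0 x y] lat_comb[of 0 1 x y] by simp_all

lemma scale_lattice_iff: "c \<noteq> 0 \<Longrightarrow> z \<in> scale_lattice c L \<longleftrightarrow> inverse c *s z \<in> L"
proof
  assume "c \<noteq> 0" "inverse c *s z \<in> L"
  then show "z \<in> scale_lattice c L"
    by (auto simp add: scale_lattice_def vector_smult_assoc intro!: image_eqI[of _ _ "inverse c *s z"])
qed (auto simp add: scale_lattice_def vector_smult_assoc)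

lemma scale_scale_lattice: "scale_lattice c (scale_lattice d L) = scale_lattice (c * d) L"
  by (auto simp add: scale_lattice_def image_image vector_smult_assoc)

lemma scale_lattice_1 [simp]: "scale_lattice 1 L = L"
  by (simp add: scale_lattice_def)

lemma scale_lat: "scale_lattice c (lat x y) = lat (c *s x) (c *s y)"
proof -
  have e: "c *s (s *s x + t *s y) = s *s (c *s x) + t *s (c *s y)" for s t
    by (simp add: vec2_eq_iff algebra_simps)
  have "scale_lattice c (lat x y) = {c *s (s *s x + t *s y) | s t. s \<in> valuation_ring \<and> t \<in> valuation_ring}"
    unfolding scale_lattice_def lat_def by blast
  then show ?thesis unfolding e lat_def .
qed

lemma is_lattice_scale: "is_lattice L \<Longrightarrow> c \<noteq> 0 \<Longrightarrow> is_lattice (scale_lattice c L)"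
  by (auto simp add: is_lattice_iff scale_lat)
    (metis dt_scale_left dt_scale_right mult_eq_0_iff)

definition sc :: "int \<Rightarrow> ('a::field fls ^ 2) set \<Rightarrow> ('a fls ^ 2) set" where
  "sc i L = scale_lattice (pw i) L"

lemma is_lattice_sc [intro]: "is_lattice L \<Longrightarrow> is_lattice (sc i L)"
  by (simp add: sc_def is_lattice_scale)

lemma sc_0 [simp]: "sc 0 L = L" and sc_sc: "sc i (sc j L) = sc (i + j) L"
  by (simp_all add: sc_def scale_scale_lattice pw_add)

lemma sc_1: "sc 1 L = scale_lattice fls_X L"
  by (simp add: sc_def pw_1)

lemma in_sc_iff: "z \<in> sc i L \<longleftrightarrow> pw (- i) *s z \<in> L"
  by (simp add: sc_def scale_lattice_iff pw_uminus)

lemma in_sc_scale_iff: "pw j *s z \<in> sc i L \<longleftrightarrow> z \<in> sc (i - j) L"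
  by (simp add: in_sc_iff vector_smult_assoc algebra_simps flip: pw_add)

lemma sc_mono: "L \<subseteq> L' \<Longrightarrow> sc i L \<subseteq> sc i L'"
  by (auto simp add: in_sc_iff)

lemma sc_eq_iff [simp]: "sc i L = sc i L' \<longleftrightarrow> L = L'"
proof
  assume "sc i L = sc i L'"
  then have "sc (- i) (sc i L) = sc (- i) (sc i L')" by (rule arg_cong)
  then show "L = L'" unfolding sc_sc by simp
qed simp

lemma sc_antimono: "is_lattice L \<Longrightarrow> i \<le> j \<Longrightarrow> sc j L \<subseteq> sc i L"
proof
  fix z assume L: "is_lattice L" "i \<le> j" "z \<in> sc j L"
  have "pw (- i) *s z = pw (j - i) *s (pw (- j) *s z)"
    by (simp add: vector_smult_assoc flip: pw_add)
  moreover have "pw (j - i) *s (pw (- j) *s z) \<in> L"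
    using L by - (rule lattice_scale, simp_all add: in_sc_iff)
  ultimately show "z \<in> sc i L" by (simp only: in_sc_iff)
qed

lemma scale_unit: "is_lattice L \<Longrightarrow> c \<noteq> 0 \<Longrightarrow> scale_lattice c L = sc (fls_subdegree c) L"
proof (rule Set.set_eqI)
  fix z assume L: "is_lattice L" and c: "c \<noteq> 0"
  define u where "u = c / pw (fls_subdegree c)"
  have u: "u \<in> valuation_ring" "inverse u \<in> valuation_ring" "u \<noteq> 0"
    using c by (auto simp add: u_def valuation_ring_def fls_divide_subdegree)
  have e: "inverse c * u = pw (- fls_subdegree c)" "inverse c = pw (- fls_subdegree c) * inverse u"
    using c by (simp_all add: u_def pw_uminus field_simps)
  show "z \<in> scale_lattice c L \<longleftrightarrow> z \<in> sc (fls_subdegree c) L"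
  proof
    assume "z \<in> scale_lattice c L"
    then have "u *s (inverse c *s z) \<in> L" using L u c by - (rule lattice_scale, simp_all add: scale_lattice_iff)
    then show "z \<in> sc (fls_subdegree c) L" using e(1) by (simp add: in_sc_iff vector_smult_assoc mult.commute)
  next
    assume "z \<in> sc (fls_subdegree c) L"
    then have "inverse u *s (pw (- fls_subdegree c) *s z) \<in> L"
      using L u by - (rule lattice_scale, simp_all add: in_sc_iff)
    then show "z \<in> scale_lattice c L" using e(2) c by (simp add: scale_lattice_iff vector_smult_assoc mult.commute)
  qed
qed

lemma homothety_class_eq: "is_lattice L \<Longrightarrow> homothety_class L = range (\<lambda>i. sc i L)"
proof
  assume L: "is_lattice L"
  show "homothety_class L \<subseteq> range (\<lambda>i. sc i L)"
    using scale_unit[OF L] by (auto simp add: homothety_class_def)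
  show "range (\<lambda>i. sc i L) \<subseteq> homothety_class L"
    by (auto simp add: homothety_class_def sc_def intro!: exI[of _ "pw _"])
qed

lemma ex_sc: "is_lattice L \<Longrightarrow> \<exists>i. z \<in> sc i L"
proof -
  assume "is_lattice L"
  then obtain x y where L: "dt x y \<noteq> 0" "L = lat x y" by (auto simp add: is_lattice_iff)
  define a b where "a = dt z y / dt x y" and "b = dt x z / dt x y"
  define i where "i = min (fls_subdegree a) (fls_subdegree b)"
  have "a / pw i \<in> valuation_ring" "b / pw i \<in> valuation_ring"
    by (auto simp add: divide_pw_in_valuation_ring i_def)
  moreover have "dt (pw (- i) *s z) y / dt x y = a / pw i" "dt x (pw (- i) *s z) / dt x y = b / pw i"
    by (simp_all add: a_def b_def dt_simps pw_uminus field_simps)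
  ultimately have "z \<in> sc i L" by (simp add: in_sc_iff L in_lat_iff)
  then show ?thesis ..
qed

lemma not_in_sc: "is_lattice L \<Longrightarrow> z \<noteq> 0 \<Longrightarrow> \<exists>i. \<forall>j\<ge>i. z \<notin> sc j L"
proof -
  assume "is_lattice L" and z: "z \<noteq> 0"
  then obtain x y where L: "dt x y \<noteq> 0" "L = lat x y" by (auto simp add: is_lattice_iff)
  define a b where "a = dt z y / dt x y" and "b = dt x z / dt x y"
  have ab: "a \<noteq> 0 \<or> b \<noteq> 0"
    using z cramer_field[OF L(1), of z] by (auto simp add: a_def b_def)
  have e: "dt (pw (- i) *s z) y / dt x y = a / pw i" "dt x (pw (- i) *s z) / dt x y = b / pw i" for i
    by (simp_all add: a_def b_def dt_simps pw_uminus field_simps)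
  define i where "i = max (fls_subdegree a) (fls_subdegree b) + 1"
  have "z \<notin> sc j L" if "j \<ge> i" for j
    unfolding L in_sc_iff in_lat_iff[OF L(1)] e using ab that
    by (auto simp add: divide_pw_in_valuation_ring i_def)
  then show ?thesis by blast
qed

lemma ex_sc_exact:
  assumes "is_lattice L" "z \<noteq> 0"
  obtains i where "z \<in> sc i L" "z \<notin> sc (i + 1) L"
proof -
  obtain i where i: "z \<in> sc i L" using ex_sc assms by blast
  obtain k where k: "\<forall>j\<ge>k. z \<notin> sc j L" using not_in_sc assms by blast
  have "i \<le> k" using i k by (meson linorder_le_cases)
  have "\<exists>j. z \<in> sc j L \<and> z \<notin> sc (j + 1) L"
  proof (rule ccontr)
    assume c: "\<not> ?thesis"
    have "z \<in> sc j L" if "i \<le> j" for j using that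
      by (induction j rule: int_ge_induct) (use i c in auto)
    then show False using k \<open>i \<le> k\<close> by blast
  qed
  then show ?thesis using that by blast
qed

lemma lattice_basis:
  assumes "is_lattice L" "x \<in> L" "x \<notin> sc 1 L"
  obtains y where "dt x y \<noteq> 0" "L = lat x y"
proof -
  obtain u v where L: "dt u v \<noteq> 0" "L = lat u v" using assms(1) by (auto simp add: is_lattice_iff)
  obtain s t where x: "x = s *s u + t *s v" "s \<in> valuation_ring" "t \<in> valuation_ring"
    using assms(2) L by (auto simp add: lat_def)
  have "s / pw 1 \<notin> valuation_ring \<or> t / pw 1 \<notin> valuation_ring"
  proof (rule ccontr)
    assume "\<not> ?thesis"
    then have "(s / pw 1) *s u + (t / pw 1) *s v \<in> L" using L by (auto intro!: lat_comb)
    moreover have "(s / pw 1) *s u + (t / pw 1) *s v = pw (-1) *s x"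
      by (simp add: x vector_add_ldistrib vector_smult_assoc pw_uminus field_simps)
    ultimately show False using assms(3) by (simp add: in_sc_iff)
  qed
  then consider "s \<noteq> 0" "inverse s \<in> valuation_ring" | "t \<noteq> 0" "inverse t \<in> valuation_ring"
    using unit_iff x by blast
  then show ?thesis
  proof cases
    case 1
    have d: "dt x v = s * dt u v" by (simp add: x dt_simps)
    moreover have "L = lat x v"
    proof
      show "lat x v \<subseteq> L" using assms L by (intro lat_subset) (auto simp add: lat_gen2)
      have "u = inverse s *s x + (- (inverse s * t)) *s v"
        using 1 by (simp add: x vector_add_ldistrib vector_smult_assoc vec2_eq_iff algebra_simps)
      then have "u \<in> lat x v" using 1 x lat_comb valuation_ring_mult valuation_ring_uminus by metis
      then show "L \<subseteq> lat x v" unfolding L using 1 L d by (intro lat_subset) (auto simp add: lat_gen2)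
    qed
    ultimately show ?thesis using that 1 L by force
  next
    case 2
    have d: "dt x u = - t * dt u v" by (simp add: x dt_simps dt_swap[of v u])
    moreover have "L = lat x u"
    proof
      show "lat x u \<subseteq> L" using assms L by (intro lat_subset) (auto simp add: lat_gen1)
      have "v = inverse t *s x + (- (inverse t * s)) *s u"
        using 2 by (simp add: x vector_add_ldistrib vector_smult_assoc vec2_eq_iff algebra_simps)
      then have "v \<in> lat x u" using 2 x lat_comb valuation_ring_mult valuation_ring_uminus by metis
      then show "L \<subseteq> lat x u" unfolding L using 2 L d by (intro lat_subset) (auto simp add: lat_gen2)
    qed
    ultimately show ?thesis using that 2 L by force
  qed
qed

section \<open>The tree\<close>

lemma mem_homothety_class: "is_lattice L \<Longrightarrow> L \<in> homothety_class L"
  unfolding homothety_class_eq by (rule range_eqI[of _ _ 0]) simp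

lemma homothety_class_sc: "is_lattice L \<Longrightarrow> homothety_class (sc i L) = homothety_class L"
proof -
  assume L: "is_lattice L"
  have "range (\<lambda>j. sc j (sc i L)) = range (\<lambda>j. sc j L)"
  proof
    show "range (\<lambda>j. sc j (sc i L)) \<subseteq> range (\<lambda>j. sc j L)" by (auto simp add: sc_sc)
    show "range (\<lambda>j. sc j L) \<subseteq> range (\<lambda>j. sc j (sc i L))"
    proof
      fix M assume "M \<in> range (\<lambda>j. sc j L)"
      then obtain j where "M = sc ((j - i) + i) L" by auto
      then show "M \<in> range (\<lambda>j. sc j (sc i L))" unfolding sc_sc[symmetric] by blast
    qed
  qed
  then show ?thesis using L by (simp add: homothety_class_eq is_lattice_sc)
qed

lemma homothety_class_eq_iff:
  "is_lattice L \<Longrightarrow> is_lattice L' \<Longrightarrow> homothety_class L = homothety_class L' \<longleftrightarrow> (\<exists>i. L' = sc i L)"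
  by (metis homothety_class_eq homothety_class_sc mem_homothety_class rangeE)

lemma homothety_class_in_tree_vertices [intro]: "is_lattice L \<Longrightarrow> homothety_class L \<in> tree_vertices"
  by (auto simp add: tree_vertices_def)

lemma tree_vertexE:
  assumes "v \<in> tree_vertices"
  obtains L where "is_lattice L" "v = homothety_class L"
  using assms by (auto simp add: tree_vertices_def)

lemma tree_vertex_mem:
  assumes "v \<in> tree_vertices" "L \<in> v"
  shows "is_lattice L" "v = homothety_class L"
proof -
  obtain M where M: "is_lattice M" "v = homothety_class M" using assms(1) by (rule tree_vertexE)
  then obtain i where "L = sc i M" using assms(2) by (auto simp add: homothety_class_eq)
  with M show "is_lattice L" "v = homothety_class L" by (auto simp add: homothety_class_sc)
qed

definition nbs :: "('a::field fls ^ 2) set \<Rightarrow> ('a fls ^ 2) set set" where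
  "nbs L = {L'. is_lattice L' \<and> sc 1 L \<subset> L' \<and> L' \<subset> L}"

lemma nbs_sc: "L' \<in> nbs L \<Longrightarrow> sc i L' \<in> nbs (sc i L)"
proof -
  assume "L' \<in> nbs L"
  moreover have "sc 1 (sc i L) = sc i (sc 1 L)" by (simp add: sc_sc add.commute)
  ultimately show ?thesis by (auto simp add: nbs_def psubset_eq sc_mono is_lattice_sc)
qed

lemma nbs_swap: "is_lattice L \<Longrightarrow> L' \<in> nbs L \<Longrightarrow> sc 1 L \<in> nbs L'"
  by (auto simp add: nbs_def psubset_eq sc_mono is_lattice_sc)

lemma tree_edge_iff:
  assumes "is_lattice L"
  shows "(homothety_class L, w) \<in> tree_edges \<longleftrightarrow> (\<exists>L' \<in> nbs L. w = homothety_class L')"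
proof
  assume "(homothety_class L, w) \<in> tree_edges"
  then obtain M M' where M: "M \<in> homothety_class L" "M' \<in> w" "sc 1 M \<subset> M'" "M' \<subset> M"
    and w: "w \<in> tree_vertices"
    by (auto simp add: tree_edges_def sc_1)
  obtain i where i: "M = sc i L" using M(1) assms by (auto simp add: homothety_class_eq)
  have "is_lattice M'" and w': "w = homothety_class M'" using tree_vertex_mem w M(2) by blast+
  then have "M' \<in> nbs M" using M by (simp add: nbs_def)
  then have "sc (- i) M' \<in> nbs (sc (- i) M)" by (rule nbs_sc)
  then show "\<exists>L' \<in> nbs L. w = homothety_class L'"
    using w' \<open>is_lattice M'\<close> i by (intro bexI[of _ "sc (- i) M'"]) (auto simp add: sc_sc homothety_class_sc)
next
  assume "\<exists>L' \<in> nbs L. w = homothety_class L'"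
  then obtain L' where L': "L' \<in> nbs L" "w = homothety_class L'" by blast
  then have "is_lattice L'" by (simp add: nbs_def)
  with L' assms show "(homothety_class L, w) \<in> tree_edges"
    unfolding tree_edges_def nbs_def sc_1[symmetric]
    using mem_homothety_class[of L] mem_homothety_class[of L'] by blast
qed

lemma tree_edgeE:
  assumes "(v, w) \<in> tree_edges"
  obtains L L' where "is_lattice L" "L' \<in> nbs L" "v = homothety_class L" "w = homothety_class L'"
proof -
  have "v \<in> tree_vertices" using assms by (simp add: tree_edges_def)
  then obtain L where "is_lattice L" "v = homothety_class L" by (rule tree_vertexE)
  with assms that show ?thesis by (auto simp add: tree_edge_iff)
qed

lemma nbs_lattice: "L' \<in> nbs L \<Longrightarrow> is_lattice L'"
  by (simp add: nbs_def)

lemma tree_edge_sym: "(v, w) \<in> tree_edges \<Longrightarrow> (w, v) \<in> tree_edges"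
proof -
  assume "(v, w) \<in> tree_edges"
  then obtain L L' where L: "is_lattice L" "L' \<in> nbs L" "v = homothety_class L" "w = homothety_class L'"
    by (rule tree_edgeE)
  then show ?thesis
    using nbs_swap[OF L(1,2)] by (auto simp add: tree_edge_iff nbs_lattice homothety_class_sc intro!: bexI[of _ "sc 1 L"])
qed

lemma inj_on_nbs: "is_lattice L \<Longrightarrow> inj_on homothety_class (nbs L)"
proof (rule inj_onI)
  fix M M' assume L: "is_lattice L" "M \<in> nbs L" "M' \<in> nbs L" "homothety_class M = homothety_class M'"
  then obtain i where i: "M' = sc i M" by (metis homothety_class_eq_iff nbs_lattice)
  have M: "is_lattice M" using L nbs_lattice by blast
  have "\<not> 1 \<le> i"
  proof
    assume "1 \<le> i"
    then have "M' \<subseteq> sc 1 M" unfolding i by (intro sc_antimono M)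
    also have "\<dots> \<subseteq> sc 1 L" using L by (auto simp add: nbs_def intro!: sc_mono)
    finally show False using L by (auto simp add: nbs_def)
  qed
  moreover have "\<not> i \<le> -1"
  proof
    assume "i \<le> -1"
    then have "sc (-1) M \<subseteq> M'" unfolding i by (intro sc_antimono M)
    then have "sc 1 (sc (-1) M) \<subseteq> sc 1 M'" by (rule sc_mono)
    also have "sc 1 M' \<subseteq> sc 1 L" using L by (auto simp add: nbs_def intro!: sc_mono)
    finally have "M \<subseteq> sc 1 L" by (simp add: sc_sc)
    then show False using L by (auto simp add: nbs_def)
  qed
  ultimately have "i = 0" by linarith
  with i show "M = M'" by simp
qed

lemma star_eq:
  assumes "is_lattice L"
  shows "{e \<in> tree_edges. snd e = homothety_class L} = (\<lambda>L'. (homothety_class L', homothety_class L)) ` nbs L"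
proof -
  have "e \<in> tree_edges \<and> snd e = homothety_class L \<longleftrightarrow>
      (homothety_class L, fst e) \<in> tree_edges \<and> snd e = homothety_class L" for e
    using tree_edge_sym by (metis prod.collapse)
  then show ?thesis using assms by (auto simp add: tree_edge_iff)
qed

lemma sum_star:
  assumes "is_lattice L"
  shows "(\<Sum>e | e \<in> tree_edges \<and> snd e = homothety_class L. f e) =
    (\<Sum>L' \<in> nbs L. f (homothety_class L', homothety_class L))"
proof -
  have "inj_on (\<lambda>L'. (homothety_class L', homothety_class L)) (nbs L)"
    using inj_on_nbs[OF assms] by (auto simp add: inj_on_def)
  then show ?thesis unfolding star_eq[OF assms] by (simp add: sum.reindex)
qed

lemma nbs_eq_lat:
  assumes "is_lattice L" "L' \<in> nbs L" "z \<in> L'" "z \<notin> sc 1 L" "dt z u \<noteq> 0" "L = lat z u"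
  shows "L' = lat z (pw 1 *s u)"
proof
  have L': "is_lattice L'" using assms nbs_lattice by blast
  have "u \<in> L" using assms by (simp add: lat_gen2)
  then have "pw 1 *s u \<in> sc 1 L" by (simp add: in_sc_scale_iff)
  then have "pw 1 *s u \<in> L'" using assms by (auto simp add: nbs_def)
  then show "lat z (pw 1 *s u) \<subseteq> L'" using L' assms by (intro lat_subset)
  show "L' \<subseteq> lat z (pw 1 *s u)"
  proof
    fix v assume v: "v \<in> L'"
    then have "v \<in> L" using assms by (auto simp add: nbs_def)
    then obtain s t where st: "v = s *s z + t *s u" "s \<in> valuation_ring" "t \<in> valuation_ring"
      by (auto simp add: assms(6) lat_def)
    have "t / pw 1 \<in> valuation_ring"
    proof (rule ccontr)
      assume "t / pw 1 \<notin> valuation_ring"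
      then have t: "t \<noteq> 0" "inverse t \<in> valuation_ring" using unit_iff st by blast+
      have "v - s *s z \<in> L'" using v assms st L' by (intro lattice_diff lattice_scale)
      then have "inverse t *s (v - s *s z) \<in> L'" by (intro lattice_scale L' t)
      then have "u \<in> L'" using t by (simp add: st)
      then have "L \<subseteq> L'" using L' assms(3) unfolding assms(6) by (intro lat_subset)
      then show False using assms by (auto simp add: nbs_def)
    qed
    then have "s *s z + (t / pw 1) *s (pw 1 *s u) \<in> lat z (pw 1 *s u)" using st by (intro lat_comb)
    then show "v \<in> lat z (pw 1 *s u)" by (simp add: st)
  qed
qed

lemma lat_in_nbs:
  assumes "dt z u \<noteq> 0"
  shows "lat z (pw 1 *s u) \<in> nbs (lat z u)"
proof -
  have d: "dt z (pw 1 *s u) \<noteq> 0" using assms by (simp add: dt_simps)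
  have L: "is_lattice (lat z u)" "is_lattice (lat z (pw 1 *s u))" using assms d by auto
  have p1: "pw (-1) \<notin> (valuation_ring :: 'a fls set)" by simp
  have "u \<notin> lat z (pw 1 *s u)"
    using p1 assms d by (auto simp add: in_lat_iff dt_simps pw_uminus field_simps)
  moreover have "lat z (pw 1 *s u) \<subseteq> lat z u"
    using L by (intro lat_subset lat_gen1 lattice_scale lat_gen2) auto
  moreover have "z \<notin> sc 1 (lat z u)"
    using p1 assms by (auto simp add: in_sc_iff in_lat_iff dt_simps)
  moreover have "sc 1 (lat z u) \<subseteq> lat z (pw 1 *s u)"
    unfolding sc_def scale_lat using L by (intro lat_subset lat_gen2 lattice_scale lat_gen1) auto
  ultimately show ?thesis
    using L lat_gen1[of z] lat_gen2[of u] by (auto simp add: nbs_def psubset_eq)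
qed

lemma lat_swap: "lat x y = lat y x"
  unfolding lat_def by (metis (no_types, opaque_lifting) add.commute)

lemma lat_shear: 
  assumes "dt x y \<noteq> 0" "c \<in> valuation_ring"
  shows "lat x (y + c *s x) = lat x y"
proof
  have L: "is_lattice (lat x y)" "is_lattice (lat x (y + c *s x))" using assms by (auto simp add: dt_simps)
  show "lat x (y + c *s x) \<subseteq> lat x y"
    using L assms by (intro lat_subset lattice_add lattice_scale lat_gen1 lat_gen2)
  have "y + c *s x - c *s x \<in> lat x (y + c *s x)"
    using L assms by (intro lattice_diff lattice_scale lat_gen1 lat_gen2)
  then show "lat x y \<subseteq> lat x (y + c *s x)" using L by (intro lat_subset lat_gen1) simp_all
qed

lemma nbs_lat:
  assumes d: "dt x y \<noteq> 0"
  shows "nbs (lat x y) = insert (lat x (pw 1 *s y)) (range (\<lambda>t. lat (y + fls_const t *s x) (pw 1 *s x)))"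
    and "lat x (pw 1 *s y) \<noteq> lat (y + fls_const t *s x) (pw 1 *s x)"
    and "inj (\<lambda>t. lat (y + fls_const t *s x) (pw 1 *s x))"
proof -
  let ?M = "lat x (pw 1 *s y)"
  let ?Lt = "\<lambda>t. lat (y + fls_const t *s x) (pw 1 *s x)"
  let ?L = "lat x y"
  have L: "is_lattice ?L" using d by auto
  have dt': "dt (y + fls_const t *s x) x \<noteq> 0" for t using d by (simp add: dt_simps dt_swap[of y x])
  have Lt: "?L = lat (y + fls_const t *s x) x" for t
    using lat_shear[OF d, of "fls_const t"] by (simp add: lat_swap)
  have in1: "?M \<in> nbs ?L" using lat_in_nbs d by blast
  have in2: "?Lt t \<in> nbs ?L" for t unfolding Lt[of t] by (rule lat_in_nbs) (rule dt')
  have p1: "pw (-1) \<notin> (valuation_ring :: 'a fls set)" by simp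
  have inLt: "v \<in> ?Lt t \<longleftrightarrow> dt v x / dt y x \<in> valuation_ring \<and> dt (y + fls_const t *s x) v / dt y x / pw 1 \<in> valuation_ring" for v t
  proof -
    have "dt (y + fls_const t *s x) (pw 1 *s x) \<noteq> 0" using dt' by (simp add: dt_simps)
    then show ?thesis by (simp add: in_lat_iff dt_simps ac_simps)
  qed
  have d': "dt y x \<noteq> 0" using d dt_swap[of y x] by simp
  show "?M \<noteq> ?Lt t" for t
  proof
    assume "?M = ?Lt t"
    then have "x \<in> ?Lt t" using lat_gen1 by blast
    then show False using p1 d' by (simp add: inLt dt_simps pw_uminus divide_inverse)
  qed
  show "inj ?Lt"
  proof (rule injI)
    fix s t assume "?Lt s = ?Lt t"
    then have "y + fls_const s *s x \<in> ?Lt t" using lat_gen1 by blast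
    then have "(fls_const (s - t)) / pw 1 \<in> valuation_ring"
      using d' by (simp add: inLt dt_simps dt_swap[of x y] diff_divide_distrib flip: fls_minus_const)
    then show "s = t" by (simp add: divide_pw_in_valuation_ring)
  qed
  have "L' \<in> insert ?M (range ?Lt)" if L': "L' \<in> nbs ?L" for L'
  proof -
    obtain z where z: "z \<in> L'" "z \<notin> sc 1 ?L" using L' by (auto simp add: nbs_def)
    have zL: "z \<in> ?L" using z L' by (auto simp add: nbs_def)
    then obtain s t where st: "z = s *s x + t *s y" "s \<in> valuation_ring" "t \<in> valuation_ring"
      by (auto simp add: lat_def)
    have "L' \<in> nbs (lat x y)" by fact
    have sub: "sc 1 ?L \<subseteq> L'" using L' by (auto simp add: nbs_def)
    have lL': "is_lattice L'" using L' nbs_lattice by blast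
    show ?thesis
    proof (cases "t / pw 1 \<in> valuation_ring")
      case True
      have "s / pw 1 \<notin> valuation_ring"
      proof
        assume "s / pw 1 \<in> valuation_ring"
        then have "(s / pw 1) *s x + (t / pw 1) *s y \<in> ?L" using True by (intro lat_comb)
        moreover have "(s / pw 1) *s x + (t / pw 1) *s y = pw (-1) *s z"
          by (simp add: st vector_add_ldistrib pw_uminus field_simps)
        ultimately show False using z by (simp add: in_sc_iff)
      qed
      then have s: "s \<noteq> 0" "inverse s \<in> valuation_ring" using unit_iff st by blast+
      have "pw 1 *s y \<in> sc 1 ?L" by (simp add: in_sc_scale_iff lat_gen2)
      then have "(t / pw 1) *s (pw 1 *s y) \<in> L'" using sub True lL' by - (rule lattice_scale, auto)
      then have "z - (t / pw 1) *s (pw 1 *s y) \<in> L'" using z lL' lattice_diff by blast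
      then have "s *s x \<in> L'" by (simp add: st)
      then have "inverse s *s (s *s x) \<in> L'" using s lL' by - (rule lattice_scale)
      then have "x \<in> L'" using s by simp
      moreover have "x \<notin> sc 1 ?L" using p1 d by (auto simp add: in_sc_iff in_lat_iff dt_simps)
      ultimately have "L' = ?M" using nbs_eq_lat[OF L L'] d by blast
      then show ?thesis by simp
    next
      case False
      then have t: "t \<noteq> 0" "inverse t \<in> valuation_ring" using unit_iff st by blast+
      define c where "c = inverse t * s"
      have c: "c \<in> valuation_ring" using t st by (auto simp add: c_def)
      define r where "r = c $$ 0"
      have r: "(c - fls_const r) / pw 1 \<in> valuation_ring"
        unfolding r_def using c by (rule valuation_ring_residue)
      have "inverse t *s z \<in> L'" using z t lL' by - (rule lattice_scale)
      moreover have "inverse t *s z = y + c *s x" using t by (simp add: st c_def vector_add_ldistrib add.commute)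
      moreover have "((c - fls_const r) / pw 1) *s (pw 1 *s x) \<in> L'"
      proof -
        have "pw 1 *s x \<in> sc 1 ?L" by (simp add: in_sc_scale_iff lat_gen1)
        then show ?thesis using sub r lL' by - (rule lattice_scale, auto)
      qed
      ultimately have "y + c *s x - ((c - fls_const r) / pw 1) *s (pw 1 *s x) \<in> L'"
        using lL' lattice_diff by metis
      moreover have "y + c *s x - ((c - fls_const r) / pw 1) *s (pw 1 *s x) = y + fls_const r *s x"
        by (simp add: vec2_eq_iff field_simps)
      ultimately have yr: "y + fls_const r *s x \<in> L'" by simp
      have "y + fls_const r *s x \<notin> sc 1 ?L"
        using p1 d' by (simp add: Lt[of r] in_sc_iff in_lat_iff[OF dt'] dt_simps)
      then have "L' = ?Lt r" using nbs_eq_lat[OF L L' yr _ dt' Lt] by blast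
      then show ?thesis by simp
    qed
  qed
  then show "nbs ?L = insert ?M (range ?Lt)" using in1 in2 by auto
qed

lemma finite_nbs: "is_lattice (L :: ('a::{field,finite} fls ^ 2) set) \<Longrightarrow> finite (nbs L)"
  by (auto simp add: is_lattice_iff nbs_lat(1))

lemma sum_nbs:
  fixes x y :: "'a::{field,finite} fls ^ 2"
  assumes "dt x y \<noteq> 0"
  shows "(\<Sum>L' \<in> nbs (lat x y). F L') =
    F (lat x (pw 1 *s y)) + (\<Sum>t\<in>UNIV. F (lat (y + fls_const t *s x) (pw 1 *s x)))"
proof -
  have "lat x (pw 1 *s y) \<notin> range (\<lambda>t. lat (y + fls_const t *s x) (pw 1 *s x))"
    using nbs_lat(2)[OF assms] by auto
  then show ?thesis
    unfolding nbs_lat(1)[OF assms] using nbs_lat(3)[OF assms] by (simp add: sum.reindex)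
qed

section \<open>The action of matrices\<close>

definition mact :: "'a::field poly ^ 2 ^ 2 \<Rightarrow> ('a fls ^ 2) set \<Rightarrow> ('a fls ^ 2) set" where
  "mact g L = (\<lambda>x. map_matrix embed_poly g *v x) ` L"

lemma map_matrix_embed_mult:
  "map_matrix embed_poly (g ** h) = map_matrix embed_poly g ** map_matrix embed_poly h" for g h :: "'a::field poly ^ 2 ^ 2"
  by (simp add: mat2_eq_iff mat2_mult_component map_matrix_def embed_poly_add embed_poly_mult)

lemma map_matrix_embed_one: "map_matrix embed_poly (mat 1 :: 'a::field poly ^ 2 ^ 2) = mat 1"
  by (simp add: mat2_eq_iff mat2_one_component map_matrix_def)

lemma det_map_matrix_embed: "det (map_matrix embed_poly g) = embed_poly (det g)" for g :: "'a::field poly ^ 2 ^ 2"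
  by (simp add: det_2 map_matrix_def embed_poly_diff embed_poly_mult)

lemma mact_mult: "mact (g ** h) L = mact g (mact h L)"
  by (simp add: mact_def map_matrix_embed_mult image_image matrix_vector_mul_assoc)

lemma mact_one [simp]: "mact (mat 1) L = L"
  by (simp add: mact_def map_matrix_embed_one)

lemma mact_lat: "mact g (lat x y) = lat (map_matrix embed_poly g *v x) (map_matrix embed_poly g *v y)"
proof -
  have "map_matrix embed_poly g *v (s *s x + t *s y) =
      s *s (map_matrix embed_poly g *v x) + t *s (map_matrix embed_poly g *v y)" for s t
    by (simp add: vec2_eq_iff mat2_vec_component algebra_simps)
  moreover have "mact g (lat x y) = {map_matrix embed_poly g *v (s *s x + t *s y) | s t. s \<in> valuation_ring \<and> t \<in> valuation_ring}"
    unfolding mact_def lat_def by blast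
  ultimately show ?thesis by (simp add: lat_def)
qed

lemma is_lattice_mact: "det g \<noteq> 0 \<Longrightarrow> is_lattice L \<Longrightarrow> is_lattice (mact g L)"
  by (auto simp add: is_lattice_iff mact_lat)
    (metis det_map_matrix_embed dt_matrix embed_poly_eq_0_iff mult_eq_0_iff)

lemma mact_scale: "mact g (scale_lattice c L) = scale_lattice c (mact g L)"
proof -
  have "map_matrix embed_poly g *v (c *s x) = c *s (map_matrix embed_poly g *v x)" for x
    by (simp add: vec2_eq_iff mat2_vec_component algebra_simps)
  then show ?thesis by (simp add: mact_def scale_lattice_def image_image)
qed

lemma mact_sc: "mact g (sc i L) = sc i (mact g L)"
  by (simp add: sc_def mact_scale)

lemma inj_embed_matrix: "det g \<noteq> 0 \<Longrightarrow> inj (\<lambda>x. map_matrix embed_poly g *v x)" for g :: "'a::field poly ^ 2 ^ 2"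
proof (rule injI)
  fix x y :: "'a fls ^ 2"
  let ?G = "map_matrix embed_poly g"
  assume d: "det g \<noteq> 0" and eq: "?G *v x = ?G *v y"
  have "det ?G \<noteq> 0" using d by (simp add: det_map_matrix_embed)
  then obtain H where "H ** ?G = mat 1" by (metis invertible_def invertible_det_nz)
  then have "x = H *v (?G *v x)" "y = H *v (?G *v y)" by (simp_all add: matrix_vector_mul_assoc)
  with eq show "x = y" by simp
qed

lemma mact_mem_iff: "det g \<noteq> 0 \<Longrightarrow> map_matrix embed_poly g *v x \<in> mact g L \<longleftrightarrow> x \<in> L"
  unfolding mact_def using inj_embed_matrix by (metis inj_image_mem_iff)

lemma inj_mact: "det g \<noteq> 0 \<Longrightarrow> inj (mact g)"
  unfolding mact_def by (rule inj_onI) (metis inj_embed_matrix inj_image_eq_iff)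

lemma mact_mono_iff: "det g \<noteq> 0 \<Longrightarrow> mact g L \<subseteq> mact g L' \<longleftrightarrow> L \<subseteq> L'"
  unfolding mact_def by (metis inj_embed_matrix inj_image_subset_iff)

lemma act_vertex_eq: "act_vertex g v = mact g ` v"
  by (simp add: act_vertex_def mact_def)

lemma act_homothety_class: "act_vertex g (homothety_class L) = homothety_class (mact g L)"
  unfolding act_vertex_eq homothety_class_def by (auto simp add: mact_scale image_iff) (metis mact_scale)

lemma act_vertex_mult: "act_vertex (g ** h) v = act_vertex g (act_vertex h v)"
  by (simp add: act_vertex_eq mact_mult image_image)

lemma act_vertex_one [simp]: "act_vertex (mat 1) v = v"
  by (simp add: act_vertex_eq)

lemma act_edge_mult: "act_edge (g ** h) e = act_edge g (act_edge h e)"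
  by (simp add: act_edge_def act_vertex_mult)

lemma act_edge_one [simp]: "act_edge (mat 1) e = e"
  by (simp add: act_edge_def)

lemma act_edge_pair [simp]: "act_edge g (v, w) = (act_vertex g v, act_vertex g w)"
  by (simp add: act_edge_def)

lemma inj_act_vertex: "det g \<noteq> 0 \<Longrightarrow> inj (act_vertex g)"
  unfolding act_vertex_eq using inj_mact by (metis (no_types, lifting) ext act_vertex_eq inj_image_eq_iff inj_onI)

lemma inj_act_edge: "det g \<noteq> 0 \<Longrightarrow> inj (act_edge g)"
  using inj_act_vertex by (auto simp add: inj_def act_edge_def prod_eq_iff)

lemma act_vertex_in_tree: "det g \<noteq> 0 \<Longrightarrow> v \<in> tree_vertices \<Longrightarrow> act_vertex g v \<in> tree_vertices"
  by (auto simp add: tree_vertices_def act_homothety_class intro: is_lattice_mact)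

definition adjm :: "'a::comm_ring_1 ^ 2 ^ 2 \<Rightarrow> 'a ^ 2 ^ 2" where
  "adjm g = vector [vector [g $ 2 $ 2, - g $ 1 $ 2], vector [- g $ 2 $ 1, g $ 1 $ 1]]"

lemma adjm_component [simp]: "adjm g $ 1 $ 1 = g $ 2 $ 2" "adjm g $ 1 $ 2 = - g $ 1 $ 2"
  "adjm g $ 2 $ 1 = - g $ 2 $ 1" "adjm g $ 2 $ 2 = g $ 1 $ 1"
  by (simp_all add: adjm_def)

lemma det_adjm [simp]: "det (adjm g) = det g"
  by (simp add: det_2 algebra_simps)

lemma mact_adjm: "mact (adjm g) (mact g L) = scale_lattice (embed_poly (det g)) L"
proof -
  have "map_matrix embed_poly (adjm g) *v (map_matrix embed_poly g *v x) = embed_poly (det g) *s x" for x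
    by (simp add: vec2_eq_iff mat2_vec_component map_matrix_def det_2 embed_poly_diff embed_poly_mult
        embed_poly_uminus algebra_simps)
  then show ?thesis by (simp add: mact_def scale_lattice_def image_image)
qed

lemma act_vertex_in_tree_iff: "det g \<noteq> 0 \<Longrightarrow> act_vertex g v \<in> tree_vertices \<longleftrightarrow> v \<in> tree_vertices"
proof
  assume d: "det g \<noteq> 0" and "act_vertex g v \<in> tree_vertices"
  then have "act_vertex (adjm g) (act_vertex g v) \<in> tree_vertices"
    using act_vertex_in_tree[of "adjm g"] by simp
  moreover have "act_vertex (adjm g) (act_vertex g v) = scale_lattice (embed_poly (det g)) ` v"
    by (simp add: act_vertex_eq image_image mact_adjm)
  ultimately obtain L where L: "is_lattice L" "scale_lattice (embed_poly (det g)) ` v = homothety_class L"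
    by (auto elim: tree_vertexE)
  let ?c = "embed_poly (det g)"
  have c: "?c \<noteq> 0" using d by simp
  have "v = scale_lattice (inverse ?c) ` (scale_lattice ?c ` v)"
    using c by (simp add: image_image scale_scale_lattice)
  also have "\<dots> = homothety_class L"
  proof
    show "scale_lattice (inverse ?c) ` scale_lattice ?c ` v \<subseteq> homothety_class L"
    proof
      fix M assume "M \<in> scale_lattice (inverse ?c) ` scale_lattice ?c ` v"
      then obtain b where b: "M = scale_lattice (inverse ?c) (scale_lattice b L)" "b \<noteq> 0"
        unfolding L(2) by (auto simp add: homothety_class_def)
      then have "M = scale_lattice (inverse ?c * b) L" "inverse ?c * b \<noteq> 0"
        using c by (simp_all add: scale_scale_lattice)
      then show "M \<in> homothety_class L" unfolding homothety_class_def by blast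
    qed
    show "homothety_class L \<subseteq> scale_lattice (inverse ?c) ` scale_lattice ?c ` v"
    proof
      fix M assume "M \<in> homothety_class L"
      then obtain b where b: "M = scale_lattice b L" "b \<noteq> 0" by (auto simp add: homothety_class_def)
      have "scale_lattice (?c * b) L \<in> homothety_class L"
        using b c by (auto simp add: homothety_class_def)
      moreover have "M = scale_lattice (inverse ?c) (scale_lattice (?c * b) L)"
        using b c by (simp add: scale_scale_lattice flip: mult.assoc)
      ultimately show "M \<in> scale_lattice (inverse ?c) ` scale_lattice ?c ` v" unfolding L(2) by blast
    qed
  qed
  finally show "v \<in> tree_vertices" using L(1) by auto
qed (use act_vertex_in_tree in blast)

lemma nbs_mact: "det g \<noteq> 0 \<Longrightarrow> L' \<in> nbs L \<Longrightarrow> mact g L' \<in> nbs (mact g L)"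
  by (auto simp add: nbs_def psubset_eq mact_mono_iff is_lattice_mact inj_mact inj_eq simp flip: mact_sc)

lemma act_edge_in_tree: "det g \<noteq> 0 \<Longrightarrow> e \<in> tree_edges \<Longrightarrow> act_edge g e \<in> tree_edges"
proof -
  assume d: "det g \<noteq> 0" and "e \<in> tree_edges"
  then obtain L L' where L: "is_lattice L" "L' \<in> nbs L" "e = (homothety_class L, homothety_class L')"
    by (metis prod.collapse tree_edgeE)
  then show ?thesis
    using d by (auto simp add: act_homothety_class tree_edge_iff is_lattice_mact intro: nbs_mact)
qed

lemma act_edge_in_tree_iff: "det g \<noteq> 0 \<Longrightarrow> act_edge g e \<in> tree_edges \<longleftrightarrow> e \<in> tree_edges"
proof
  assume d: "det g \<noteq> 0" and e: "act_edge g e \<in> tree_edges"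
  then have v: "fst e \<in> tree_vertices" "snd e \<in> tree_vertices"
    by (auto simp add: tree_edges_def act_edge_def act_vertex_in_tree_iff)
  then obtain L L' where L: "is_lattice L" "fst e = homothety_class L" "is_lattice L'" "snd e = homothety_class L'"
    by (auto elim!: tree_vertexE)
  have "act_edge (adjm g) (act_edge g e) \<in> tree_edges" using d e act_edge_in_tree[of "adjm g"] by simp
  moreover have "act_vertex (adjm g) (act_vertex g (homothety_class M)) = homothety_class M" if "is_lattice M" for M
    using that d by (simp add: act_homothety_class mact_adjm scale_unit homothety_class_sc)
  ultimately show "e \<in> tree_edges" using L by (cases e) (simp add: act_edge_def)
qed (use act_edge_in_tree in blast)

lemma bij_betw_star:
  assumes "det g \<noteq> 0" "v \<in> tree_vertices"
  shows "bij_betw (act_edge g) {e \<in> tree_edges. snd e = v} {e \<in> tree_edges. snd e = act_vertex g v}"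
proof (rule bij_betwI')
  show "act_edge g e = act_edge g e' \<longleftrightarrow> e = e'" for e e'
    using inj_act_edge[OF assms(1)] by (simp add: inj_eq)
  show "act_edge g e \<in> {e \<in> tree_edges. snd e = act_vertex g v}" if "e \<in> {e \<in> tree_edges. snd e = v}" for e
    using that assms act_edge_in_tree[of g e] by (simp add: act_edge_def)
  show "\<exists>e \<in> {e \<in> tree_edges. snd e = v}. e' = act_edge g e" if e': "e' \<in> {e \<in> tree_edges. snd e = act_vertex g v}" for e'
  proof -
    have inv: "act_vertex g (act_vertex (adjm g) u) = u" if "u \<in> tree_vertices" for u
    proof -
      have "adjm (adjm g) = g" by (simp add: mat2_eq_iff)
      then have e: "mact g (mact (adjm g) L) = scale_lattice (embed_poly (det g)) L" for L
        using mact_adjm[of "adjm g" L] by simp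
      obtain L where L: "is_lattice L" "u = homothety_class L" using \<open>u \<in> tree_vertices\<close> by (rule tree_vertexE)
      have "embed_poly (det g) \<noteq> 0" using assms(1) by simp
      have "homothety_class (scale_lattice (embed_poly (det g)) L) = homothety_class L"
        unfolding scale_unit[OF L(1) \<open>embed_poly (det g) \<noteq> 0\<close>] by (rule homothety_class_sc[OF L(1)])
      then show ?thesis by (simp only: L(2) act_homothety_class e)
    qed
    define e where "e = act_edge (adjm g) e'"
    have "act_edge g e = e'"
    proof -
      have "fst e' \<in> tree_vertices" "snd e' \<in> tree_vertices" using e' by (auto simp add: tree_edges_def)
      then show ?thesis using inv by (simp add: e_def act_edge_def)
    qed
    moreover have "e \<in> tree_edges"
      using e' \<open>act_edge g e = e'\<close> act_edge_in_tree_iff[OF assms(1), of e] by simp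
    moreover have "snd e = v"
    proof -
      have "act_vertex g (snd e) = act_vertex g v"
        using \<open>act_edge g e = e'\<close> e' unfolding act_edge_def by (metis (mono_tags) mem_Collect_eq snd_conv)
      then show ?thesis using inj_act_vertex[OF assms(1)] by (simp add: inj_eq)
    qed
    ultimately show ?thesis by blast
  qed
qed

section \<open>Polynomials over a field\<close>

lemma poly_bezout:
  fixes a b :: "'a::field poly"
  shows "\<exists>s t. (s * a + t * b) dvd a \<and> (s * a + t * b) dvd b"
proof (cases "a = 0 \<and> b = 0")
  case False
  define I where "I = {s * a + t * b | s t. True}"
  have "a = 1 * a + 0 * b" "b = 0 * a + 1 * b" by simp_all
  then have ab: "a \<in> I" "b \<in> I" unfolding I_def by blast+
  then obtain x0 where x0: "x0 \<in> I \<and> x0 \<noteq> 0" using False by blast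
  obtain h where h: "h \<in> I" "h \<noteq> 0" and min: "\<And>x. x \<in> I \<Longrightarrow> x \<noteq> 0 \<Longrightarrow> degree h \<le> degree x"
    using ex_has_least_nat[of "\<lambda>x. x \<in> I \<and> x \<noteq> 0", OF x0, of degree] by blast
  obtain s t where st: "h = s * a + t * b" using h(1) by (auto simp add: I_def)
  have "h dvd x" if "x \<in> I" for x
  proof -
    obtain u v where uv: "x = u * a + v * b" using \<open>x \<in> I\<close> by (auto simp add: I_def)
    have "x mod h = (u - x div h * s) * a + (v - x div h * t) * b"
      by (simp add: minus_div_mult_eq_mod[symmetric] st[symmetric]) (simp add: st uv algebra_simps)
    then have "x mod h \<in> I" unfolding I_def by blast
    moreover have "x mod h = 0 \<or> degree (x mod h) < degree h" by (rule degree_mod_less) (rule h(2))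
    ultimately have "x mod h = 0" using min by fastforce
    then show ?thesis by (simp add: dvd_eq_mod_eq_0)
  qed
  with ab st show ?thesis by metis
qed auto

lemma coprime_poly_bezout:
  fixes a b :: "'a::field poly"
  assumes "coprime a b"
  obtains s t where "s * a + t * b = 1"
proof -
  obtain s t where st: "(s * a + t * b) dvd a" "(s * a + t * b) dvd b" using poly_bezout by blast
  then have "is_unit (s * a + t * b)" using assms by (auto simp add: coprime_def)
  then obtain c where "(s * a + t * b) * c = 1" by (metis dvdE)
  then have "(c * s) * a + (c * t) * b = 1" by (simp add: algebra_simps)
  then show ?thesis by (rule that)
qed

lemma poly_prime_divisor:
  fixes m :: "'a::field poly"
  assumes "degree m > 0"
  obtains r where "lead_coeff r = 1" "prime_elem r" "r dvd m"
proof -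
  define S where "S = (\<lambda>x. x dvd m \<and> degree x > 0)"
  have "S m" using assms by (simp add: S_def)
  then obtain r0 where r0: "S r0" and min: "\<And>x. S x \<Longrightarrow> degree r0 \<le> degree x"
    using ex_has_least_nat[of S m degree] by blast
  define r where "r = smult (inverse (lead_coeff r0)) r0"
  have nz: "r0 \<noteq> 0" using r0 by (auto simp add: S_def)
  then have r: "lead_coeff r = 1" "degree r = degree r0" "r \<noteq> 0" by (simp_all add: r_def)
  have rm: "r dvd m" using r0 nz by (simp add: S_def r_def smult_dvd_iff)
  have "irreducible r"
  proof (rule irreducibleI)
    show "r \<noteq> 0" by (rule r(3))
    show "\<not> is_unit r" using r(2) r0 by (auto simp add: S_def is_unit_iff_degree nz r(3))
    fix a b assume ab: "r = a * b"
    then have nz': "a \<noteq> 0" "b \<noteq> 0" using r(3) by auto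
    have dvd: "a dvd m" "b dvd m" using ab rm by (meson dvd_mult_left dvd_mult_right dvd_refl dvd_trans dvd_triv_left dvd_triv_right)+
    have "degree r = degree a + degree b" using ab nz' by (simp add: degree_mult_eq)
    then have "degree a = 0 \<or> degree b = 0"
      using min[of a] min[of b] dvd r(2) unfolding S_def by fastforce
    then show "is_unit a \<or> is_unit b" using nz' by (auto simp add: is_unit_iff_degree)
  qed
  then show ?thesis using that r(1) rm field_poly_irreducible_imp_prime by blast
qed

lemma finite_poly_degree_le: "finite {P :: 'a::{zero,finite} poly. degree P \<le> n}"
proof (rule finite_subset)
  show "{P :: 'a poly. degree P \<le> n} \<subseteq> Poly ` {xs. set xs \<subseteq> UNIV \<and> length xs = Suc n}"
  proof
    fix P :: "'a poly" assume "P \<in> {P. degree P \<le> n}"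
    then have "P = Poly (map (coeff P) [0..<Suc n])"
      by (intro poly_eqI) (auto simp add: coeff_Poly_eq nth_default_def coeff_eq_0 simp del: upt_Suc)
    then show "P \<in> Poly ` {xs. set xs \<subseteq> UNIV \<and> length xs = Suc n}"
      by (intro image_eqI[of _ _ "map (coeff P) [0..<Suc n]"]) auto
  qed
  show "finite (Poly ` {xs :: 'a list. set xs \<subseteq> UNIV \<and> length xs = Suc n})"
    by (intro finite_imageI finite_lists_length_eq) simp
qed

section \<open>Congruence subgroups\<close>

lemma invertible_mat2_det_unit: "invertible g \<Longrightarrow> is_unit (det g)" for g :: "'a::field poly ^ 2 ^ 2"
  unfolding invertible_def by (metis det_I det_mul dvdI)

lemma mat2_adjm: "g ** adjm g = mat 1" "adjm g ** g = mat 1" if "det g = 1" for g :: "'a::comm_ring_1 ^ 2 ^ 2"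
  using that by (simp_all add: mat2_eq_iff mat2_mult_component mat2_one_component det_2 algebra_simps)

lemma Gamma0_det: "g \<in> Gamma0 n \<Longrightarrow> det g \<noteq> 0" and Gamma0_det_unit: "g \<in> Gamma0 n \<Longrightarrow> is_unit (det g)"
  using invertible_mat2_det_unit by (fastforce simp add: Gamma0_def)+

lemma Gamma0_one [simp]: "mat 1 \<in> Gamma0 n"
  by (auto simp add: Gamma0_def mat2_one_component invertible_def)

lemma Gamma0_mult: "g \<in> Gamma0 n \<Longrightarrow> h \<in> Gamma0 n \<Longrightarrow> g ** h \<in> Gamma0 n"
  by (auto simp add: Gamma0_def mat2_mult_component invertible_mult)

lemma Gamma0_inverse:
  assumes "g \<in> Gamma0 n"
  obtains h where "h \<in> Gamma0 n" "g ** h = mat 1" "h ** g = mat 1"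
proof -
  obtain h where h: "g ** h = mat 1" "h ** g = mat 1"
    using assms by (auto simp add: Gamma0_def invertible_def)
  have e: "h $ 1 $ 1 * g $ 1 $ 1 + h $ 1 $ 2 * g $ 2 $ 1 = 1"
    "h $ 2 $ 1 * g $ 1 $ 1 + h $ 2 $ 2 * g $ 2 $ 1 = 0"
    using h(2) by (simp_all add: mat2_eq_iff mat2_mult_component mat2_one_component)
  have "h $ 2 $ 1 = h $ 2 $ 1 * (h $ 1 $ 1 * g $ 1 $ 1 + h $ 1 $ 2 * g $ 2 $ 1)" using e(1) by simp
  also have "\<dots> = h $ 1 $ 1 * (h $ 2 $ 1 * g $ 1 $ 1) + h $ 2 $ 1 * h $ 1 $ 2 * g $ 2 $ 1"
    by (simp add: algebra_simps)
  also have "h $ 2 $ 1 * g $ 1 $ 1 = - (h $ 2 $ 2 * g $ 2 $ 1)" using e(2) by (simp add: eq_neg_iff_add_eq_0)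
  finally have "h $ 2 $ 1 = g $ 2 $ 1 * (h $ 2 $ 1 * h $ 1 $ 2 - h $ 1 $ 1 * h $ 2 $ 2)"
    by (simp add: algebra_simps)
  then have "n dvd h $ 2 $ 1" using assms by (metis (no_types, lifting) Gamma0_def dvd_mult2 mem_Collect_eq)
  moreover have "invertible h" using h unfolding invertible_def by blast
  ultimately show ?thesis using h that by (auto simp add: Gamma0_def)
qed

lemma Gamma0_mono: "d dvd n \<Longrightarrow> Gamma0 n \<subseteq> Gamma0 d"
  by (auto simp add: Gamma0_def)

lemma Gamma0_det1: "det g = 1 \<Longrightarrow> n dvd g $ 2 $ 1 \<Longrightarrow> g \<in> Gamma0 n"
  using mat2_adjm[of g] by (auto simp add: Gamma0_def invertible_def)

lemma act_edge_inverse: "h ** g = mat 1 \<Longrightarrow> act_edge h (act_edge g e) = e"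
  by (simp flip: act_edge_mult)

lemma act_vertex_inverse: "h ** g = mat 1 \<Longrightarrow> act_vertex h (act_vertex g v) = v"
  by (simp flip: act_vertex_mult)

section \<open>Successive minima\<close>

definition Lam :: "'a::field poly \<Rightarrow> ('a fls ^ 2) set" where
  "Lam d = {x. \<exists>a b. x $ 1 = embed_poly a \<and> x $ 2 = embed_poly (d * b)}"

lemma LamI: "x $ 1 = embed_poly a \<Longrightarrow> x $ 2 = embed_poly (d * b) \<Longrightarrow> x \<in> Lam d"
  by (auto simp add: Lam_def)

lemma Lam_0 [simp]: "0 \<in> Lam d"
  by (rule LamI[of _ 0 _ 0]) simp_all

lemma Lam_add: "x \<in> Lam d \<Longrightarrow> y \<in> Lam d \<Longrightarrow> x + y \<in> Lam d"
  unfolding Lam_def by (auto simp add: simp flip: embed_poly_add distrib_left)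

lemma Lam_scale: "x \<in> Lam d \<Longrightarrow> embed_poly a *s x \<in> Lam d"
  unfolding Lam_def by (auto simp add: mult.left_commute simp flip: embed_poly_mult)

lemma Lam_scale_const: "x \<in> Lam d \<Longrightarrow> fls_const c *s x \<in> Lam d"
  using Lam_scale[of x d "[:c:]"] by simp

lemma Lam_mono: "d dvd d' \<Longrightarrow> Lam d' \<subseteq> Lam d"
  unfolding Lam_def by (auto simp add: dvd_def mult.assoc)

lemma Lam_1_iff: "x \<in> Lam 1 \<longleftrightarrow> (\<exists>a b. x = vector [embed_poly a, embed_poly b])"
  by (auto simp add: Lam_def vec2_eq_iff)

lemma Lam_subset_1: "Lam d \<subseteq> Lam 1"
  by (rule Lam_mono) simp

lemma Lam_Gamma0: "g \<in> Gamma0 d \<Longrightarrow> x \<in> Lam d \<Longrightarrow> map_matrix embed_poly g *v x \<in> Lam d"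
proof -
  assume g: "g \<in> Gamma0 d" and "x \<in> Lam d"
  then obtain a b where x: "x $ 1 = embed_poly a" "x $ 2 = embed_poly (d * b)" by (auto simp add: Lam_def)
  obtain c where c: "g $ 2 $ 1 = d * c" using g by (auto simp add: Gamma0_def)
  show ?thesis
  proof (rule LamI)
    show "(map_matrix embed_poly g *v x) $ 1 = embed_poly (g $ 1 $ 1 * a + g $ 1 $ 2 * (d * b))"
      by (simp add: mat2_vec_component map_matrix_def x embed_poly_add embed_poly_mult)
    show "(map_matrix embed_poly g *v x) $ 2 = embed_poly (d * (c * a + g $ 2 $ 2 * b))"
      by (simp add: mat2_vec_component map_matrix_def x c embed_poly_add embed_poly_mult algebra_simps)
  qed
qed

lemma lattice_bounded:
  assumes "is_lattice L"
  obtains B where "\<And>z i. z \<in> L \<Longrightarrow> z $ i / pw B \<in> valuation_ring"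
proof -
  obtain x y where L: "dt x y \<noteq> 0" "L = lat x y" using assms by (auto simp add: is_lattice_iff)
  define B where "B = Min (fls_subdegree ` {x $ 1, x $ 2, y $ 1, y $ 2})"
  have "B \<le> fls_subdegree (x $ i)" "B \<le> fls_subdegree (y $ i)" for i
    using exhaust_2[of i] unfolding B_def by (auto intro!: Min_le)
  then have b: "x $ i / pw B \<in> valuation_ring" "y $ i / pw B \<in> valuation_ring" for i
    by (simp_all add: divide_pw_in_valuation_ring)
  have "z $ i / pw B \<in> valuation_ring" if "z \<in> L" for z i
  proof -
    obtain s t where st: "z = s *s x + t *s y" "s \<in> valuation_ring" "t \<in> valuation_ring"
      using \<open>z \<in> L\<close> by (auto simp add: L lat_def)
    have "z $ i / pw B = s * (x $ i / pw B) + t * (y $ i / pw B)" by (simp add: st add_divide_distrib)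
    also have "\<dots> \<in> valuation_ring" using b st by blast
    finally show ?thesis .
  qed
  then show ?thesis by (rule that)
qed

lemma finite_Lam_lattice:
  fixes L :: "('a::{field,finite} fls ^ 2) set"
  assumes "is_lattice L"
  shows "finite (Lam d \<inter> L)"
proof -
  obtain B where B: "\<And>z i. z \<in> L \<Longrightarrow> z $ i / pw B \<in> valuation_ring" using assms by (rule lattice_bounded) blast
  let ?S = "{P :: 'a poly. degree P \<le> nat (- B)}"
  have "Lam d \<inter> L \<subseteq> (\<lambda>(a, b). vector [embed_poly a, embed_poly b]) ` (?S \<times> ?S)"
  proof
    fix z assume z: "z \<in> Lam d \<inter> L"
    then obtain a b where ab: "z = vector [embed_poly a, embed_poly b]" using Lam_subset_1 Lam_1_iff by blast
    have "degree a \<le> nat (- B)" "degree b \<le> nat (- B)"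
      using B[of z 1] B[of z 2] z by (auto simp add: ab divide_pw_in_valuation_ring embed_poly_subdegree)
    then show "z \<in> (\<lambda>(a, b). vector [embed_poly a, embed_poly b]) ` (?S \<times> ?S)" using ab by auto
  qed
  moreover have "finite ((\<lambda>(a, b). vector [embed_poly a, embed_poly b] :: 'a fls ^ 2) ` (?S \<times> ?S))"
    by (intro finite_imageI finite_cartesian_product finite_poly_degree_le)
  ultimately show ?thesis by (rule finite_subset)
qed

definition Mx :: "'a::field poly \<Rightarrow> ('a fls ^ 2) set \<Rightarrow> int" where
  "Mx d L = (THE i. (\<exists>w \<in> Lam d. w \<noteq> 0 \<and> w \<in> sc i L) \<and> \<not> (\<exists>w \<in> Lam d. w \<noteq> 0 \<and> w \<in> sc (i + 1) L))"

lemma le_Mx_iff: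
  fixes L :: "('a::{field,finite} fls ^ 2) set"
  assumes L: "is_lattice L"
  shows "i \<le> Mx d L \<longleftrightarrow> (\<exists>w \<in> Lam d. w \<noteq> 0 \<and> w \<in> sc i L)"
proof -
  define P where "P = (\<lambda>i. \<exists>w \<in> Lam d. w \<noteq> 0 \<and> w \<in> sc i L)"
  have mono: "P i" if "P j" "i \<le> j" for i j
    using that sc_antimono[OF L] unfolding P_def by blast
  have e1: "(vector [1, 0] :: 'a fls ^ 2) \<in> Lam d" "(vector [1, 0] :: 'a fls ^ 2) \<noteq> 0"
    by (auto intro: LamI[of _ 1 _ 0] simp add: vec2_eq_iff)
  obtain i0 where i0: "P i0" using ex_sc[OF L, of "vector [1, 0]"] e1 unfolding P_def by blast
  have "\<exists>k. \<not> P k"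
  proof -
    let ?S = "Lam d \<inter> L - {0}"
    have "\<forall>z \<in> ?S. \<exists>i. \<forall>j\<ge>i. z \<notin> sc j L" using not_in_sc[OF L] by blast
    then obtain h where h: "\<forall>z \<in> ?S. \<forall>j\<ge>h z. z \<notin> sc j L" by metis
    define k where "k = Max (insert 0 (h ` ?S))"
    have fin: "finite (insert 0 (h ` ?S))" using finite_Lam_lattice[OF L] by simp
    have k: "0 \<le> k" "\<forall>z \<in> ?S. h z \<le> k"
      unfolding k_def using fin by (auto intro: Max_ge)
    have "\<not> P k"
    proof
      assume "P k"
      then obtain w where w: "w \<in> Lam d" "w \<noteq> 0" "w \<in> sc k L" unfolding P_def by blast
      then have "w \<in> L" using sc_antimono[OF L k(1)] by auto
      with w h k show False by blast
    qed
    then show ?thesis ..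
  qed
  then obtain k where k: "\<not> P k" ..
  have ik: "i0 \<le> k" using mono i0 k by (meson linorder_le_cases)
  have "\<exists>j. P j \<and> \<not> P (j + 1)"
  proof (rule ccontr)
    assume c: "\<not> ?thesis"
    have "P j" if "i0 \<le> j" for j using that
      by (induction j rule: int_ge_induct) (use i0 c in auto)
    with k ik show False by blast
  qed
  then obtain j where j: "P j" "\<not> P (j + 1)" by blast
  have u: "j' = j" if "P j'" "\<not> P (j' + 1)" for j'
  proof (rule antisym)
    show "j' \<le> j" using that(1) j(2) mono[of j' "j + 1"] by linarith
    show "j \<le> j'" using that(2) j(1) mono[of j "j' + 1"] by linarith
  qed
  have "(THE i. P i \<and> \<not> P (i + 1)) = j" by (rule the_equality) (use j u in blast)+
  then have "Mx d L = j" by (simp only: Mx_def P_def)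
  have "i \<le> j \<longleftrightarrow> P i"
  proof
    show "P i" if "i \<le> j" using mono[OF j(1) that] .
    show "i \<le> j" if "P i" using mono[OF that, of "j + 1"] j(2) by linarith
  qed
  with \<open>Mx d L = j\<close> show ?thesis unfolding P_def by simp
qed

lemma Mx_witness:
  fixes L :: "('a::{field,finite} fls ^ 2) set"
  assumes "is_lattice L"
  obtains w where "w \<in> Lam d" "w \<noteq> 0" "w \<in> sc (Mx d L) L"
  using le_Mx_iff[OF assms, of "Mx d L" d] by auto

lemma not_Mx:
  fixes L :: "('a::{field,finite} fls ^ 2) set"
  assumes "is_lattice L" "w \<in> Lam d" "w \<in> sc (Mx d L + 1) L"
  shows "w = 0"
  using le_Mx_iff[OF assms(1), of "Mx d L + 1" d] assms by auto

lemma Mx_eqI: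
  assumes "\<And>i. i \<le> Mx d L \<longleftrightarrow> i \<le> j"
  shows "Mx d L = j"
  using assms[of j] assms[of "Mx d L"] by simp

lemma Mx_sc:
  fixes L :: "('a::{field,finite} fls ^ 2) set"
  shows "is_lattice L \<Longrightarrow> Mx d (sc j L) = Mx d L - j"
  by (rule Mx_eqI) (simp add: le_Mx_iff is_lattice_sc sc_sc le_diff_eq)

lemma Mx_mact:
  fixes L :: "('a::{field,finite} fls ^ 2) set"
  assumes g: "g \<in> Gamma0 d" and L: "is_lattice L"
  shows "Mx d (mact g L) = Mx d L"
proof (rule Mx_eqI)
  fix i
  obtain h where h: "h \<in> Gamma0 d" "g ** h = mat 1" "h ** g = mat 1" using g by (rule Gamma0_inverse)
  let ?g = "map_matrix embed_poly g" and ?h = "map_matrix embed_poly h"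
  have hg: "?h *v (?g *v w) = w" "?g *v (?h *v w) = w" for w
    using h(2,3) by (simp_all add: matrix_vector_mul_assoc map_matrix_embed_one flip: map_matrix_embed_mult)
  have g0: "?g *v 0 = 0" "?h *v 0 = 0" by (simp_all add: vec2_eq_iff mat2_vec_component)
  have iff: "?g *v w \<in> sc i (mact g L) \<longleftrightarrow> w \<in> sc i L" for w
    using Gamma0_det[OF g] by (simp add: mact_mem_iff flip: mact_sc)
  have "(\<exists>w \<in> Lam d. w \<noteq> 0 \<and> w \<in> sc i (mact g L)) \<longleftrightarrow> (\<exists>w \<in> Lam d. w \<noteq> 0 \<and> w \<in> sc i L)"
    using iff hg g0 Lam_Gamma0[OF g] Lam_Gamma0[OF h(1)] by metis
  then show "i \<le> Mx d (mact g L) \<longleftrightarrow> i \<le> Mx d L"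
    using L is_lattice_mact[OF Gamma0_det[OF g] L] by (simp add: le_Mx_iff)
qed

lemma act_vertex_eq_imp:
  fixes L :: "('a::{field,finite} fls ^ 2) set"
  assumes g: "g \<in> Gamma0 n" and L: "is_lattice L" "is_lattice L'"
    and eq: "act_vertex g (homothety_class L) = homothety_class L'"
  shows "mact g L = sc (Mx 1 L' - Mx 1 L) L'"
proof -
  have gL: "is_lattice (mact g L)" using g L Gamma0_det is_lattice_mact by blast
  have "homothety_class L' = homothety_class (mact g L)" using eq by (simp add: act_homothety_class)
  then obtain i where i: "mact g L = sc i L'" using gL L homothety_class_eq_iff by blast
  have "Mx 1 (mact g L) = Mx 1 L" using g L Gamma0_mono[of 1 n] by (intro Mx_mact) auto
  then have "i = Mx 1 L' - Mx 1 L" using L by (simp add: i Mx_sc)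
  with i show ?thesis by simp
qed

lemma finite_transporter:
  fixes v v' :: "'a::{field,finite} tree_vertex"
  assumes v: "v \<in> tree_vertices" "v' \<in> tree_vertices"
  shows "finite {g \<in> Gamma0 n. act_vertex g v = v'}"
proof -
  obtain L where L: "is_lattice L" "v = homothety_class L" using v(1) by (rule tree_vertexE)
  obtain L' where L': "is_lattice L'" "v' = homothety_class L'" using v(2) by (rule tree_vertexE)
  define i where "i = Mx 1 L' - Mx 1 L"
  obtain j1 where j1: "vector [1, 0] \<in> sc j1 L" using ex_sc[OF L(1)] by blast
  obtain j2 where j2: "vector [0, 1] \<in> sc j2 L" using ex_sc[OF L(1)] by blast
  let ?F = "\<lambda>g. (map_matrix embed_poly g *v vector [1, 0], map_matrix embed_poly g *v vector [0, 1])"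
  have "inj_on ?F {g \<in> Gamma0 n. act_vertex g v = v'}"
    by (rule inj_onI) (simp add: mat2_eq_iff vec2_eq_iff mat2_vec_component map_matrix_def)
  moreover have "?F ` {g \<in> Gamma0 n. act_vertex g v = v'} \<subseteq> (Lam 1 \<inter> sc (j1 + i) L') \<times> (Lam 1 \<inter> sc (j2 + i) L')"
  proof
    fix z assume "z \<in> ?F ` {g \<in> Gamma0 n. act_vertex g v = v'}"
    then obtain g where g: "g \<in> Gamma0 n" "act_vertex g v = v'" "z = ?F g" by blast
    have "mact g L = sc i L'" using g L L' act_vertex_eq_imp unfolding i_def by blast
    then have s: "mact g (sc j L) = sc (j + i) L'" for j by (simp add: mact_sc sc_sc)
    have "map_matrix embed_poly g *v vector [1, 0] \<in> mact g (sc j1 L)"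
      "map_matrix embed_poly g *v vector [0, 1] \<in> mact g (sc j2 L)" using j1 j2 by (auto simp add: mact_def)
    moreover have "map_matrix embed_poly g *v vector [1, 0] \<in> Lam 1" "map_matrix embed_poly g *v vector [0, 1] \<in> Lam 1"
      by (auto simp add: Lam_1_iff vec2_eq_iff mat2_vec_component map_matrix_def)
    ultimately show "z \<in> (Lam 1 \<inter> sc (j1 + i) L') \<times> (Lam 1 \<inter> sc (j2 + i) L')" using g(3) s by auto
  qed
  moreover have "finite ((Lam 1 \<inter> sc (j1 + i) L') \<times> (Lam 1 \<inter> sc (j2 + i) L'))"
    using L' by (intro finite_cartesian_product finite_Lam_lattice is_lattice_sc)
  ultimately show ?thesis using finite_imageD finite_subset by blast
qed

section \<open>Reduction theory\<close>

definition Vc :: "int \<Rightarrow> ('a::field fls ^ 2) set" where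
  "Vc c = lat (vector [1, 0]) (vector [0, pw c])"

lemma is_lattice_Vc [simp]: "is_lattice (Vc c)"
  unfolding Vc_def by (rule is_lattice_lat) (simp add: dt_def)

lemma in_Vc_iff: "z \<in> Vc c \<longleftrightarrow> z $ 1 \<in> valuation_ring \<and> z $ 2 / pw c \<in> valuation_ring"
  unfolding Vc_def by (subst in_lat_iff) (auto simp add: dt_def)

lemma reduction:
  fixes L :: "('a::{field,finite} fls ^ 2) set"
  assumes L: "is_lattice L"
  obtains g i c where "g \<in> Gamma0 1" "0 \<le> c" "L = sc i (mact g (Vc c))"
proof -
  define M where "M = Mx 1 L"
  obtain w where w: "w \<in> Lam 1" "w \<noteq> 0" "w \<in> sc M L" unfolding M_def using L by (rule Mx_witness)
  obtain a b where ab: "w = vector [embed_poly a, embed_poly b]" using w(1) Lam_1_iff by blast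
  obtain s t where h: "(s * a + t * b) dvd a" "(s * a + t * b) dvd b" using poly_bezout by blast
  define h where "h = s * a + t * b"
  obtain a' b' where a': "a = h * a'" "b = h * b'" using h unfolding h_def by (auto elim!: dvdE)
  have h0: "h \<noteq> 0" using w(2) a' by (auto simp add: ab vec2_eq_iff)
  have "degree h = 0"
  proof (rule ccontr)
    assume "degree h \<noteq> 0"
    define w' where "w' = (vector [embed_poly a', embed_poly b'] :: 'a fls ^ 2)"
    have e: "w = embed_poly h *s w'" by (simp add: ab w'_def vec2_eq_iff a' embed_poly_mult)
    have "w' \<in> Lam 1" unfolding w'_def Lam_1_iff by blast
    moreover have "w' \<in> sc (M + 1) L"
    proof -
      have "w' \<in> scale_lattice (inverse (embed_poly h)) (sc M L)"
        using w(3) h0 by (simp add: scale_lattice_iff e)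
      also have "\<dots> = sc (int (degree h) + M) L"
        using L h0 by (simp add: scale_unit is_lattice_sc sc_sc embed_poly_subdegree)
      also have "\<dots> \<subseteq> sc (M + 1) L" using \<open>degree h \<noteq> 0\<close> by (intro sc_antimono L) auto
      finally show ?thesis .
    qed
    ultimately have "w' = 0" using not_Mx[OF L] unfolding M_def by blast
    then show False using w(2) e by simp
  qed
  then have "is_unit h" using h0 by (simp add: is_unit_iff_degree)
  then obtain u where u: "1 = h * u" by (rule dvdE)
  define g :: "'a poly ^ 2 ^ 2" where "g = vector [vector [a, - (u * t)], vector [b, u * s]]"
  have "det g = 1" using u by (simp add: g_def det_2 h_def algebra_simps)
  then have g: "g \<in> Gamma0 1" "adjm g \<in> Gamma0 1" "det g \<noteq> 0" "det (adjm g) \<noteq> 0" by (auto intro!: Gamma0_det1)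
  define L1 where "L1 = mact (adjm g) (sc M L)"
  have L1: "is_lattice L1" unfolding L1_def using g L by (intro is_lattice_mact is_lattice_sc)
  have gL1: "mact g L1 = sc M L" using mat2_adjm(1)[OF \<open>det g = 1\<close>] by (simp add: L1_def flip: mact_mult)
  have ge1: "map_matrix embed_poly g *v vector [1, 0] = w"
    by (simp add: vec2_eq_iff mat2_vec_component g_def ab map_matrix_def)
  have e1: "vector [1, 0] \<in> L1" using w(3) mact_mem_iff[OF g(3), of "vector [1, 0]" L1] unfolding gL1 ge1 by simp
  have min: "z = 0" if "z \<in> Lam 1" "z \<in> sc 1 L1" for z
  proof -
    have "Mx 1 L1 = 0" using Mx_mact[OF g(2), of "sc M L"] L by (simp add: L1_def Mx_sc is_lattice_sc M_def)
    then show ?thesis using not_Mx[OF L1, of z 1] that by simp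
  qed
  have "vector [1, 0] \<notin> sc 1 L1"
  proof
    assume *: "vector [1, 0] \<in> sc 1 L1"
    have "vector [1, 0] = (0 :: 'a fls ^ 2)" by (rule min) (use * in \<open>auto intro: LamI[of _ 1 _ 0]\<close>)
    then show False by (simp add: vec2_eq_iff)
  qed
  then obtain y where y: "dt (vector [1, 0]) y \<noteq> 0" "L1 = lat (vector [1, 0]) y"
    using lattice_basis[OF L1 e1] by blast
  have y2: "y $ 2 \<noteq> 0" using y(1) by (simp add: dt_def)
  define c where "c = fls_subdegree (y $ 2)"
  obtain P where P: "(y $ 1 / y $ 2 - embed_poly P) / pw 1 \<in> valuation_ring" using embed_poly_part by blast
  define r where "r = y $ 1 / y $ 2 - embed_poly P"
  have r: "r / pw 1 \<in> valuation_ring" "r \<in> valuation_ring" using P divide_X_imp unfolding r_def by blast+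
  have c0: "0 \<le> c"
  proof (rule ccontr)
    assume "\<not> 0 \<le> c"
    define z :: "'a fls ^ 2" where "z = vector [embed_poly P, 1]"
    have z: "z = inverse (y $ 2) *s y - r *s vector [1, 0]"
      using y2 by (simp add: vec2_eq_iff z_def r_def field_simps)
    have "inverse (y $ 2) *s y \<in> scale_lattice (inverse (y $ 2)) L1"
      using y2 by (simp add: scale_lattice_iff y(2) lat_gen2)
    also have "\<dots> = sc (- c) L1" using y2 L1 by (simp add: scale_unit c_def)
    also have "\<dots> \<subseteq> sc 1 L1" using \<open>\<not> 0 \<le> c\<close> by (intro sc_antimono L1) simp
    finally have i1: "inverse (y $ 2) *s y \<in> sc 1 L1" .
    have "(r / pw 1) *s vector [1, 0] \<in> L1" using r e1 L1 by - (rule lattice_scale)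
    then have "r *s vector [1, 0] \<in> sc 1 L1" by (simp add: in_sc_iff pw_uminus divide_inverse mult.commute)
    with i1 have "z \<in> sc 1 L1" unfolding z by (intro lattice_diff is_lattice_sc L1)
    moreover have "z \<in> Lam 1" by (rule LamI[of _ P _ 1]) (simp_all add: z_def)
    ultimately have "z = 0" using min by blast
    then show False by (simp add: z_def vec2_eq_iff)
  qed
  define \<delta> :: "'a poly ^ 2 ^ 2" where "\<delta> = vector [vector [1, P], vector [0, 1]]"
  have "det \<delta> = 1" by (simp add: \<delta>_def det_2)
  then have \<delta>: "\<delta> \<in> Gamma0 1" by (rule Gamma0_det1) simp
  have "L1 = mact \<delta> (Vc c)"
  proof -
    define e1 :: "'a fls ^ 2" where "e1 = vector [1, 0]"
    define y' :: "'a fls ^ 2" where "y' = vector [0, y $ 2]"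
    have d: "dt e1 y' \<noteq> 0" using y2 by (simp add: dt_def e1_def y'_def)
    have "Vc c = lat e1 y'"
    proof (rule Set.set_eqI)
      fix z :: "'a fls ^ 2"
      have eq: "z $ 2 / pw c \<in> valuation_ring \<longleftrightarrow> z $ 2 / y $ 2 \<in> valuation_ring"
        using y2 unfolding divide_pw_in_valuation_ring c_def
        by (cases "z $ 2 = 0") (auto simp add: valuation_ring_def fls_divide_subdegree)
      show "z \<in> Vc c \<longleftrightarrow> z \<in> lat e1 y'"
        using y2 unfolding in_Vc_iff in_lat_iff[OF d] by (auto simp add: eq dt_def e1_def y'_def)
    qed
    also have "\<dots> = lat e1 (y' + (r * y $ 2) *s e1)"
    proof -
      have "y $ 2 \<in> valuation_ring" using c0 by (simp add: c_def valuation_ring_def)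
      with r(2) have "r * y $ 2 \<in> valuation_ring" by (rule valuation_ring_mult)
      then show ?thesis by (rule lat_shear[OF d, symmetric])
    qed
    finally have V: "Vc c = lat e1 (y' + (r * y $ 2) *s e1)" .
    have m: "map_matrix embed_poly \<delta> *v e1 = e1" "map_matrix embed_poly \<delta> *v (y' + (r * y $ 2) *s e1) = y"
      using y2 by (simp_all add: vec2_eq_iff mat2_vec_component map_matrix_def \<delta>_def e1_def y'_def r_def field_simps)
    show ?thesis unfolding V mact_lat m using y(2) by (simp add: e1_def)
  qed
  then have "sc M L = mact (g ** \<delta>) (Vc c)" using gL1 by (simp add: mact_mult)
  then have "sc (- M) (sc M L) = sc (- M) (mact (g ** \<delta>) (Vc c))" by simp
  then have "L = sc (- M) (mact (g ** \<delta>) (Vc c))" unfolding sc_sc by simp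
  then show ?thesis using that Gamma0_mult[OF g(1) \<delta>] c0 by blast
qed

lemma tree_vertex_reduction:
  fixes v :: "'a::{field,finite} tree_vertex"
  assumes "v \<in> tree_vertices"
  obtains g c where "g \<in> Gamma0 1" "0 \<le> c" "v = act_vertex g (homothety_class (Vc c))"
proof -
  obtain L where L: "is_lattice L" "v = homothety_class L" using assms by (rule tree_vertexE)
  obtain g i c where g: "g \<in> Gamma0 1" "0 \<le> c" "L = sc i (mact g (Vc c))" using L(1) by (rule reduction)
  have "v = act_vertex g (homothety_class (Vc c))"
    using g Gamma0_det[OF g(1)] by (simp add: L(2) act_homothety_class homothety_class_sc is_lattice_mact)
  with g that show ?thesis by blast
qed

lemma Gamma0_finite_index:
  fixes n :: "'a::{field,finite} poly"
  assumes n: "n \<noteq> 0"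
  obtains R where "finite R" "R \<subseteq> Gamma0 1" "\<And>g. g \<in> Gamma0 1 \<Longrightarrow> \<exists>d \<in> Gamma0 n. \<exists>h \<in> R. g = d ** h"
proof -
  define red where "red = (\<lambda>g :: 'a poly ^ 2 ^ 2. (g $ 1 $ 1 mod n, g $ 1 $ 2 mod n, g $ 2 $ 1 mod n, g $ 2 $ 2 mod n))"
  let ?S = "{P :: 'a poly. degree P \<le> degree n}"
  have deg: "degree (P mod n) \<le> degree n" for P
    using degree_mod_less[OF n, of P] by auto
  have "red ` Gamma0 1 \<subseteq> ?S \<times> ?S \<times> ?S \<times> ?S" unfolding red_def using deg by auto
  moreover have "finite (?S \<times> ?S \<times> ?S \<times> ?S)" by (intro finite_cartesian_product finite_poly_degree_le)
  ultimately have fin: "finite (red ` Gamma0 1)" by (rule finite_subset)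
  define rep where "rep = (\<lambda>x. SOME g. g \<in> Gamma0 1 \<and> red g = x)"
  have rep: "rep (red g) \<in> Gamma0 1 \<and> red (rep (red g)) = red g" if "g \<in> Gamma0 1" for g
    unfolding rep_def by (rule someI[of _ g]) (use that in simp)
  show ?thesis
  proof (rule that[of "rep ` red ` Gamma0 1"])
    show "finite (rep ` red ` Gamma0 1)" using fin by simp
    show "rep ` red ` Gamma0 1 \<subseteq> Gamma0 1" using rep by blast
    fix g assume g: "g \<in> Gamma0 (1 :: 'a poly)"
    define h where "h = rep (red g)"
    have h: "h \<in> Gamma0 1" "red h = red g" using rep[OF g] by (simp_all add: h_def)
    obtain h' where h': "h' \<in> Gamma0 1" "h ** h' = mat 1" "h' ** h = mat 1" using h(1) by (rule Gamma0_inverse)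
    have "g = (g ** h') ** h" using h'(3) by (simp flip: matrix_mul_assoc)
    moreover have "g ** h' \<in> Gamma0 n"
    proof -
      have "(g ** h') \<in> Gamma0 1" using g h' by (intro Gamma0_mult)
      moreover have "n dvd (g ** h') $ 2 $ 1"
      proof -
        have "n dvd g $ 2 $ 1 - h $ 2 $ 1" "n dvd g $ 2 $ 2 - h $ 2 $ 2"
          using h(2)[symmetric] by (auto simp add: red_def mod_eq_dvd_iff)
        then have "n dvd (g $ 2 $ 1 - h $ 2 $ 1) * h' $ 1 $ 1 + (g $ 2 $ 2 - h $ 2 $ 2) * h' $ 2 $ 1" by simp
        also have "\<dots> = (g ** h') $ 2 $ 1 - (h ** h') $ 2 $ 1"
          by (simp add: mat2_mult_component algebra_simps)
        finally show ?thesis by (simp add: h'(2) mat2_one_component)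
      qed
      ultimately show ?thesis by (simp add: Gamma0_def)
    qed
    ultimately show "\<exists>d \<in> Gamma0 n. \<exists>h \<in> rep ` red ` Gamma0 1. g = d ** h" using g h_def by blast
  qed
qed

section \<open>The gradient of a difference of minima\<close>

lemma Mx_subset:
  fixes L L' :: "('a::{field,finite} fls ^ 2) set"
  shows "is_lattice L \<Longrightarrow> is_lattice L' \<Longrightarrow> L' \<subseteq> L \<Longrightarrow> Mx d L' \<le> Mx d L"
proof -
  assume L: "is_lattice L" "is_lattice L'" "L' \<subseteq> L"
  obtain w where "w \<in> Lam d" "w \<noteq> 0" "w \<in> sc (Mx d L') L'" using L(2) by (rule Mx_witness)
  then show ?thesis using sc_mono[OF L(3)] by (subst le_Mx_iff[OF L(1)]) blast
qed

lemma Mx_nbs: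
  fixes L L' :: "('a::{field,finite} fls ^ 2) set"
  assumes L: "is_lattice L" "L' \<in> nbs L"
  shows "Mx d L' = (if \<exists>w \<in> Lam d. w \<noteq> 0 \<and> w \<in> sc (Mx d L) L' then Mx d L else Mx d L - 1)"
proof -
  have L': "is_lattice L'" using L nbs_lattice by blast
  have "Mx d L' \<le> Mx d L" using L L' by (intro Mx_subset) (auto simp add: nbs_def)
  moreover have "Mx d (sc 1 L) \<le> Mx d L'" using L L' by (intro Mx_subset is_lattice_sc) (auto simp add: nbs_def)
  moreover have "Mx d (sc 1 L) = Mx d L - 1" using L by (simp add: Mx_sc)
  moreover have "Mx d L \<le> Mx d L' \<longleftrightarrow> (\<exists>w \<in> Lam d. w \<noteq> 0 \<and> w \<in> sc (Mx d L) L')"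
    by (rule le_Mx_iff[OF L'])
  ultimately show ?thesis by auto
qed

lemma sum_Mx_nbs:
  fixes L :: "('a::{field,finite} fls ^ 2) set"
  assumes L: "is_lattice L"
  shows "int CARD('a) dvd (\<Sum>L' \<in> nbs L. Mx d L' - Mx d L)"
proof -
  define M where "M = Mx d L"
  obtain w where w: "w \<in> Lam d" "w \<noteq> 0" "w \<in> sc M L" unfolding M_def using L by (rule Mx_witness)
  define x where "x = pw (- M) *s w"
  have wx: "w = pw M *s x" by (simp add: x_def flip: pw_add)
  have x: "x \<in> L" "x \<notin> sc 1 L"
  proof -
    show "x \<in> L" using w(3) by (simp add: x_def in_sc_iff)
    show "x \<notin> sc 1 L"
    proof
      assume "x \<in> sc 1 L"
      then have "w \<in> sc (M + 1) L" unfolding wx in_sc_scale_iff by simp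
      with not_Mx[OF L w(1)] w(2) show False by (simp add: M_def)
    qed
  qed
  obtain y where y: "dt x y \<noteq> 0" "L = lat x y" using lattice_basis[OF L x] .
  let ?Lt = "\<lambda>t. lat (y + fls_const t *s x) (pw 1 *s x)"
  have nb: "lat x (pw 1 *s y) \<in> nbs L" "?Lt t \<in> nbs L" for t
    unfolding y(2) nbs_lat(1)[OF y(1)] by auto
  have "w \<in> sc M (lat x (pw 1 *s y))" unfolding wx in_sc_scale_iff by (simp add: lat_gen1)
  then have z: "Mx d (lat x (pw 1 *s y)) = M" unfolding Mx_nbs[OF L nb(1)] M_def using w by auto
  have sum: "(\<Sum>L' \<in> nbs L. Mx d L' - Mx d L) = (\<Sum>t\<in>UNIV. Mx d (?Lt t) - M)"
    unfolding y(2) sum_nbs[OF y(1)] using z by (simp add: M_def y(2))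
  show ?thesis
  proof (cases "\<exists>w' \<in> Lam d. w' \<in> sc M L \<and> dt x (pw (- M) *s w') / dt x y / pw 1 \<notin> valuation_ring")
    case True
    then obtain w' where w': "w' \<in> Lam d" "w' \<in> sc M L" "dt x (pw (- M) *s w') / dt x y / pw 1 \<notin> valuation_ring"
      by blast
    define x' where "x' = pw (- M) *s w'"
    define s u where "s = dt x' y / dt x y" and "u = dt x x' / dt x y"
    have "x' \<in> L" using w'(2) by (simp add: x'_def in_sc_iff)
    then have su: "s \<in> valuation_ring" "u \<in> valuation_ring" "u / pw 1 \<notin> valuation_ring"
      using w'(3) in_lat_iff[OF y(1), of x'] by (auto simp add: s_def u_def y(2) x'_def)
    have x'e: "x' = s *s x + u *s y" unfolding s_def u_def by (rule cramer_field[OF y(1)])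
    define s0 u0 where "s0 = s $$ 0" and "u0 = u $$ 0"
    have r: "(s - fls_const s0) / pw 1 \<in> valuation_ring" "(u - fls_const u0) / pw 1 \<in> valuation_ring"
      unfolding s0_def u0_def using su by (auto intro: valuation_ring_residue)
    have u0: "u0 \<noteq> 0" using r(2) su(3) by auto
    have "Mx d (?Lt t) = M" for t
    proof -
      define w'' where "w'' = fls_const (inverse u0) *s w' + fls_const (t - s0 / u0) *s w"
      have in1: "w'' \<in> Lam d" unfolding w''_def using w w' by (intro Lam_add Lam_scale_const)
      have e: "pw (- M) *s w'' = y + fls_const t *s x + pw 1 *s (fls_const (inverse u0) *s
          (((s - fls_const s0) / pw 1) *s x + ((u - fls_const u0) / pw 1) *s y))"
      proof -
        have "pw (- M) *s w'' = fls_const (inverse u0) *s x' + fls_const (t - s0 / u0) *s x"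
          by (simp add: w''_def x'_def x_def vec2_eq_iff algebra_simps)
        moreover have "fls_const (t - s0 / u0) = fls_const t - fls_const (inverse u0) * fls_const s0"
          by (simp add: fls_minus_const field_simps)
        moreover have "fls_const (inverse u0) * fls_const u0 = 1" using u0 by simp
        moreover have "y + fls_const t *s x + pw 1 *s (c *s
          (((s - b) / pw 1) *s x + ((u - a) / pw 1) *s y)) = c *s (s *s x + u *s y) + (fls_const t - c * b) *s x"
          if "c * a = 1" for a b c
        proof -
          have "pw 1 *s (c *s (((s - b) / pw 1) *s x + ((u - a) / pw 1) *s y)) = c *s ((s - b) *s x + (u - a) *s y)"
            by (simp add: vec2_eq_iff field_simps)
          moreover have "y = (c * a) *s y" using that by simp
          ultimately have "y + fls_const t *s x + pw 1 *s (c *s (((s - b) / pw 1) *s x + ((u - a) / pw 1) *s y)) =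
              (c * a) *s y + fls_const t *s x + c *s ((s - b) *s x + (u - a) *s y)" by metis
          also have "\<dots> = c *s (s *s x + u *s y) + (fls_const t - c * b) *s x"
            by (simp add: vec2_eq_iff algebra_simps)
          finally show ?thesis .
        qed
        ultimately show ?thesis by (simp only: x'e)
      qed
      have "pw (- M) *s w'' \<in> ?Lt t"
      proof -
        have L': "is_lattice (?Lt t)" using nb nbs_lattice by blast
        have "fls_const (inverse u0) *s (((s - fls_const s0) / pw 1) *s x + ((u - fls_const u0) / pw 1) *s y) \<in> L"
          using L by (rule lattice_scale) (use r in \<open>auto simp add: y(2) intro: lat_comb\<close>)
        then have "pw 1 *s (fls_const (inverse u0) *s (((s - fls_const s0) / pw 1) *s x + ((u - fls_const u0) / pw 1) *s y)) \<in> sc 1 L"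
          by (simp only: in_sc_scale_iff diff_self sc_0)
        also have "sc 1 L \<subseteq> ?Lt t" using nb(2)[of t] by (auto simp add: nbs_def)
        finally show ?thesis unfolding e by (intro lattice_add L' lat_gen1)
      qed
      then have in2: "w'' \<in> sc M (?Lt t)" by (simp add: in_sc_iff)
      have "w'' \<noteq> 0"
      proof
        assume "w'' = 0"
        have "dt x (pw (- M) *s w'') = dt x (fls_const (inverse u0) *s x' + fls_const (t - s0 / u0) *s x)"
          by (simp add: w''_def x'_def x_def dt_simps)
        then have "fls_const (inverse u0) * dt x x' = 0" using \<open>w'' = 0\<close> by (simp add: dt_simps)
        then have "u = 0" using u0 by (simp add: u_def)
        then show False using su by simp
      qed
      with in1 in2 show ?thesis unfolding Mx_nbs[OF L nb(2)] M_def by auto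
    qed
    then show ?thesis unfolding sum by simp
  next
    case False
    have "Mx d (?Lt t) = M - 1" for t
    proof -
      have False if v: "v \<in> Lam d" "v \<noteq> 0" "v \<in> sc M (?Lt t)" for v
      proof -
        have L': "is_lattice (?Lt t)" using nb nbs_lattice by blast
        define v' where "v' = pw (- M) *s v"
        have v': "v' \<in> ?Lt t" using v(3) by (simp add: v'_def in_sc_iff)
        then have v'L: "v' \<in> L" using nb(2)[of t] by (auto simp add: nbs_def)
        then have vL: "v \<in> sc M L" by (simp add: v'_def in_sc_iff)
        obtain a b where ab: "v' = a *s (y + fls_const t *s x) + b *s (pw 1 *s x)" "a \<in> valuation_ring" "b \<in> valuation_ring"
          using v' by (auto simp add: lat_def)
        have "dt x v' = a * dt x y" by (simp add: ab(1) dt_simps)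
        then have a: "a / pw 1 \<in> valuation_ring" using False v(1) vL y(1) by (auto simp add: v'_def)
        have xy: "x \<in> L" "y \<in> L" by (simp_all add: y(2) lat_gen1 lat_gen2)
        have "(a / pw 1) *s (y + fls_const t *s x) + b *s x \<in> L"
          by (intro lattice_add[OF L] lattice_scale[OF L] a ab xy) simp
        moreover have "v' = pw 1 *s ((a / pw 1) *s (y + fls_const t *s x) + b *s x)"
          by (simp add: ab(1) vec2_eq_iff field_simps)
        ultimately have "v' \<in> sc 1 L" by (simp only: in_sc_scale_iff diff_self sc_0)
        then have "v \<in> sc (M + 1) L" by (simp add: v'_def in_sc_scale_iff add.commute)
        then show False using not_Mx[OF L v(1)] v(2) by (simp add: M_def)
      qed
      then show ?thesis unfolding Mx_nbs[OF L nb(2)] M_def by auto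
    qed
    then show ?thesis unfolding sum by simp
  qed
qed

definition Gv :: "'a::field poly \<Rightarrow> 'a poly \<Rightarrow> 'a tree_vertex \<Rightarrow> int" where
  "Gv D E v = Mx D (SOME L. L \<in> v) - Mx E (SOME L. L \<in> v)"

lemma Gv_class:
  fixes L :: "('a::{field,finite} fls ^ 2) set"
  assumes L: "is_lattice L"
  shows "Gv D E (homothety_class L) = Mx D L - Mx E L"
proof -
  have "(SOME M. M \<in> homothety_class L) \<in> homothety_class L"
    by (rule someI) (rule mem_homothety_class[OF L])
  then obtain i where i: "(SOME M. M \<in> homothety_class L) = sc i L"
    unfolding homothety_class_eq[OF L] by blast
  show ?thesis unfolding Gv_def i using L by (simp add: Mx_sc)
qed

lemma Gv_act:
  fixes v :: "'a::{field,finite} tree_vertex"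
  assumes "g \<in> Gamma0 n" "D dvd n" "E dvd n" "v \<in> tree_vertices"
  shows "Gv D E (act_vertex g v) = Gv D E v"
proof -
  obtain L where L: "is_lattice L" "v = homothety_class L" using assms(4) by (rule tree_vertexE)
  have "Mx D (mact g L) = Mx D L" "Mx E (mact g L) = Mx E L"
    using assms L Gamma0_mono by (blast intro: Mx_mact)+
  with L show ?thesis
    using Gamma0_det[OF assms(1)] by (simp add: act_homothety_class Gv_class is_lattice_mact)
qed

lemma Gv_harmonic:
  fixes v :: "'a::{field,finite} tree_vertex"
  assumes "v \<in> tree_vertices"
  shows "int CARD('a) dvd (\<Sum>e | e \<in> tree_edges \<and> snd e = v. Gv D E (snd e) - Gv D E (fst e))"
proof -
  obtain L where L: "is_lattice L" "v = homothety_class L" using assms by (rule tree_vertexE)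
  have "(\<Sum>e | e \<in> tree_edges \<and> snd e = v. Gv D E (snd e) - Gv D E (fst e)) =
      (\<Sum>L' \<in> nbs L. (Mx E L' - Mx E L) - (Mx D L' - Mx D L))"
  proof -
    have "Gv D E (homothety_class L') = Mx D L' - Mx E L'" if "L' \<in> nbs L" for L'
      using nbs_lattice[OF that] by (rule Gv_class)
    then show ?thesis unfolding L(2) sum_star[OF L(1)] by (intro sum.cong) (simp_all add: Gv_class[OF L(1)])
  qed
  then show ?thesis
    using sum_Mx_nbs[OF L(1), of D] sum_Mx_nbs[OF L(1), of E] by (simp add: sum_subtractf)
qed

definition unipotent :: "'a::comm_ring_1 ^ 2 ^ 2 \<Rightarrow> bool" where
  "unipotent g \<longleftrightarrow> g \<noteq> mat 1 \<and> det g = 1 \<and> g $ 1 $ 1 + g $ 2 $ 2 = 2"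

text \<open>
  At a vertex fixed by the unipotent \<open>1 + N\<close>, the matrix \<open>N\<close> divided by \<open>P\<close> still preserves \<open>A + dA\<close>.
  As it shrinks the lattice, it kills the minimal vectors; these lie on a line that is independent of
  \<open>d\<close>.
\<close>

lemma Mx_unipotent:
  fixes L L' :: "('a::{field,finite} fls ^ 2) set" and P d n :: "'a poly"
  assumes P: "prime_elem P" "P dvd d" "P * d dvd n" "P ^ 2 dvd n"
    and g: "g \<in> Gamma0 n" "unipotent g" and L: "is_lattice L" "mact g L = L" and L': "L' \<in> nbs L"
  shows "Mx d L' = Mx d L \<longleftrightarrow> (\<exists>z \<in> L'. z \<notin> sc 1 L \<and> map_matrix embed_poly g *v z = z)"
proof -
  define M where "M = Mx d L"
  let ?g = "map_matrix embed_poly g"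
  define a b c where "a = g $ 1 $ 1 - 1" and "b = g $ 1 $ 2" and "c = g $ 2 $ 1"
  have gs: "g $ 1 $ 1 = 1 + a" "g $ 1 $ 2 = b" "g $ 2 $ 1 = c" "g $ 2 $ 2 = 1 - a"
    using g(2) by (auto simp add: a_def b_def c_def unipotent_def algebra_simps)
  have abc: "a * a = - (b * c)"
    using g(2) by (simp add: unipotent_def det_2 gs algebra_simps eq_neg_iff_add_eq_0)
  have nc: "n dvd c" using g(1) by (simp add: Gamma0_def c_def)
  have "P dvd a * a" using P(4) nc by (metis abc dvd_minus_iff dvd_mult dvd_mult_right dvd_trans power2_eq_square)
  then have "P dvd a" using P(1) by (metis prime_elem_dvd_mult_iff)
  then obtain a' where a': "a = P * a'" by (rule dvdE)
  obtain d' where d': "d = P * d'" using P(2) by (rule dvdE)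
  obtain c' where c': "c = P * d * c'" using dvd_trans[OF P(3) nc] by (rule dvdE)
  have P0: "P \<noteq> 0" "degree P \<noteq> 0"
    using P(1) unfolding prime_elem_def by (auto simp add: is_unit_iff_degree)
  have kill: "?g *v w = w" if w: "w \<in> Lam d" "w \<in> sc M L" for w
  proof -
    obtain s t where st: "w $ 1 = embed_poly s" "w $ 2 = embed_poly (d * t)" using w(1) by (auto simp add: Lam_def)
    define w' :: "'a fls ^ 2" where "w' = vector [embed_poly (a' * s + b * d' * t), embed_poly (d * (c' * s - a' * t))]"
    have e: "?g *v w - w = embed_poly P *s w'"
      by (simp add: vec2_eq_iff mat2_vec_component map_matrix_def gs w'_def st a' d' c'
          embed_poly_add embed_poly_diff embed_poly_mult algebra_simps)
    have "w' \<in> Lam d" by (rule LamI[of _ "a' * s + b * d' * t" _ "c' * s - a' * t"]) (simp_all add: w'_def)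
    moreover have "w' \<in> sc (M + 1) L"
    proof -
      have "?g *v w \<in> mact g (sc M L)" using w(2) by (auto simp add: mact_def)
      then have "?g *v w - w \<in> sc M L" using w(2) L by (auto simp add: mact_sc intro: lattice_diff)
      then have "w' \<in> scale_lattice (inverse (embed_poly P)) (sc M L)"
        using P0 by (simp add: scale_lattice_iff e)
      also have "\<dots> = sc (int (degree P) + M) L"
        using L P0 by (simp add: scale_unit is_lattice_sc sc_sc embed_poly_subdegree)
      also have "\<dots> \<subseteq> sc (M + 1) L" using P0 by (intro sc_antimono L) auto
      finally show ?thesis .
    qed
    ultimately have "w' = 0" using not_Mx[OF L(1)] unfolding M_def by blast
    then show ?thesis using e by simp
  qed
  obtain w where w: "w \<in> Lam d" "w \<noteq> 0" "w \<in> sc M L" unfolding M_def using L(1) by (rule Mx_witness)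
  have lL': "is_lattice L'" using L' nbs_lattice by blast
  have gs': "?g *v (k *s z) = k *s (?g *v z)" for k z
    by (simp add: vec2_eq_iff mat2_vec_component algebra_simps)
  have "(\<exists>w \<in> Lam d. w \<noteq> 0 \<and> w \<in> sc M L') \<longleftrightarrow> (\<exists>z \<in> L'. z \<notin> sc 1 L \<and> ?g *v z = z)"
  proof
    assume "\<exists>w \<in> Lam d. w \<noteq> 0 \<and> w \<in> sc M L'"
    then obtain w where w: "w \<in> Lam d" "w \<noteq> 0" "w \<in> sc M L'" by blast
    have wL: "w \<in> sc M L" using w(3) L' sc_mono[of L' L M] by (auto simp add: nbs_def)
    have "w \<notin> sc (M + 1) L" using not_Mx[OF L(1) w(1)] w(2) by (auto simp add: M_def)
    then have "pw (- M) *s w \<notin> sc 1 L" by (simp add: in_sc_scale_iff add.commute)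
    moreover have "pw (- M) *s w \<in> L'" using w(3) by (simp add: in_sc_iff)
    moreover have "?g *v (pw (- M) *s w) = pw (- M) *s w" unfolding gs' kill[OF w(1) wL] ..
    ultimately show "\<exists>z \<in> L'. z \<notin> sc 1 L \<and> ?g *v z = z" by blast
  next
    assume "\<exists>z \<in> L'. z \<notin> sc 1 L \<and> ?g *v z = z"
    then obtain z where z: "z \<in> L'" "z \<notin> sc 1 L" "?g *v z = z" by blast
    define x where "x = pw (- M) *s w"
    have x: "x \<in> L" using w(3) by (simp add: x_def in_sc_iff)
    have gx: "?g *v x = x" unfolding x_def gs' kill[OF w(1,3)] ..
    have x0: "x \<noteq> 0" using w(2) by (simp add: x_def)
    have "dt x z = 0"
    proof (rule ccontr)
      assume d0: "dt x z \<noteq> 0"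
      have "?g *v u = u" for u
      proof -
        obtain k l where u: "u = k *s x + l *s z" using cramer_field[OF d0, of u] by blast
        have "?g *v u = k *s (?g *v x) + l *s (?g *v z)"
          unfolding u by (simp add: vec2_eq_iff mat2_vec_component algebra_simps)
        then show ?thesis by (simp add: gx z(3) u)
      qed
      from this[of "vector [1, 0]"] this[of "vector [0, 1]"]
      have "embed_poly a = 0" "embed_poly c = 0" "embed_poly b = 0"
        by (simp_all add: vec2_eq_iff mat2_vec_component map_matrix_def gs embed_poly_add)
      then have "g = mat 1" by (simp add: mat2_eq_iff gs mat2_one_component)
      then show False using g(2) by (simp add: unipotent_def)
    qed
    have "\<exists>k. z = k *s x"
    proof (cases "x $ 1 = 0")
      case True
      then have "x $ 2 \<noteq> 0" using x0 by (simp add: vec2_eq_iff)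
      with \<open>dt x z = 0\<close> True show ?thesis
        by (intro exI[of _ "z $ 2 / x $ 2"]) (auto simp add: dt_def vec2_eq_iff)
    next
      case False
      with \<open>dt x z = 0\<close> show ?thesis
        by (intro exI[of _ "z $ 1 / x $ 1"]) (auto simp add: dt_def vec2_eq_iff field_simps)
    qed
    then obtain k where k: "z = k *s x" ..
    have "k \<noteq> 0 \<and> inverse k \<in> valuation_ring"
    proof (rule ccontr)
      assume c: "\<not> ?thesis"
      have "k / pw 1 \<in> valuation_ring"
        using c by (cases "k = 0") (auto simp add: fls_divide_subdegree valuation_ring_def)
      then have "(k / pw 1) *s x \<in> L" using L(1) x by - (rule lattice_scale)
      then have "pw 1 *s ((k / pw 1) *s x) \<in> sc 1 L" by (simp only: in_sc_scale_iff diff_self sc_0)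
      then show False using z(2) by (simp add: k)
    qed
    then have "inverse k *s z \<in> L'" using lattice_scale[OF lL' _ z(1)] by blast
    then have "x \<in> L'" using \<open>k \<noteq> 0 \<and> inverse k \<in> valuation_ring\<close> by (simp add: k)
    then have "w \<in> sc M L'" by (simp add: x_def in_sc_iff)
    with w show "\<exists>w \<in> Lam d. w \<noteq> 0 \<and> w \<in> sc M L'" by blast
  qed
  then show ?thesis unfolding Mx_nbs[OF L(1) L'] M_def by simp
qed

lemma Gv_unipotent:
  fixes v w :: "'a::{field,finite} tree_vertex" and P n :: "'a poly"
  assumes P: "prime_elem P" "P ^ 2 dvd n" and D: "P dvd D" "P * D dvd n" and E: "P dvd E" "P * E dvd n"
    and g: "g \<in> Gamma0 n" "unipotent g" "act_vertex g v = v" and vw: "(v, w) \<in> tree_edges"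
  shows "Gv D E w = Gv D E v"
proof -
  obtain L L' where L: "is_lattice L" "L' \<in> nbs L" "v = homothety_class L" "w = homothety_class L'"
    using vw by (rule tree_edgeE)
  have gL: "mact g L = L" using act_vertex_eq_imp[OF g(1) L(1) L(1)] g(3) by (simp add: L(3))
  have "Mx D L' = Mx D L \<longleftrightarrow> Mx E L' = Mx E L"
    unfolding Mx_unipotent[OF P(1) D P(2) g(1,2) L(1) gL L(2)] Mx_unipotent[OF P(1) E P(2) g(1,2) L(1) gL L(2)] ..
  moreover have "Mx D L' = Mx D L \<or> Mx D L' = Mx D L - 1" "Mx E L' = Mx E L \<or> Mx E L' = Mx E L - 1"
    using Mx_nbs[OF L(1,2)] by auto
  ultimately have "Mx D L' - Mx E L' = Mx D L - Mx E L" by auto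
  then show ?thesis using L nbs_lattice[OF L(2)] by (simp add: Gv_class)
qed

section \<open>Connectedness and finiteness modulo the group\<close>

lemma lat_unit: "t \<noteq> 0 \<Longrightarrow> dt x y \<noteq> 0 \<Longrightarrow> lat x (t *s y) = lat x (pw (fls_subdegree t) *s y)"
proof (rule Set.set_eqI)
  fix z assume t: "t \<noteq> 0" and d: "dt x y \<noteq> 0"
  have "dt x z / (t * dt x y) \<in> valuation_ring \<longleftrightarrow> dt x z / (pw (fls_subdegree t) * dt x y) \<in> valuation_ring"
    using t d by (cases "dt x z = 0") (auto simp add: valuation_ring_def fls_divide_subdegree)
  with t d show "z \<in> lat x (t *s y) \<longleftrightarrow> z \<in> lat x (pw (fls_subdegree t) *s y)"
    by (simp add: in_lat_iff dt_simps)
qed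

lemma tree_connected:
  fixes v w :: "'a::field tree_vertex"
  assumes "v \<in> tree_vertices" "w \<in> tree_vertices"
  shows "(v, w) \<in> tree_edges\<^sup>*"
proof -
  obtain L where L: "is_lattice L" "v = homothety_class L" using assms(1) by (rule tree_vertexE)
  obtain N where N: "is_lattice N" "w = homothety_class N" using assms(2) by (rule tree_vertexE)
  obtain x0 y0 where N0: "dt x0 y0 \<noteq> 0" "N = lat x0 y0" using N(1) by (auto simp add: is_lattice_iff)
  obtain i1 where i1: "x0 \<in> sc i1 L" using ex_sc[OF L(1)] by blast
  obtain i2 where i2: "y0 \<in> sc i2 L" using ex_sc[OF L(1)] by blast
  define i where "i = min i1 i2"
  have "x0 \<in> sc i L" "y0 \<in> sc i L"
    using i1 i2 sc_antimono[OF L(1), of i i1] sc_antimono[OF L(1), of i i2] by (auto simp add: i_def)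
  then have Ni: "N \<subseteq> sc i L" unfolding N0 using L by (intro lat_subset is_lattice_sc)
  have x0: "x0 \<noteq> 0" using N0 by auto
  obtain k where k: "\<forall>j\<ge>k. x0 \<notin> sc j L" using not_in_sc[OF L(1) x0] by blast
  have x0N: "x0 \<in> N" by (simp add: N0 lat_gen1)
  have "\<exists>j. N \<subseteq> sc j L \<and> \<not> N \<subseteq> sc (j + 1) L"
  proof (rule ccontr)
    assume c: "\<not> ?thesis"
    have "N \<subseteq> sc j L" if "i \<le> j" for j using that
      by (induction j rule: int_ge_induct) (use Ni c in auto)
    then have "N \<subseteq> sc (max i k) L" by simp
    then show False using x0N k by (meson max.cobounded2 subsetD)
  qed
  then obtain j where j: "N \<subseteq> sc j L" "\<not> N \<subseteq> sc (j + 1) L" by blast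
  define L1 where "L1 = sc j L"
  have L1: "is_lattice L1" "v = homothety_class L1" using L by (auto simp add: L1_def homothety_class_sc)
  have NL1: "N \<subseteq> L1" "\<not> N \<subseteq> sc 1 L1" using j by (simp_all add: L1_def sc_sc add.commute)
  then obtain x where x: "x \<in> N" "x \<notin> sc 1 L1" by blast
  have "x \<in> L1" using x NL1 by blast
  then obtain y where y: "dt x y \<noteq> 0" "L1 = lat x y" using lattice_basis[OF L1(1)] x(2) by blast
  have "x \<notin> sc 1 N" using x(2) sc_mono[OF NL1(1), of 1] by blast
  then obtain z where z: "dt x z \<noteq> 0" "N = lat x z" using lattice_basis[OF N(1) x(1)] by blast
  have "z \<in> L1" using NL1(1) z by (auto simp add: lat_gen2)
  then obtain s t where st: "z = s *s x + t *s y" "s \<in> valuation_ring" "t \<in> valuation_ring"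
    by (auto simp add: y(2) lat_def)
  have t0: "t \<noteq> 0" using z(1) by (auto simp add: st dt_simps)
  have "N = lat x (z + (- s) *s x)" unfolding z(2) using z(1) st(2) by (intro lat_shear[symmetric]) auto
  also have "z + (- s) *s x = t *s y" by (simp add: st vec2_eq_iff)
  also have "lat x (t *s y) = lat x (pw (fls_subdegree t) *s y)" using t0 y(1) by (rule lat_unit)
  finally have Ne: "N = lat x (pw (int (nat (fls_subdegree t))) *s y)" using st(3) by (simp add: valuation_ring_def)
  have "(v, homothety_class (lat x (pw (int m) *s y))) \<in> tree_edges\<^sup>*" for m
  proof (induction m)
    case 0
    then show ?case by (simp add: L1(2) y(2))
  next
    case (Suc m)
    have d: "dt x (pw (int m) *s y) \<noteq> 0" using y(1) by (simp add: dt_simps)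
    have "lat x (pw 1 *s (pw (int m) *s y)) \<in> nbs (lat x (pw (int m) *s y))" using d by (rule lat_in_nbs)
    moreover have "pw 1 *s (pw (int m) *s y) = pw (int (Suc m)) *s y" by (simp flip: pw_add)
    ultimately have "(homothety_class (lat x (pw (int m) *s y)), homothety_class (lat x (pw (int (Suc m)) *s y))) \<in> tree_edges"
      using d by (auto simp add: tree_edge_iff is_lattice_lat)
    with Suc show ?case by simp
  qed
  then show ?thesis unfolding N(2) Ne by blast
qed

lemma deep_unipotent:
  fixes n :: "'a::{field,finite} poly"
  assumes g: "g \<in> Gamma0 1" and n: "n \<noteq> 0" and c: "int (degree n) \<le> c"
  shows "\<exists>h \<in> Gamma0 n. unipotent h \<and> act_vertex h (act_vertex g (homothety_class (Vc c))) = act_vertex g (homothety_class (Vc c))"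
proof -
  obtain g' where g': "g' \<in> Gamma0 1" "g ** g' = mat 1" "g' ** g = mat 1" using g by (rule Gamma0_inverse)
  define \<tau> :: "'a poly ^ 2 ^ 2" where "\<tau> = vector [vector [1, n], vector [0, 1]]"
  define h where "h = g ** \<tau> ** g'"
  have dg: "det g * det g' = 1" by (metis g'(2) det_I det_mul)
  have dh: "det h = 1"
  proof -
    have "det \<tau> = 1" by (simp add: \<tau>_def det_2)
    then show ?thesis using dg by (simp add: h_def det_mul)
  qed
  have gg': "g $ 1 $ 1 * g' $ 1 $ 1 + g $ 1 $ 2 * g' $ 2 $ 1 = 1"
    "g $ 2 $ 1 * g' $ 1 $ 1 + g $ 2 $ 2 * g' $ 2 $ 1 = 0"
    "g $ 2 $ 1 * g' $ 1 $ 2 + g $ 2 $ 2 * g' $ 2 $ 2 = 1"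
    using g'(2) by (simp_all add: mat2_eq_iff mat2_mult_component mat2_one_component)
  have g'g: "g' $ 2 $ 1 * g $ 1 $ 1 + g' $ 2 $ 2 * g $ 2 $ 1 = 0"
    using g'(3) by (simp_all add: mat2_eq_iff mat2_mult_component mat2_one_component)
  have h21: "h $ 2 $ 1 = n * (g $ 2 $ 1 * g' $ 2 $ 1)"
    using gg'(2) by (simp add: h_def mat2_mult_component \<tau>_def algebra_simps)
  have tr: "h $ 1 $ 1 + h $ 2 $ 2 = 2"
  proof -
    have "h $ 1 $ 1 + h $ 2 $ 2 = (g $ 1 $ 1 * g' $ 1 $ 1 + g $ 1 $ 2 * g' $ 2 $ 1) +
        (g $ 2 $ 1 * g' $ 1 $ 2 + g $ 2 $ 2 * g' $ 2 $ 2) + n * (g' $ 2 $ 1 * g $ 1 $ 1 + g' $ 2 $ 2 * g $ 2 $ 1)"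
      by (simp add: h_def mat2_mult_component \<tau>_def algebra_simps)
    then show ?thesis by (simp add: gg' g'g)
  qed
  have h1: "h \<noteq> mat 1"
  proof
    assume "h = mat 1"
    then have "g' ** h ** g = mat 1" by (simp add: g'(3))
    moreover have "g' ** h ** g = \<tau>"
    proof -
      have "g' ** h ** g = (g' ** g) ** \<tau> ** (g' ** g)" by (simp add: h_def matrix_mul_assoc)
      then show ?thesis by (simp add: g'(3))
    qed
    ultimately show False using n by (simp add: \<tau>_def mat2_eq_iff mat2_one_component)
  qed
  have "mact \<tau> (Vc c) = Vc c"
  proof -
    have "map_matrix embed_poly \<tau> *v vector [1, 0] = vector [1, 0]"
      "map_matrix embed_poly \<tau> *v vector [0, pw c] = vector [0, pw c] + (embed_poly n * pw c) *s vector [1, 0]"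
      by (simp_all add: vec2_eq_iff mat2_vec_component map_matrix_def \<tau>_def)
    moreover have "lat (vector [1, 0]) (vector [0, pw c] + (embed_poly n * pw c) *s vector [1, 0]) = lat (vector [1, 0]) (vector [0, pw c :: 'a fls])"
      using n c by (intro lat_shear) (simp_all add: dt_def valuation_ring_def embed_poly_subdegree)
    ultimately show ?thesis unfolding Vc_def mact_lat by simp
  qed
  then have "act_vertex h (act_vertex g (homothety_class (Vc c))) = act_vertex g (homothety_class (Vc c))"
  proof -
    have "h ** g = g ** \<tau>" by (simp add: h_def g'(3) flip: matrix_mul_assoc)
    then have "act_vertex h (act_vertex g (homothety_class (Vc c))) = act_vertex (g ** \<tau>) (homothety_class (Vc c))"
      by (simp flip: act_vertex_mult)
    also have "\<dots> = act_vertex g (homothety_class (Vc c))"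
      using \<open>mact \<tau> (Vc c) = Vc c\<close> by (simp add: act_homothety_class mact_mult)
    finally show ?thesis .
  qed
  moreover have "h \<in> Gamma0 n" using dh by (rule Gamma0_det1) (simp add: h21)
  moreover have "unipotent h" using dh tr h1 by (simp add: unipotent_def)
  ultimately show ?thesis by blast
qed

definition low_vertices :: "'a::field poly \<Rightarrow> 'a tree_vertex set" where
  "low_vertices n = {act_vertex g (homothety_class (Vc c)) | g c. g \<in> Gamma0 1 \<and> 0 \<le> c \<and> c < int (degree n)}"

lemma low_vertices_reps:
  fixes n :: "'a::{field,finite} poly"
  assumes n: "n \<noteq> 0"
  obtains F where "finite F" "F \<subseteq> tree_vertices" "\<And>v. v \<in> low_vertices n \<Longrightarrow> \<exists>g \<in> Gamma0 n. \<exists>u \<in> F. v = act_vertex g u"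
proof -
  obtain R where R: "finite R" "R \<subseteq> Gamma0 1" "\<And>g. g \<in> Gamma0 1 \<Longrightarrow> \<exists>d \<in> Gamma0 n. \<exists>h \<in> R. g = d ** h"
    using n by (rule Gamma0_finite_index) blast
  define F where "F = (\<lambda>(h, c). act_vertex h (homothety_class (Vc c))) ` (R \<times> {0..<int (degree n)})"
  show ?thesis
  proof (rule that)
    show "finite F" unfolding F_def using R(1) by simp
    show "F \<subseteq> tree_vertices" unfolding F_def using R(2) Gamma0_det by (auto intro!: act_vertex_in_tree)
    show "\<exists>g \<in> Gamma0 n. \<exists>u \<in> F. v = act_vertex g u" if "v \<in> low_vertices n" for v
    proof -
      obtain g c where gc: "v = act_vertex g (homothety_class (Vc c))" "g \<in> Gamma0 1" "0 \<le> c" "c < int (degree n)"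
        using \<open>v \<in> low_vertices n\<close> unfolding low_vertices_def by blast
      obtain d h where dh: "d \<in> Gamma0 n" "h \<in> R" "g = d ** h" using R(3)[OF gc(2)] by blast
      have "act_vertex h (homothety_class (Vc c)) \<in> F" unfolding F_def using dh gc by auto
      moreover have "v = act_vertex d (act_vertex h (homothety_class (Vc c)))" by (simp add: gc(1) dh(3) act_vertex_mult)
      ultimately show ?thesis using dh by blast
    qed
  qed
qed

lemma not_low_unipotent:
  fixes v :: "'a::{field,finite} tree_vertex"
  assumes "v \<in> tree_vertices" "v \<notin> low_vertices n" "n \<noteq> 0"
  shows "\<exists>h \<in> Gamma0 n. unipotent h \<and> act_vertex h v = v"
proof -
  obtain g c where g: "g \<in> Gamma0 1" "0 \<le> c" "v = act_vertex g (homothety_class (Vc c))"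
    using assms(1) by (rule tree_vertex_reduction)
  then have "int (degree n) \<le> c" using assms(2) unfolding low_vertices_def by fastforce
  then show ?thesis using deep_unipotent[OF g(1) assms(3)] g(3) by blast
qed

section \<open>Elements of order p\<close>

lemma of_nat_card_eq_0: "of_nat CARD('a) = (0 :: 'a::{field,finite})"
proof -
  have "bij (\<lambda>x :: 'a. x + 1)" by (rule bij_plus_right)
  then have "(\<Sum>x\<in>UNIV. x) = (\<Sum>x\<in>UNIV. x + (1 :: 'a))"
    using sum.reindex_bij_betw[of "\<lambda>x :: 'a. x + 1" UNIV UNIV "\<lambda>x. x"] by simp
  then show ?thesis by (simp add: sum.distrib)
qed

lemma of_nat_char_eq_0:
  assumes "CARD('a::{field,finite}) = p ^ k"
  shows "of_nat p = (0 :: 'a)"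
proof -
  have "(of_nat p :: 'a) ^ k = 0" using of_nat_card_eq_0[where 'a = 'a] by (simp add: assms)
  then show ?thesis by simp
qed

lemma mat_vec_sum: "H *v (\<Sum>j\<in>A. c j *s v j) = (\<Sum>j\<in>A. c j *s (H *v v j))"
  for H :: "'b::comm_ring_1 ^ 2 ^ 2"
proof (induction A rule: infinite_finite_induct)
  case (insert j A)
  have "H *v (c j *s v j) = c j *s (H *v v j)" by (simp add: vec2_eq_iff mat2_vec_component algebra_simps)
  with insert show ?case by (simp add: matrix_vector_right_distrib)
qed (simp_all add: vec2_eq_iff mat2_vec_component)

lemma iterate_binomial:
  fixes H :: "'b::comm_ring_1 ^ 2 ^ 2"
  shows "((\<lambda>x. x + H *v x) ^^ k) x = (\<Sum>j\<le>k. of_nat (k choose j) *s ((\<lambda>x. H *v x) ^^ j) x)"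
proof (induction k)
  case (Suc k)
  let ?N = "\<lambda>j. ((\<lambda>x. H *v x) ^^ j) x"
  have "((\<lambda>x. x + H *v x) ^^ Suc k) x =
      (\<Sum>j\<le>k. of_nat (k choose j) *s ?N j) + (\<Sum>j\<le>k. of_nat (k choose j) *s ?N (Suc j))"
    by (simp add: Suc.IH mat_vec_sum)
  also have "(\<Sum>j\<le>k. of_nat (k choose j) *s ?N j) = (\<Sum>j\<le>Suc k. of_nat (k choose j) *s ?N j)"
    by (simp add: binomial_eq_0)
  also have "\<dots> = ?N 0 + (\<Sum>j\<le>k. of_nat (k choose Suc j) *s ?N (Suc j))"
    by (subst sum.atMost_Suc_shift) simp
  also have "\<dots> + (\<Sum>j\<le>k. of_nat (k choose j) *s ?N (Suc j)) =
      ?N 0 + (\<Sum>j\<le>k. of_nat (Suc k choose Suc j) *s ?N (Suc j))"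
    by (simp only: binomial_Suc_Suc of_nat_add vector_sadd_rdistrib sum.distrib add.assoc)
      (simp only: add.left_commute add.commute)
  also have "\<dots> = (\<Sum>j\<le>Suc k. of_nat (Suc k choose j) *s ?N j)"
    by (subst sum.atMost_Suc_shift) simp
  finally show ?case .
qed simp

lemma cauchy_unipotent:
  fixes S :: "('a::{field,finite} poly ^ 2 ^ 2) set"
  assumes p: "prime p" "CARD('a) = p ^ k"
    and S: "finite S" "mat 1 \<in> S" "\<And>g h. g \<in> S \<Longrightarrow> h \<in> S \<Longrightarrow> g ** h \<in> S"
      "\<And>g. g \<in> S \<Longrightarrow> \<exists>h \<in> S. h ** g = mat 1"
    and dvd: "p dvd card S"
  shows "\<exists>g \<in> S. unipotent g"
proof -
  define G :: "('a poly ^ 2 ^ 2) monoid" where "G = \<lparr>carrier = S, monoid.mult = (**), one = mat 1\<rparr>"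
  have G: "group G"
    by (rule groupI) (use S in \<open>auto simp add: G_def matrix_mul_assoc\<close>)
  obtain m where m: "card S = p * m" using dvd by (rule dvdE)
  have "order G = p ^ 1 * m" using m by (simp add: order_def G_def)
  moreover have "finite (carrier G)" using S by (simp add: G_def)
  ultimately obtain H where H: "subgroup H G" "card H = p ^ 1" using sylow_thm[OF p(1) G] by blast
  have "1 < card H" using H(2) prime_gt_1_nat[OF p(1)] by simp
  then have "\<not> H \<subseteq> {mat 1}" using card_mono[of "{mat 1}" H] by fastforce
  then obtain \<tau> where \<tau>: "\<tau> \<in> H" "\<tau> \<noteq> mat 1" by blast
  define G' where "G' = G\<lparr>carrier := H\<rparr>"
  have G': "group G'" unfolding G'_def using H(1) G by (rule subgroup.subgroup_is_group)
  have "\<tau> [^]\<^bsub>G'\<^esub> order G' = \<one>\<^bsub>G'\<^esub>" using \<tau>(1) by (intro group.pow_order_eq_1[OF G']) (simp add: G'_def)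
  then have pw: "\<tau> [^]\<^bsub>G'\<^esub> p = mat 1" using H(2) by (simp add: order_def G'_def G_def)
  define N where "N = \<tau> - mat 1"
  have \<tau>N: "\<tau> *v x = x + N *v x" for x by (simp add: N_def matrix_vector_mult_diff_rdistrib)
  have pow: "(\<tau> [^]\<^bsub>G'\<^esub> j) *v x = ((\<lambda>x. x + N *v x) ^^ j) x" for j :: nat and x
  proof (induction j arbitrary: x)
    case (Suc j)
    interpret group G' by (rule G')
    have "\<tau> [^]\<^bsub>G'\<^esub> Suc j = (\<tau> [^]\<^bsub>G'\<^esub> j) ** \<tau>" by (simp add: G'_def G_def)
    then have "(\<tau> [^]\<^bsub>G'\<^esub> Suc j) *v x = (\<tau> [^]\<^bsub>G'\<^esub> j) *v (x + N *v x)"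
      by (simp add: \<tau>N flip: matrix_vector_mul_assoc)
    also have "\<dots> = ((\<lambda>x. x + N *v x) ^^ Suc j) x" by (simp only: Suc.IH funpow_Suc_right o_apply)
    finally show ?case .
  qed (simp add: G'_def G_def)
  have p0: "of_nat p = (0 :: 'a poly)" using of_nat_char_eq_0[OF p(2)] by (simp add: of_nat_poly)
  have nil: "((\<lambda>x. N *v x) ^^ p) x = 0" for x
  proof -
    let ?f = "\<lambda>j. of_nat (p choose j) *s ((\<lambda>x. N *v x) ^^ j) x"
    have "of_nat (p choose j) = (0 :: 'a poly)" if "0 < j" "j < p" for j
    proof -
      have "p dvd (p choose j)" by (rule dvd_choose_prime) (use that p(1) in auto)
      then obtain i where "p choose j = p * i" by (rule dvdE)
      then show ?thesis by (simp add: p0)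
    qed
    then have z: "?f j = 0" if "j \<in> {..p} - {0, p}" for j using that by auto
    have "(\<Sum>j\<le>p. ?f j) = (\<Sum>j\<in>{0, p}. ?f j)"
      by (rule sum.mono_neutral_right) (use z in auto)
    also have "\<dots> = x + ((\<lambda>x. N *v x) ^^ p) x" using p(1) prime_gt_0_nat[of p] by simp
    finally have "((\<lambda>x. x + N *v x) ^^ p) x = x + ((\<lambda>x. N *v x) ^^ p) x" by (simp add: iterate_binomial)
    moreover have "((\<lambda>x. x + N *v x) ^^ p) x = x" using pw by (simp flip: pow)
    ultimately show ?thesis by simp
  qed
  have N0: "N \<noteq> 0" using \<tau>(2) by (simp add: N_def)
  have ch: "N *v (N *v x) = (N $ 1 $ 1 + N $ 2 $ 2) *s (N *v x) - det N *s x" for x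
    by (simp add: vec2_eq_iff mat2_vec_component det_2 algebra_simps)
  have detN: "det N = 0"
  proof (rule ccontr)
    assume d: "det N \<noteq> 0"
    have inj: "x = 0" if "N *v x = 0" for x
    proof -
      have "adjm N *v (N *v x) = det N *s x"
        by (simp add: vec2_eq_iff mat2_vec_component det_2 algebra_simps)
      moreover have "adjm N *v (N *v x) = 0" using that by (simp add: vec2_eq_iff mat2_vec_component)
      ultimately show ?thesis using d by (auto simp add: vec2_eq_iff)
    qed
    have "x = 0" if "((\<lambda>x. N *v x) ^^ j) x = 0" for j x using that by (induction j) (auto dest: inj)
    from this[OF nil, of "vector [1, 0]"] show False by (simp add: vec2_eq_iff)
  qed
  have it: "((\<lambda>x. N *v x) ^^ Suc j) x = (N $ 1 $ 1 + N $ 2 $ 2) ^ j *s (N *v x)" for j x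
  proof (induction j)
    case (Suc j)
    have "((\<lambda>x. N *v x) ^^ Suc (Suc j)) x = N *v ((N $ 1 $ 1 + N $ 2 $ 2) ^ j *s (N *v x))"
      using Suc.IH by simp
    also have "\<dots> = (N $ 1 $ 1 + N $ 2 $ 2) ^ j *s (N *v (N *v x))"
      by (simp add: vec2_eq_iff mat2_vec_component algebra_simps)
    also have "N *v (N *v x) = (N $ 1 $ 1 + N $ 2 $ 2) *s (N *v x)" unfolding ch detN by simp
    finally show ?case unfolding vector_smult_assoc power_Suc2[symmetric] .
  qed simp
  have tr: "N $ 1 $ 1 + N $ 2 $ 2 = 0"
  proof (rule ccontr)
    assume t: "N $ 1 $ 1 + N $ 2 $ 2 \<noteq> 0"
    obtain p' where p': "p = Suc p'" using p(1) prime_gt_0_nat[of p] gr0_conv_Suc by blast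
    have "N *v x = 0" for x
    proof -
      have "(N $ 1 $ 1 + N $ 2 $ 2) ^ p' *s (N *v x) = 0" using nil[of x] unfolding p' it .
      then show ?thesis using t by (auto simp add: vec2_eq_iff)
    qed
    from this[of "vector [1, 0]"] this[of "vector [0, 1]"] have "N = 0"
      by (simp add: vec2_eq_iff mat2_eq_iff mat2_vec_component)
    with N0 show False ..
  qed
  have \<tau>e: "\<tau> = mat 1 + N" by (simp add: N_def)
  have "\<tau> $ 1 $ 1 + \<tau> $ 2 $ 2 = 2" using tr by (simp add: \<tau>e mat2_one_component algebra_simps)
  moreover have "det \<tau> = 1 + (N $ 1 $ 1 + N $ 2 $ 2) + det N"
    by (simp add: \<tau>e det_2 mat2_one_component algebra_simps)
  ultimately have "unipotent \<tau>" using \<tau>(2) detN tr by (simp add: unipotent_def)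
  moreover have "\<tau> \<in> S" using \<tau>(1) subgroup.subset[OF H(1)] by (auto simp add: G_def)
  ultimately show ?thesis by blast
qed

section \<open>Counting group elements that move one edge to another\<close>

definition cnt :: "'a::field poly \<Rightarrow> 'a tree_edge \<Rightarrow> 'a tree_edge \<Rightarrow> int" where
  "cnt n e e' = int (card {g \<in> Gamma0 n. act_edge g e = e'})"

lemma finite_edge_transporter:
  fixes e e' :: "'a::{field,finite} tree_edge"
  assumes "fst e \<in> tree_vertices" "fst e' \<in> tree_vertices"
  shows "finite {g \<in> Gamma0 n. act_edge g e = e'}"
  by (rule finite_subset[OF _ finite_transporter[OF assms, of n]]) (auto simp add: act_edge_def)

lemma cnt_act_left: "h \<in> Gamma0 n \<Longrightarrow> cnt n (act_edge h e) e' = cnt n e e'"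
proof -
  assume h: "h \<in> Gamma0 n"
  obtain h' where h': "h' \<in> Gamma0 n" "h ** h' = mat 1" "h' ** h = mat 1" using h by (rule Gamma0_inverse)
  have "bij_betw (\<lambda>g. g ** h) {g \<in> Gamma0 n. act_edge g (act_edge h e) = e'} {g \<in> Gamma0 n. act_edge g e = e'}"
  proof (rule bij_betw_byWitness[of _ "\<lambda>g. g ** h'"])
    have "a ** h ** h' = a" "a ** h' ** h = a" for a :: "'a poly ^ 2 ^ 2" by (simp_all add: h' flip: matrix_mul_assoc)
    then show "\<forall>a \<in> {g \<in> Gamma0 n. act_edge g (act_edge h e) = e'}. a ** h ** h' = a"
      "\<forall>a \<in> {g \<in> Gamma0 n. act_edge g e = e'}. a ** h' ** h = a" by simp_all
  qed (auto simp add: Gamma0_mult h h' act_edge_mult act_edge_inverse simp del: act_edge_pair)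
  then show ?thesis unfolding cnt_def by (simp add: bij_betw_same_card)
qed

lemma cnt_act_right: "h \<in> Gamma0 n \<Longrightarrow> cnt n e (act_edge h e') = cnt n e e'"
proof -
  assume h: "h \<in> Gamma0 n"
  obtain h' where h': "h' \<in> Gamma0 n" "h ** h' = mat 1" "h' ** h = mat 1" using h by (rule Gamma0_inverse)
  have "bij_betw (\<lambda>g. h ** g) {g \<in> Gamma0 n. act_edge g e = e'} {g \<in> Gamma0 n. act_edge g e = act_edge h e'}"
    by (rule bij_betw_byWitness[of _ "\<lambda>g. h' ** g"])
      (auto simp add: Gamma0_mult h h' act_edge_mult act_edge_inverse matrix_mul_assoc)
  then show ?thesis unfolding cnt_def by (simp add: bij_betw_same_card)
qed

lemma mem_Gamma0_orbit: "e' \<in> Gamma0_orbit n e \<longleftrightarrow> (\<exists>h \<in> Gamma0 n. e' = act_edge h e)"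
  by (auto simp add: Gamma0_orbit_def)

lemma Gamma0_orbit_self: "e \<in> Gamma0_orbit n e"
  unfolding mem_Gamma0_orbit by (rule bexI[of _ "mat 1"]) auto

lemma Gamma0_orbit_act: "h \<in> Gamma0 n \<Longrightarrow> Gamma0_orbit n (act_edge h e) = Gamma0_orbit n e"
proof -
  assume h: "h \<in> Gamma0 n"
  obtain h' where h': "h' \<in> Gamma0 n" "h ** h' = mat 1" "h' ** h = mat 1" using h by (rule Gamma0_inverse)
  have "x \<in> Gamma0_orbit n (act_edge h e)" if "x \<in> Gamma0_orbit n e" for x
  proof -
    obtain g where g: "g \<in> Gamma0 n" "x = act_edge g e"
      using \<open>x \<in> Gamma0_orbit n e\<close> unfolding mem_Gamma0_orbit by blast
    then have "x = act_edge (g ** h') (act_edge h e)" by (simp add: act_edge_mult act_edge_inverse h')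
    then show ?thesis unfolding mem_Gamma0_orbit using g h' Gamma0_mult by blast
  qed
  moreover have "x \<in> Gamma0_orbit n e" if "x \<in> Gamma0_orbit n (act_edge h e)" for x
  proof -
    obtain g where g: "g \<in> Gamma0 n" "x = act_edge g (act_edge h e)"
      using \<open>x \<in> Gamma0_orbit n (act_edge h e)\<close> unfolding mem_Gamma0_orbit by blast
    then have "x = act_edge (g ** h) e" by (simp only: act_edge_mult)
    then show ?thesis unfolding mem_Gamma0_orbit using Gamma0_mult[OF g(1) h] by blast
  qed
  ultimately show ?thesis by blast
qed

lemma Gamma0_orbit_eq_iff: "Gamma0_orbit n e = Gamma0_orbit n e' \<longleftrightarrow> e' \<in> Gamma0_orbit n e"
proof
  assume "e' \<in> Gamma0_orbit n e"
  then obtain h where "h \<in> Gamma0 n" "e' = act_edge h e" unfolding mem_Gamma0_orbit by blast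
  then show "Gamma0_orbit n e = Gamma0_orbit n e'" by (simp only: Gamma0_orbit_act)
qed (simp only: Gamma0_orbit_self)

lemma cnt_orbit: "e' \<in> Gamma0_orbit n e \<Longrightarrow> cnt n e e' = cnt n e' e'"
  unfolding mem_Gamma0_orbit by (elim bexE) (simp only: cnt_act_left)

lemma cnt_no_orbit: "e' \<notin> Gamma0_orbit n e \<Longrightarrow> cnt n e e' = 0"
  unfolding mem_Gamma0_orbit cnt_def by (auto simp add: card_eq_0_iff)

lemma cnt_pos:
  fixes e :: "'a::{field,finite} tree_edge"
  assumes "fst e \<in> tree_vertices"
  shows "cnt n e e > 0"
proof -
  have "{g \<in> Gamma0 n. act_edge g e = e} \<noteq> {}" using Gamma0_one[of n] act_edge_one[of e] by blast
  then show ?thesis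
    unfolding cnt_def of_nat_0_less_iff card_gt_0_iff using finite_edge_transporter[OF assms assms, of n] by blast
qed

lemma cnt_coprime:
  fixes e :: "'a::{field,finite} tree_edge"
  assumes p: "prime p" "CARD('a) = p ^ k" and e: "fst e \<in> tree_vertices"
    and nu: "\<not> (\<exists>g \<in> Gamma0 n. unipotent g \<and> act_vertex g (fst e) = fst e)"
  shows "coprime (cnt n e e) (int p)"
proof -
  let ?S = "{g \<in> Gamma0 n. act_edge g e = e}"
  have "\<not> p dvd card ?S"
  proof
    assume "p dvd card ?S"
    then have "\<exists>g \<in> ?S. unipotent g"
    proof (intro cauchy_unipotent[OF p])
      show "finite ?S" using e by (rule finite_edge_transporter[OF _ e])
      show "\<exists>h \<in> ?S. h ** g = mat 1" if "g \<in> ?S" for g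
      proof -
        obtain h where h: "h \<in> Gamma0 n" "g ** h = mat 1" "h ** g = mat 1"
          using \<open>g \<in> ?S\<close> by (blast elim: Gamma0_inverse)
        have "act_edge h e = act_edge h (act_edge g e)" using that by simp
        also have "\<dots> = e" using h(3) by (rule act_edge_inverse)
        finally show ?thesis using h by blast
      qed
    qed (auto simp add: Gamma0_mult act_edge_mult)
    then show False using nu by (auto simp add: act_edge_def prod_eq_iff)
  qed
  then have "coprime p (card ?S)" using p(1) by (rule prime_imp_coprime[rotated])
  then show ?thesis unfolding cnt_def by (simp add: coprime_commute)
qed

abbreviation vcnt :: "'a::field poly \<Rightarrow> 'a tree_vertex \<Rightarrow> 'a tree_vertex \<Rightarrow> int" where
  "vcnt n v w \<equiv> cnt n (v, v) (w, w)"

lemma finite_star: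
  fixes v :: "'a::{field,finite} tree_vertex"
  assumes "v \<in> tree_vertices"
  shows "finite {e \<in> tree_edges. snd e = v}" "finite {e \<in> tree_edges. fst e = v}"
proof -
  obtain L where "is_lattice L" "v = homothety_class L" using assms by (rule tree_vertexE)
  then show fin: "finite {e \<in> tree_edges. snd e = v}" by (simp add: star_eq finite_nbs)
  have "{e \<in> tree_edges. fst e = v} \<subseteq> prod.swap ` {e \<in> tree_edges. snd e = v}"
    using tree_edge_sym by (auto simp add: image_iff) 
  then show "finite {e \<in> tree_edges. fst e = v}" using fin finite_surj by blast
qed

lemma sum_star_cnt:
  fixes v :: "'a::{field,finite} tree_vertex"
  assumes v: "v \<in> tree_vertices" and e': "e' \<in> tree_edges"
  shows "(\<Sum>e | e \<in> tree_edges \<and> snd e = v. cnt n e e') = vcnt n v (snd e')"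
proof -
  let ?A = "\<lambda>e. {g \<in> Gamma0 n. act_edge g e = e'}"
  have V: "fst e' \<in> tree_vertices" "snd e' \<in> tree_vertices" using e' by (auto simp add: tree_edges_def)
  have eq: "{g \<in> Gamma0 n. act_edge g (v, v) = (snd e', snd e')} = (\<Union>e \<in> {e \<in> tree_edges. snd e = v}. ?A e)"
  proof (intro equalityI subsetI)
    fix g assume "g \<in> {g \<in> Gamma0 n. act_edge g (v, v) = (snd e', snd e')}"
    then have g: "g \<in> Gamma0 n" "act_vertex g v = snd e'" by auto
    have "bij_betw (act_edge g) {e \<in> tree_edges. snd e = v} {e \<in> tree_edges. snd e = act_vertex g v}"
      using Gamma0_det[OF g(1)] v by (rule bij_betw_star)
    then have "e' \<in> act_edge g ` {e \<in> tree_edges. snd e = v}" using e' g by (simp add: bij_betw_def)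
    then show "g \<in> (\<Union>e \<in> {e \<in> tree_edges. snd e = v}. ?A e)" using g by auto
  qed (auto simp add: act_edge_def)
  have "card (\<Union>e \<in> {e \<in> tree_edges. snd e = v}. ?A e) = (\<Sum>e \<in> {e \<in> tree_edges. snd e = v}. card (?A e))"
  proof (rule card_UN_disjoint)
    show "finite {e \<in> tree_edges. snd e = v}" using v by (rule finite_star)
    show "\<forall>e \<in> {e \<in> tree_edges. snd e = v}. finite (?A e)"
    proof
      fix e assume "e \<in> {e \<in> tree_edges. snd e = v}"
      then have "fst e \<in> tree_vertices" by (auto simp add: tree_edges_def)
      then show "finite (?A e)" using V(1) by (rule finite_edge_transporter)
    qed
    show "\<forall>e \<in> {e \<in> tree_edges. snd e = v}. \<forall>e1 \<in> {e \<in> tree_edges. snd e = v}. e \<noteq> e1 \<longrightarrow> ?A e \<inter> ?A e1 = {}"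
    proof (intro ballI impI)
      fix e e1 :: "'a tree_edge" assume "e \<noteq> e1"
      have False if "g \<in> Gamma0 n" "act_edge g e = e'" "act_edge g e1 = e'" for g
      proof -
        have "e = e1"
          using inj_act_edge[OF Gamma0_det[OF that(1)]] by (rule injD) (simp only: that)
        with \<open>e \<noteq> e1\<close> show False ..
      qed
      then show "?A e \<inter> ?A e1 = {}" by blast
    qed
  qed
  then show ?thesis unfolding cnt_def eq by simp
qed

lemma vcnt_total:
  fixes x :: "'i \<Rightarrow> 'a::{field,finite} tree_vertex"
  assumes I: "finite I" and x: "\<And>i. i \<in> I \<Longrightarrow> x i \<in> tree_vertices"
    and zero: "\<And>v. v \<in> tree_vertices \<Longrightarrow> (\<Sum>i\<in>I. b i * vcnt n v (x i)) = 0"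
  shows "(\<Sum>i\<in>I. b i) = 0"
proof -
  define orb where "orb = (\<lambda>i. Gamma0_orbit n (x i, x i))"
  have "(\<Sum>i\<in>I. b i) = (\<Sum>X \<in> orb ` I. \<Sum>i | i \<in> I \<and> orb i = X. b i)"
    using I by (rule sum.image_gen)
  also have "\<dots> = 0"
  proof (rule sum.neutral, rule ballI)
    fix X assume "X \<in> orb ` I"
    then obtain j where j: "j \<in> I" "X = orb j" by blast
    let ?c = "vcnt n (x j) (x j)"
    have v: "vcnt n (x j) (x i) = (if orb i = X then ?c else 0)" for i
    proof (cases "orb i = X")
      case True
      then have "(x i, x i) \<in> Gamma0_orbit n (x j, x j)"
        using j Gamma0_orbit_self[of "(x i, x i)" n] by (simp add: orb_def)
      then obtain h where "h \<in> Gamma0 n" "(x i, x i) = act_edge h (x j, x j)" unfolding mem_Gamma0_orbit by blast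
      then show ?thesis using True cnt_act_right by metis
    next
      case False
      then have "(x i, x i) \<notin> Gamma0_orbit n (x j, x j)"
        using j by (simp add: orb_def Gamma0_orbit_eq_iff[symmetric])
      then show ?thesis using False by (simp add: cnt_no_orbit)
    qed
    have "0 = (\<Sum>i\<in>I. b i * vcnt n (x j) (x i))" using zero[OF x[OF j(1)]] by simp
    also have "\<dots> = (\<Sum>i\<in>I. if orb i = X then b i * ?c else 0)"
      by (rule sum.cong[OF refl], subst v) simp
    also have "\<dots> = (\<Sum>i | i \<in> I \<and> orb i = X. b i * ?c)" using I by (rule sum.inter_filter[symmetric])
    also have "\<dots> = (\<Sum>i | i \<in> I \<and> orb i = X. b i) * ?c" by (simp add: sum_distrib_right)
    finally show "(\<Sum>i | i \<in> I \<and> orb i = X. b i) = 0"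
      using cnt_pos[of "(x j, x j)" n] x[OF j(1)] by simp
  qed
  finally show ?thesis .
qed

section \<open>Invariant flows with finite support\<close>

definition flow :: "'a::field poly \<Rightarrow> 'a cochain \<Rightarrow> bool" where
  "flow n f \<longleftrightarrow> (\<forall>e. e \<notin> tree_edges \<longrightarrow> f e = 0) \<and>
     (\<forall>e \<in> tree_edges. f (prod.swap e) = - f e) \<and>
     (\<forall>g \<in> Gamma0 n. \<forall>e \<in> tree_edges. f (act_edge g e) = f e) \<and>
     finite (Gamma0_orbit n ` {e \<in> tree_edges. f e \<noteq> 0})"

definition divg :: "'a::field cochain \<Rightarrow> 'a tree_vertex \<Rightarrow> int" where
  "divg f v = (\<Sum>e | e \<in> tree_edges \<and> snd e = v. f e)"

lemma H0_iff: "f \<in> H0 n \<longleftrightarrow> flow n f \<and> (\<forall>v \<in> tree_vertices. divg f v = 0)"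
  unfolding H0_def flow_def harmonic_def divg_def by (auto simp add: split_def prod.swap_def)

lemma flow_add: "flow n f \<Longrightarrow> flow n g \<Longrightarrow> flow n (\<lambda>e. f e + g e)"
  unfolding flow_def
proof (elim conjE, intro conjI)
  assume "finite (Gamma0_orbit n ` {e \<in> tree_edges. f e \<noteq> 0})" "finite (Gamma0_orbit n ` {e \<in> tree_edges. g e \<noteq> 0})"
  then have "finite (Gamma0_orbit n ` ({e \<in> tree_edges. f e \<noteq> 0} \<union> {e \<in> tree_edges. g e \<noteq> 0}))"
    by (simp add: image_Un)
  then show "finite (Gamma0_orbit n ` {e \<in> tree_edges. f e + g e \<noteq> 0})"
    by (rule finite_subset[rotated]) (intro image_mono, auto)
qed auto

lemma flow_scale: "flow n f \<Longrightarrow> flow n (\<lambda>e. c * f e)"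
  unfolding flow_def
proof (elim conjE, intro conjI)
  assume "finite (Gamma0_orbit n ` {e \<in> tree_edges. f e \<noteq> 0})"
  then show "finite (Gamma0_orbit n ` {e \<in> tree_edges. c * f e \<noteq> 0})"
    by (rule finite_subset[rotated]) (intro image_mono, auto)
qed auto

lemma flow_zero: "flow n (\<lambda>e. 0)"
  by (simp add: flow_def)

lemma flow_sum: "(\<And>i. i \<in> I \<Longrightarrow> flow n (f i)) \<Longrightarrow> flow n (\<lambda>e. \<Sum>i\<in>I. c i * f i e)"
  by (induction I rule: infinite_finite_induct) (auto intro!: flow_add flow_scale simp add: flow_zero)

lemma divg_add: "divg (\<lambda>e. f e + g e) v = divg f v + divg g v"
  by (simp add: divg_def sum.distrib)

lemma divg_scale: "divg (\<lambda>e. c * f e) v = c * divg f v"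
  by (simp add: divg_def sum_distrib_left)

lemma divg_sum: "divg (\<lambda>e. \<Sum>i\<in>I. c i * f i e) v = (\<Sum>i\<in>I. c i * divg (f i) v)"
  unfolding divg_def by (subst sum.swap) (simp add: sum_distrib_left)

definition pflow :: "'a::field poly \<Rightarrow> 'a tree_edge \<Rightarrow> 'a cochain" where
  "pflow n e' = (\<lambda>e. if e \<in> tree_edges then cnt n e e' - cnt n e (prod.swap e') else 0)"

lemma act_edge_swap: "act_edge g (prod.swap e) = prod.swap (act_edge g e)"
  by (simp add: act_edge_def)

lemma swap_in_tree_edges [simp]: "prod.swap e \<in> tree_edges \<longleftrightarrow> e \<in> tree_edges"
  using tree_edge_sym by (cases e) auto

lemma cnt_swap: "cnt n (prod.swap e) (prod.swap e') = cnt n e e'"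
  unfolding cnt_def act_edge_swap by (metis swap_swap)

lemma flow_pflow: "flow n (pflow n e')"
  unfolding flow_def
proof (intro conjI ballI allI impI)
  fix e :: "'a tree_edge" assume e: "e \<in> tree_edges"
  show "pflow n e' (prod.swap e) = - pflow n e' e"
    using e cnt_swap[of n e e'] cnt_swap[of n e "prod.swap e'"] by (simp add: pflow_def)
  show "pflow n e' (act_edge g e) = pflow n e' e" if "g \<in> Gamma0 n" for g
    using e that Gamma0_det[OF that] by (simp add: pflow_def act_edge_in_tree_iff cnt_act_left)
next
  have "Gamma0_orbit n ` {e \<in> tree_edges. pflow n e' e \<noteq> 0} \<subseteq> {Gamma0_orbit n e', Gamma0_orbit n (prod.swap e')}"
  proof
    fix X assume "X \<in> Gamma0_orbit n ` {e \<in> tree_edges. pflow n e' e \<noteq> 0}"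
    then obtain e where e: "X = Gamma0_orbit n e" "pflow n e' e \<noteq> 0" by blast
    then have "e' \<in> Gamma0_orbit n e \<or> prod.swap e' \<in> Gamma0_orbit n e"
      using cnt_no_orbit[of e' n e] cnt_no_orbit[of "prod.swap e'" n e] by (auto simp add: pflow_def split: if_splits)
    then show "X \<in> {Gamma0_orbit n e', Gamma0_orbit n (prod.swap e')}"
      unfolding e(1) Gamma0_orbit_eq_iff[symmetric] by auto
  qed
  then show "finite (Gamma0_orbit n ` {e \<in> tree_edges. pflow n e' e \<noteq> 0})" by (rule finite_subset) simp
qed (simp add: pflow_def)

lemma divg_pflow:
  fixes v :: "'a::{field,finite} tree_vertex"
  assumes "v \<in> tree_vertices" "e' \<in> tree_edges"
  shows "divg (pflow n e') v = vcnt n v (snd e') - vcnt n v (fst e')"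
proof -
  have "divg (pflow n e') v = (\<Sum>e | e \<in> tree_edges \<and> snd e = v. cnt n e e' - cnt n e (prod.swap e'))"
    unfolding divg_def by (intro sum.cong) (auto simp add: pflow_def)
  then show ?thesis using assms by (simp add: sum_subtractf sum_star_cnt)
qed

lemma flow_between:
  fixes v w :: "'a::{field,finite} tree_vertex"
  assumes "v \<in> tree_vertices" "w \<in> tree_vertices"
  obtains f where "flow n f" "\<And>u. u \<in> tree_vertices \<Longrightarrow> divg f u = vcnt n u w - vcnt n u v"
proof -
  have "\<exists>f. flow n f \<and> (\<forall>u \<in> tree_vertices. divg f u = vcnt n u w - vcnt n u v)"
    using tree_connected[OF assms]
  proof (induction rule: rtrancl_induct)
    case base
    show ?case by (rule exI[of _ "\<lambda>e. 0"]) (simp add: flow_zero divg_def)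
  next
    case (step y z)
    then obtain f where f: "flow n f" "\<forall>u \<in> tree_vertices. divg f u = vcnt n u y - vcnt n u v" by blast
    show ?case
      by (rule exI[of _ "\<lambda>e. f e + pflow n (y, z) e"])
        (use f step(2) in \<open>auto intro!: flow_add flow_pflow simp add: divg_add divg_pflow\<close>)
  qed
  then show ?thesis using that by blast
qed

lemma orbit_reps:
  fixes X :: "'a::field tree_edge set"
  assumes fin: "finite (Gamma0_orbit n ` X)"
  obtains R where "finite R" "R \<subseteq> X" "\<And>e. e \<in> X \<Longrightarrow> \<exists>r \<in> R. r \<in> Gamma0_orbit n e"
    "\<And>r r'. r \<in> R \<Longrightarrow> r' \<in> R \<Longrightarrow> r' \<in> Gamma0_orbit n r \<Longrightarrow> r = r'"
proof -
  define rep where "rep = (\<lambda>O'. SOME e. e \<in> X \<and> Gamma0_orbit n e = O')"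
  have rep: "rep O' \<in> X \<and> Gamma0_orbit n (rep O') = O'" if "O' \<in> Gamma0_orbit n ` X" for O'
    unfolding rep_def by (rule someI_ex) (use that in auto)
  show ?thesis
  proof (rule that[of "rep ` Gamma0_orbit n ` X"])
    show "finite (rep ` Gamma0_orbit n ` X)" using fin by simp
    show "rep ` Gamma0_orbit n ` X \<subseteq> X" using rep by blast
    show "\<exists>r \<in> rep ` Gamma0_orbit n ` X. r \<in> Gamma0_orbit n e" if "e \<in> X" for e
    proof
      have "Gamma0_orbit n (rep (Gamma0_orbit n e)) = Gamma0_orbit n e" using rep that by blast
      then show "rep (Gamma0_orbit n e) \<in> Gamma0_orbit n e" using Gamma0_orbit_self by metis
    qed (use that in blast)
    show "r = r'" if "r \<in> rep ` Gamma0_orbit n ` X" "r' \<in> rep ` Gamma0_orbit n ` X" "r' \<in> Gamma0_orbit n r" for r r'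
    proof -
      have "r = rep (Gamma0_orbit n r)" "r' = rep (Gamma0_orbit n r')" using that(1,2) rep by auto
      then show ?thesis using that(3) by (metis Gamma0_orbit_eq_iff)
    qed
  qed
qed

lemma sum_reps:
  fixes X :: "'a::{field,finite} tree_edge set" and \<phi> :: "'a tree_edge \<Rightarrow> int"
  assumes R: "finite R" "R \<subseteq> X" "\<And>e. e \<in> X \<Longrightarrow> \<exists>r \<in> R. r \<in> Gamma0_orbit n e"
    "\<And>r r'. r \<in> R \<Longrightarrow> r' \<in> R \<Longrightarrow> r' \<in> Gamma0_orbit n r \<Longrightarrow> r = r'"
    and X: "\<And>e g. g \<in> Gamma0 n \<Longrightarrow> e \<in> X \<Longrightarrow> act_edge g e \<in> X"
    and \<phi>: "\<And>e g. g \<in> Gamma0 n \<Longrightarrow> e \<in> X \<Longrightarrow> \<phi> (act_edge g e) = \<phi> e"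
    and m: "m = (\<Prod>r\<in>R. cnt n r r)"
  shows "(\<Sum>r\<in>R. (\<phi> r * (m div cnt n r r)) * cnt n e r) = (if e \<in> X then m * \<phi> e else 0)"
proof (cases "e \<in> X")
  case True
  obtain r where r: "r \<in> R" "r \<in> Gamma0_orbit n e" using R(3)[OF True] by blast
  obtain g where g: "g \<in> Gamma0 n" "r = act_edge g e" using r(2) unfolding mem_Gamma0_orbit by blast
  have "cnt n e r' = 0" if "r' \<in> R - {r}" for r'
  proof (rule cnt_no_orbit)
    show "r' \<notin> Gamma0_orbit n e"
    proof
      assume "r' \<in> Gamma0_orbit n e"
      moreover have "Gamma0_orbit n e = Gamma0_orbit n r" using r(2) by (simp add: Gamma0_orbit_eq_iff)
      ultimately have "r = r'" using R(4)[OF r(1), of r'] that by blast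
      then show False using that by blast
    qed
  qed
  then have "(\<Sum>r\<in>R. (\<phi> r * (m div cnt n r r)) * cnt n e r) = (\<Sum>r'\<in>{r}. (\<phi> r' * (m div cnt n r' r')) * cnt n e r')"
    using R(1) r(1) by (intro sum.mono_neutral_right) auto
  also have "\<dots> = \<phi> r * ((m div cnt n r r) * cnt n r r)" by (simp add: cnt_orbit[OF r(2)])
  also have "cnt n r r dvd m" unfolding m using R(1) r(1) by (rule dvd_prodI)
  then have "(m div cnt n r r) * cnt n r r = m" by simp
  also have "\<phi> r = \<phi> e" using \<phi> g True by simp
  finally show ?thesis using True by simp
next
  case False
  have "cnt n e r = 0" if r: "r \<in> R" for r
  proof (rule cnt_no_orbit)
    show "r \<notin> Gamma0_orbit n e"
    proof
      assume "r \<in> Gamma0_orbit n e"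
      then have "e \<in> Gamma0_orbit n r" by (metis Gamma0_orbit_eq_iff)
      then obtain g where "g \<in> Gamma0 n" "e = act_edge g r" unfolding mem_Gamma0_orbit by blast
      then show False using X r R(2) False by blast
    qed
  qed
  then show ?thesis using False by simp
qed

lemma low_edges_finite:
  fixes n :: "'a::{field,finite} poly"
  assumes n: "n \<noteq> 0"
  shows "finite (Gamma0_orbit n ` {e \<in> tree_edges. fst e \<in> low_vertices n})"
    and "finite (Gamma0_orbit n ` (\<lambda>v. (v, v)) ` low_vertices n)"
proof -
  obtain F where F: "finite F" "F \<subseteq> tree_vertices"
    "\<And>v. v \<in> low_vertices n \<Longrightarrow> \<exists>g \<in> Gamma0 n. \<exists>u \<in> F. v = act_vertex g u"
    using n by (rule low_vertices_reps) blast
  have "Gamma0_orbit n ` {e \<in> tree_edges. fst e \<in> low_vertices n} \<subseteq> Gamma0_orbit n ` (\<Union>u\<in>F. {e \<in> tree_edges. fst e = u})"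
  proof
    fix O' assume "O' \<in> Gamma0_orbit n ` {e \<in> tree_edges. fst e \<in> low_vertices n}"
    then obtain e where e: "e \<in> tree_edges" "fst e \<in> low_vertices n" "O' = Gamma0_orbit n e" by blast
    obtain g u where g: "g \<in> Gamma0 n" "u \<in> F" "fst e = act_vertex g u" using F(3)[OF e(2)] by blast
    obtain h where h: "h \<in> Gamma0 n" "g ** h = mat 1" "h ** g = mat 1" using g(1) by (rule Gamma0_inverse)
    have "act_edge h e \<in> tree_edges" using e(1) Gamma0_det[OF h(1)] by (simp add: act_edge_in_tree_iff)
    moreover have "fst (act_edge h e) = u" using g h by (simp add: act_edge_def act_vertex_inverse)
    moreover have "Gamma0_orbit n (act_edge h e) = O'" using e(3) h(1) by (simp add: Gamma0_orbit_act)
    ultimately show "O' \<in> Gamma0_orbit n ` (\<Union>u\<in>F. {e \<in> tree_edges. fst e = u})" using g(2) by blast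
  qed
  moreover have "finite (\<Union>u\<in>F. {e \<in> tree_edges. fst e = u})" using F(1,2) finite_star(2) by blast
  ultimately show "finite (Gamma0_orbit n ` {e \<in> tree_edges. fst e \<in> low_vertices n})"
    by (rule finite_subset[OF _ finite_imageI])
  have "Gamma0_orbit n ` (\<lambda>v. (v, v)) ` low_vertices n \<subseteq> Gamma0_orbit n ` (\<lambda>v. (v, v)) ` F"
  proof
    fix O' assume "O' \<in> Gamma0_orbit n ` (\<lambda>v. (v, v)) ` low_vertices n"
    then obtain v where v: "v \<in> low_vertices n" "O' = Gamma0_orbit n (v, v)" by blast
    obtain g u where g: "g \<in> Gamma0 n" "u \<in> F" "v = act_vertex g u" using F(3)[OF v(1)] by blast
    have "O' = Gamma0_orbit n (u, u)" using Gamma0_orbit_act[OF g(1), of "(u, u)"] by (simp add: v(2) g(3))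
    then show "O' \<in> Gamma0_orbit n ` (\<lambda>v. (v, v)) ` F" using g(2) by blast
  qed
  then show "finite (Gamma0_orbit n ` (\<lambda>v. (v, v)) ` low_vertices n)"
    by (rule finite_subset) (simp add: F(1))
qed

text \<open>
  The gradient of \<open>G0\<close> is an integral flow that is conserved only modulo \<open>p\<close>. As it vanishes near all
  vertices whose stabilizer has order divisible by \<open>p\<close>, its divergence is, up to a factor prime to \<open>p\<close>,
  \<open>p\<close> times an integral combination of orbit sums of total mass 0, hence \<open>p\<close> times a divergence.
\<close>

lemma gradient_lift:
  fixes n :: "'a::{field,finite} poly" and G0 :: "'a tree_vertex \<Rightarrow> int"
  assumes p: "prime p" "CARD('a) = p ^ k" and n: "n \<noteq> 0"
    and inv: "\<And>g v. g \<in> Gamma0 n \<Longrightarrow> v \<in> tree_vertices \<Longrightarrow> G0 (act_vertex g v) = G0 v"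
    and harm: "\<And>v. v \<in> tree_vertices \<Longrightarrow> int p dvd (\<Sum>e | e \<in> tree_edges \<and> snd e = v. G0 (snd e) - G0 (fst e))"
    and uni: "\<And>g v w. g \<in> Gamma0 n \<Longrightarrow> unipotent g \<Longrightarrow> act_vertex g v = v \<Longrightarrow> (v, w) \<in> tree_edges \<Longrightarrow> G0 w = G0 v"
  obtains M f where "coprime M (int p)" "f \<in> H0 n"
    "\<And>e. e \<in> tree_edges \<Longrightarrow> int p dvd f e - M * (G0 (snd e) - G0 (fst e))"
proof -
  define \<phi> where "\<phi> = (\<lambda>e. G0 (snd e) - G0 (fst e))"
  have V: "fst e \<in> tree_vertices" "snd e \<in> tree_vertices" if "e \<in> tree_edges" for e :: "'a tree_edge"
    using that by (auto simp add: tree_edges_def)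
  have \<phi>act: "\<phi> (act_edge g e) = \<phi> e" if "g \<in> Gamma0 n" "e \<in> tree_edges" for g e
    using that inv V by (simp add: \<phi>_def act_edge_def)
  have \<phi>swap: "\<phi> (prod.swap e) = - \<phi> e" for e by (simp add: \<phi>_def)
  have \<phi>uni: "\<phi> e = 0" if "g \<in> Gamma0 n" "unipotent g" "act_vertex g (fst e) = fst e" "e \<in> tree_edges" for g e
    using uni[OF that(1-3), of "snd e"] that(4) by (simp add: \<phi>_def)
  have low: "v \<in> low_vertices n"
    if "v \<in> tree_vertices" "\<not> (\<exists>g \<in> Gamma0 n. unipotent g \<and> act_vertex g v = v)" for v
    using not_low_unipotent[OF that(1) _ n] that(2) by blast
  define X1 where "X1 = {e \<in> tree_edges. 0 < \<phi> e}"
  have X1nu: "\<not> (\<exists>g \<in> Gamma0 n. unipotent g \<and> act_vertex g (fst e) = fst e)" if "e \<in> X1" for e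
    using that \<phi>uni[of _ e] by (auto simp add: X1_def)
  have X1low: "X1 \<subseteq> {e \<in> tree_edges. fst e \<in> low_vertices n}"
    using X1nu low V by (auto simp add: X1_def)
  have finX1: "finite (Gamma0_orbit n ` X1)"
    by (rule finite_subset[OF image_mono[OF X1low] low_edges_finite(1)[OF n]])
  obtain R1 where R1: "finite R1" "R1 \<subseteq> X1" "\<And>e. e \<in> X1 \<Longrightarrow> \<exists>r \<in> R1. r \<in> Gamma0_orbit n e"
    "\<And>r r'. r \<in> R1 \<Longrightarrow> r' \<in> R1 \<Longrightarrow> r' \<in> Gamma0_orbit n r \<Longrightarrow> r = r'"
    using finX1 by (rule orbit_reps) blast
  define m1 where "m1 = (\<Prod>r\<in>R1. cnt n r r)"
  have X1act: "act_edge g e \<in> X1" if "g \<in> Gamma0 n" "e \<in> X1" for g e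
    using that \<phi>act Gamma0_det[OF that(1)] by (simp add: X1_def act_edge_in_tree_iff)
  define c1 where "c1 = (\<lambda>r. \<phi> r * (m1 div cnt n r r))"
  have s1: "(\<Sum>r\<in>R1. c1 r * cnt n e r) = (if e \<in> X1 then m1 * \<phi> e else 0)" for e
    unfolding c1_def by (rule sum_reps[OF R1 X1act _ m1_def]) (auto simp add: X1_def \<phi>act)
  have R1E: "r \<in> tree_edges" if "r \<in> R1" for r using that R1(2) by (auto simp add: X1_def)
  have m1: "coprime m1 (int p)" unfolding m1_def
    using R1(2) X1nu V by (intro prod_coprime_left cnt_coprime[OF p]) (auto simp add: X1_def)
  define F1 where "F1 = (\<lambda>e. \<Sum>r\<in>R1. c1 r * pflow n r e)"
  have F1: "flow n F1" unfolding F1_def by (rule flow_sum) (rule flow_pflow)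
  have F1e: "F1 e = m1 * \<phi> e" if e: "e \<in> tree_edges" for e
  proof -
    have "F1 e = (\<Sum>r\<in>R1. c1 r * cnt n e r) - (\<Sum>r\<in>R1. c1 r * cnt n (prod.swap e) r)"
      unfolding F1_def sum_subtractf[symmetric] using e cnt_swap[of n "prod.swap e"]
      by (intro sum.cong refl) (simp add: pflow_def algebra_simps)
    then show ?thesis unfolding s1 using e \<phi>swap[of e] by (auto simp add: X1_def)
  qed
  define D where "D = (\<lambda>v. (\<Sum>e | e \<in> tree_edges \<and> snd e = v. \<phi> e) div int p)"
  have D: "(\<Sum>e | e \<in> tree_edges \<and> snd e = v. \<phi> e) = int p * D v" if "v \<in> tree_vertices" for v
    using harm[OF that] unfolding D_def \<phi>_def by simp
  have dF1: "divg F1 v = m1 * (int p * D v)" if "v \<in> tree_vertices" for v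
  proof -
    have "divg F1 v = (\<Sum>e | e \<in> tree_edges \<and> snd e = v. m1 * \<phi> e)"
      unfolding divg_def by (rule sum.cong) (auto simp add: F1e)
    then show ?thesis by (simp add: D[OF that] flip: sum_distrib_left)
  qed
  have dF1': "divg F1 v = (\<Sum>r\<in>R1. c1 r * (vcnt n v (snd r) - vcnt n v (fst r)))" if "v \<in> tree_vertices" for v
    unfolding F1_def divg_sum using that R1E by (intro sum.cong refl) (simp add: divg_pflow)
  have Dact: "D (act_vertex g v) = D v" if g: "g \<in> Gamma0 n" and v: "v \<in> tree_vertices" for g v
  proof -
    have "(\<Sum>e | e \<in> tree_edges \<and> snd e = act_vertex g v. \<phi> e) = (\<Sum>e | e \<in> tree_edges \<and> snd e = v. \<phi> (act_edge g e))"
      by (rule sum.reindex_bij_betw[symmetric]) (rule bij_betw_star[OF Gamma0_det[OF g] v])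
    also have "\<dots> = (\<Sum>e | e \<in> tree_edges \<and> snd e = v. \<phi> e)" using \<phi>act[OF g] by (intro sum.cong) auto
    finally show ?thesis by (simp add: D_def)
  qed
  have Duni: "D v = 0" if "\<exists>g \<in> Gamma0 n. unipotent g \<and> act_vertex g v = v" for v
  proof -
    have "\<phi> e = 0" if "e \<in> tree_edges" "snd e = v" for e
    proof -
      obtain g where "g \<in> Gamma0 n" "unipotent g" "act_vertex g v = v" using \<open>\<exists>g \<in> Gamma0 n. _\<close> by blast
      then have "\<phi> (prod.swap e) = 0" using that by (intro \<phi>uni[of g]) auto
      then show ?thesis by (simp add: \<phi>swap)
    qed
    then show ?thesis by (simp add: D_def)
  qed
  define X2 where "X2 = (\<lambda>v. (v, v)) ` {v \<in> tree_vertices. D v \<noteq> 0}"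
  have X2low: "X2 \<subseteq> (\<lambda>v. (v, v)) ` low_vertices n"
  proof -
    have "v \<in> low_vertices n" if "v \<in> tree_vertices" "D v \<noteq> 0" for v
      using low[OF that(1)] Duni[of v] that(2) by argo
    then show ?thesis by (auto simp add: X2_def)
  qed
  have finX2: "finite (Gamma0_orbit n ` X2)"
    by (rule finite_subset[OF image_mono[OF X2low] low_edges_finite(2)[OF n]])
  obtain R2 where R2: "finite R2" "R2 \<subseteq> X2" "\<And>e. e \<in> X2 \<Longrightarrow> \<exists>r \<in> R2. r \<in> Gamma0_orbit n e"
    "\<And>r r'. r \<in> R2 \<Longrightarrow> r' \<in> R2 \<Longrightarrow> r' \<in> Gamma0_orbit n r \<Longrightarrow> r = r'"
    using finX2 by (rule orbit_reps) blast
  define m2 where "m2 = (\<Prod>r\<in>R2. cnt n r r)"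
  have X2act: "act_edge g e \<in> X2" if "g \<in> Gamma0 n" "e \<in> X2" for g e
    using that Dact Gamma0_det[OF that(1)] by (auto simp add: X2_def act_vertex_in_tree_iff)
  define c2 where "c2 = (\<lambda>r :: 'a tree_edge. D (fst r) * (m2 div cnt n r r))"
  have R2d: "r = (fst r, fst r)" "fst r \<in> tree_vertices" if "r \<in> R2" for r
    using that R2(2) by (auto simp add: X2_def)
  have s2: "(\<Sum>r\<in>R2. c2 r * vcnt n v (fst r)) = m2 * D v" if "v \<in> tree_vertices" for v
  proof -
    have "(\<Sum>r\<in>R2. c2 r * cnt n (v, v) r) = (if (v, v) \<in> X2 then m2 * D (fst (v, v)) else 0)"
      unfolding c2_def by (rule sum_reps[OF R2 X2act _ m2_def]) (auto simp add: X2_def Dact)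
    moreover have "(\<Sum>r\<in>R2. c2 r * vcnt n v (fst r)) = (\<Sum>r\<in>R2. c2 r * cnt n (v, v) r)"
      by (rule sum.cong[OF refl]) (use R2d(1) in simp)
    ultimately show ?thesis using that by (auto simp add: X2_def)
  qed
  have m2: "coprime m2 (int p)" unfolding m2_def
  proof (rule prod_coprime_left)
    fix r assume r: "r \<in> R2"
    then have "D (fst r) \<noteq> 0" using R2(2) by (auto simp add: X2_def)
    then have "\<not> (\<exists>g \<in> Gamma0 n. unipotent g \<and> act_vertex g (fst r) = fst r)" using Duni by blast
    then show "coprime (cnt n r r) (int p)" by (rule cnt_coprime[OF p R2d(2)[OF r]])
  qed
  have p0: "int p \<noteq> 0" using p(1) by auto
  have m10: "m1 \<noteq> 0" using m1 p(1) by auto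
  define s where "s = (\<Sum>r\<in>R2. c2 r)"
  have "s = 0"
  proof -
    define I where "I = (R1 \<times> (UNIV :: bool set)) <+> R2"
    define x where "x = (\<lambda>i :: ('a tree_edge \<times> bool) + 'a tree_edge.
      case i of Inl (r, b) \<Rightarrow> if b then snd r else fst r | Inr r \<Rightarrow> fst r)"
    define b where "b = (\<lambda>i :: ('a tree_edge \<times> bool) + 'a tree_edge.
      case i of Inl (r, b) \<Rightarrow> if b then m2 * c1 r else - (m2 * c1 r) | Inr r \<Rightarrow> - (int p * m1 * c2 r))"
    have split: "(\<Sum>i\<in>I. F i) = (\<Sum>r\<in>R1. F (Inl (r, True)) + F (Inl (r, False))) + (\<Sum>r\<in>R2. F (Inr r))"
      for F :: "('a tree_edge \<times> bool) + 'a tree_edge \<Rightarrow> int"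
    proof -
      have "(\<Sum>i\<in>I. F i) = (\<Sum>z\<in>R1 \<times> UNIV. F (Inl z)) + (\<Sum>r\<in>R2. F (Inr r))"
        unfolding I_def using R1(1) R2(1) by (simp add: sum.Plus)
      also have "(\<Sum>z\<in>R1 \<times> UNIV. F (Inl z)) = (\<Sum>r\<in>R1. \<Sum>b\<in>UNIV. F (Inl (r, b)))"
        by (simp add: sum.cartesian_product)
      finally show ?thesis by (simp add: UNIV_bool add.commute)
    qed
    have "(\<Sum>i\<in>I. b i) = 0"
    proof (rule vcnt_total)
      show "finite I" unfolding I_def using R1(1) R2(1) by auto
      show "x i \<in> tree_vertices" if "i \<in> I" for i
      proof -
        have "fst r \<in> tree_vertices" "snd r \<in> tree_vertices" if "r \<in> R1" for r
          using V R1E[OF that] by blast+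
        then show ?thesis using that R2d(2) by (force simp add: I_def x_def)
      qed
      show "(\<Sum>i\<in>I. b i * vcnt n v (x i)) = 0" if v: "v \<in> tree_vertices" for v
      proof -
        have "(\<Sum>i\<in>I. b i * vcnt n v (x i)) =
            m2 * (\<Sum>r\<in>R1. c1 r * (vcnt n v (snd r) - vcnt n v (fst r))) - int p * m1 * (\<Sum>r\<in>R2. c2 r * vcnt n v (fst r))"
          unfolding split by (simp add: b_def x_def sum_distrib_left sum_negf algebra_simps)
        also have "\<dots> = m2 * (m1 * (int p * D v)) - int p * m1 * (m2 * D v)"
          using dF1[OF v] dF1'[OF v] s2[OF v] by simp
        finally show ?thesis by simp
      qed
    qed
    moreover have "(\<Sum>i\<in>I. b i) = - (int p * m1 * s)"
      unfolding split s_def by (simp add: b_def sum_distrib_left sum_negf)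
    ultimately show ?thesis using p0 m10 by simp
  qed
  obtain v0 :: "'a tree_vertex" where v0: "v0 \<in> tree_vertices" using is_lattice_Vc by blast
  have "\<forall>u \<in> tree_vertices. \<exists>f. flow n f \<and> (\<forall>v \<in> tree_vertices. divg f v = vcnt n v u - vcnt n v v0)"
    using flow_between[OF v0] by metis
  then obtain pf where pf: "\<And>u. u \<in> tree_vertices \<Longrightarrow> flow n (pf u)"
    "\<And>u v. u \<in> tree_vertices \<Longrightarrow> v \<in> tree_vertices \<Longrightarrow> divg (pf u) v = vcnt n v u - vcnt n v v0"
    by metis
  define F2 where "F2 = (\<lambda>e. \<Sum>r\<in>R2. c2 r * pf (fst r) e)"
  have F2: "flow n F2" unfolding F2_def using pf(1) R2d(2) by (intro flow_sum) auto
  have dF2: "divg F2 v = m2 * D v" if "v \<in> tree_vertices" for v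
  proof -
    have "divg F2 v = (\<Sum>r\<in>R2. c2 r * (vcnt n v (fst r) - vcnt n v v0))"
      unfolding F2_def divg_sum using that pf(2) R2d(2) by (intro sum.cong refl) simp
    also have "\<dots> = (\<Sum>r\<in>R2. c2 r * vcnt n v (fst r)) - s * vcnt n v v0"
      by (simp add: s_def right_diff_distrib sum_subtractf sum_distrib_right)
    finally show ?thesis using s2[OF that] \<open>s = 0\<close> by simp
  qed
  define f where "f = (\<lambda>e. m2 * F1 e + (- int p * m1) * F2 e)"
  have "flow n f" unfolding f_def by (intro flow_add flow_scale F1 F2)
  moreover have "divg f v = 0" if "v \<in> tree_vertices" for v
    unfolding f_def divg_add divg_scale dF1[OF that] dF2[OF that] by simp
  ultimately have "f \<in> H0 n" by (simp add: H0_iff)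
  moreover have "int p dvd f e - (m1 * m2) * (G0 (snd e) - G0 (fst e))" if "e \<in> tree_edges" for e
  proof -
    have "f e - (m1 * m2) * (G0 (snd e) - G0 (fst e)) = int p * (- m1 * F2 e)"
      unfolding f_def F1e[OF that] by (simp add: \<phi>_def algebra_simps)
    then show ?thesis by simp
  qed
  moreover have "coprime (m1 * m2) (int p)" using m1 m2 by simp
  ultimately show ?thesis using that by blast
qed

section \<open>Bounded harmonic cochains vanish near the cusps\<close>

lemma lat_e1:
  fixes y :: "'a::field fls ^ 2"
  assumes y2: "y $ 2 \<noteq> 0" and c0: "0 \<le> fls_subdegree (y $ 2)"
  shows "\<exists>h \<in> Gamma0 1. lat (vector [1, 0]) y = mact h (Vc (fls_subdegree (y $ 2)))"
proof -
  define c where "c = fls_subdegree (y $ 2)"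
  obtain P where P: "(y $ 1 / y $ 2 - embed_poly P) / pw 1 \<in> valuation_ring" using embed_poly_part by blast
  define r where "r = y $ 1 / y $ 2 - embed_poly P"
  have r: "r \<in> valuation_ring" using P divide_X_imp unfolding r_def by blast
  define h :: "'a poly ^ 2 ^ 2" where "h = vector [vector [1, P], vector [0, 1]]"
  have "det h = 1" by (simp add: h_def det_2)
  then have h: "h \<in> Gamma0 1" by (rule Gamma0_det1) simp
  define e1 :: "'a fls ^ 2" where "e1 = vector [1, 0]"
  define y' :: "'a fls ^ 2" where "y' = vector [0, y $ 2]"
  have d: "dt e1 y' \<noteq> 0" using y2 by (simp add: dt_def e1_def y'_def)
  have "Vc c = lat e1 y'"
  proof (rule Set.set_eqI)
    fix z :: "'a fls ^ 2"
    have eq: "z $ 2 / pw c \<in> valuation_ring \<longleftrightarrow> z $ 2 / y $ 2 \<in> valuation_ring"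
      using y2 unfolding divide_pw_in_valuation_ring c_def
      by (cases "z $ 2 = 0") (auto simp add: valuation_ring_def fls_divide_subdegree)
    show "z \<in> Vc c \<longleftrightarrow> z \<in> lat e1 y'"
      using y2 unfolding in_Vc_iff in_lat_iff[OF d] by (auto simp add: eq dt_def e1_def y'_def)
  qed
  also have "\<dots> = lat e1 (y' + (r * y $ 2) *s e1)"
  proof -
    have "y $ 2 \<in> valuation_ring" using c0 by (simp add: valuation_ring_def)
    with r have "r * y $ 2 \<in> valuation_ring" by (rule valuation_ring_mult)
    then show ?thesis by (rule lat_shear[OF d, symmetric])
  qed
  finally have V: "Vc c = lat e1 (y' + (r * y $ 2) *s e1)" .
  have m: "map_matrix embed_poly h *v e1 = e1" "map_matrix embed_poly h *v (y' + (r * y $ 2) *s e1) = y"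
    using y2 by (simp_all add: vec2_eq_iff mat2_vec_component map_matrix_def h_def e1_def y'_def r_def field_simps)
  have "lat (vector [1, 0]) y = mact h (Vc c)" unfolding V mact_lat m by (simp add: e1_def)
  with h show ?thesis unfolding c_def by blast
qed

definition cvert :: "'a::field poly ^ 2 ^ 2 \<Rightarrow> int \<Rightarrow> 'a tree_vertex" where
  "cvert g c = act_vertex g (homothety_class (Vc c))"

lemma cvert_in_tree: "g \<in> Gamma0 1 \<Longrightarrow> cvert g c \<in> tree_vertices"
  unfolding cvert_def using Gamma0_det by (auto intro!: act_vertex_in_tree)

lemma tree_vertex_cvert:
  fixes v :: "'a::{field,finite} tree_vertex"
  assumes "v \<in> tree_vertices"
  obtains g c where "g \<in> Gamma0 1" "0 \<le> c" "v = cvert g c"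
  using tree_vertex_reduction[OF assms] unfolding cvert_def by metis

text \<open>The unipotents of \<open>Gamma0 n\<close> that fix a vertex far up a cusp permute its lower neighbours transitively.\<close>

lemma sum_star_cusp:
  fixes f :: "'a::{field,finite} cochain" and n :: "'a poly"
  assumes n: "n \<noteq> 0" and g: "g \<in> Gamma0 1" and c: "int (degree n) \<le> c"
    and inv: "\<And>h e. h \<in> Gamma0 n \<Longrightarrow> e \<in> tree_edges \<Longrightarrow> f (act_edge h e) = f e"
  shows "divg f (cvert g c) = f (cvert g (c + 1), cvert g c) + int CARD('a) * f (cvert g (c - 1), cvert g c)"
    and "e \<in> tree_edges \<Longrightarrow> snd e = cvert g c \<Longrightarrow> f e = f (cvert g (c + 1), cvert g c) \<or> f e = f (cvert g (c - 1), cvert g c)"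
proof -
  obtain g' where g': "g' \<in> Gamma0 1" "g ** g' = mat 1" "g' ** g = mat 1" using g by (rule Gamma0_inverse)
  define F where "F = (\<lambda>e. f (act_edge g e))"
  define x where "x = (vector [1, 0] :: 'a fls ^ 2)"
  define y where "y = (vector [0, pw c] :: 'a fls ^ 2)"
  have d: "dt x y \<noteq> 0" by (simp add: x_def y_def dt_def)
  have V: "Vc c = lat x y" by (simp add: Vc_def x_def y_def)
  let ?L = "\<lambda>t. lat (y + fls_const t *s x) (pw 1 *s x)"
  have up: "lat x (pw 1 *s y) = Vc (c + 1)"
  proof -
    have "pw 1 *s y = vector [0, pw (c + 1)]" by (simp add: vec2_eq_iff y_def add.commute[of c] pw_add)
    then show ?thesis by (simp add: Vc_def x_def)
  qed
  have down: "homothety_class (?L 0) = homothety_class (Vc (c - 1))"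
  proof -
    have "?L 0 = lat (pw 1 *s x) y" by (simp add: lat_swap)
    also have "\<dots> = sc 1 (Vc (c - 1))"
      unfolding Vc_def sc_def scale_lat by (simp add: x_def y_def vec2_eq_iff pw_diff arg_cong2[where f = lat])
    finally show ?thesis by (simp add: homothety_class_sc)
  qed
  have trans: "F (homothety_class (?L t), homothety_class (Vc c)) = F (homothety_class (Vc (c - 1)), homothety_class (Vc c))" for t
  proof -
    define b where "b = Polynomial.smult (t / lead_coeff n) (monom 1 (nat c - degree n) * n)"
    define \<tau> :: "'a poly ^ 2 ^ 2" where "\<tau> = vector [vector [1, b], vector [0, 1]]"
    define h where "h = g ** \<tau> ** g'"
    have "det \<tau> = 1" by (simp add: \<tau>_def det_2)
    moreover have "det g * det g' = 1" by (metis g'(2) det_I det_mul)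
    ultimately have dh: "det h = 1" by (simp add: h_def det_mul)
    have "g $ 2 $ 1 * g' $ 1 $ 1 + g $ 2 $ 2 * g' $ 2 $ 1 = 0"
      using g'(2) by (simp add: mat2_eq_iff mat2_mult_component mat2_one_component)
    then have "h $ 2 $ 1 = b * (g $ 2 $ 1 * g' $ 2 $ 1)"
      by (simp add: h_def mat2_mult_component \<tau>_def algebra_simps)
    moreover have "n dvd b" by (simp add: b_def dvd_smult)
    ultimately have h: "h \<in> Gamma0 n" using dh by (intro Gamma0_det1) auto
    have hg: "h ** g = g ** \<tau>" by (simp add: h_def g'(3) flip: matrix_mul_assoc)
    have r: "(embed_poly b * pw c - fls_const t) / pw 1 \<in> valuation_ring"
    proof -
      have "(embed_poly b * pw c) $$ k = (if k \<le> c then coeff b (nat (c - k)) else 0)" for k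
      proof -
        have "embed_poly b * pw c = fls_shift (- c) (embed_poly b)"
          by (simp add: pw_def fls_X_intpow_times_conv_shift)
        then show ?thesis by (simp add: embed_poly_nth)
      qed
      moreover have "coeff b (nat c) = t"
      proof -
        have "degree n \<le> nat c" using c by linarith
        then have "coeff (monom 1 (nat c - degree n) * n) (nat c) = lead_coeff n"
          by (simp add: coeff_monom_mult)
        then show ?thesis using n by (simp add: b_def)
      qed
      moreover have "coeff b (nat (c - k)) = 0" if "k < 0" for k
      proof (rule coeff_eq_0)
        have "degree (monom 1 (nat c - degree n) * n) = nat c"
          using n c by (subst degree_mult_eq) (auto simp add: degree_monom_eq)
        then have "degree b \<le> nat c" unfolding b_def by (metis degree_smult_le)
        then show "degree b < nat (c - k)" using that c by simp
      qed
      ultimately show ?thesis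
        using c unfolding divide_X_in_valuation_ring_iff by auto
    qed
    have "mact \<tau> (Vc c) = Vc c"
    proof -
      have "map_matrix embed_poly \<tau> *v x = x" "map_matrix embed_poly \<tau> *v y = y + (embed_poly b * pw c) *s x"
        by (simp_all add: vec2_eq_iff mat2_vec_component map_matrix_def \<tau>_def x_def y_def)
      moreover have "embed_poly b * pw c \<in> valuation_ring"
      proof -
        have "embed_poly b * pw c - fls_const t + fls_const t \<in> valuation_ring"
          using divide_X_imp[OF r] by (rule valuation_ring_add) simp
        then show ?thesis by simp
      qed
      ultimately show ?thesis unfolding V mact_lat using lat_shear[OF d] by simp
    qed
    moreover have "mact \<tau> (?L 0) = ?L t"
    proof -
      define s where "s = (embed_poly b * pw c - fls_const t) / pw 1"
      have "map_matrix embed_poly \<tau> *v (pw 1 *s x) = pw 1 *s x"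
        "map_matrix embed_poly \<tau> *v (y + fls_const 0 *s x) = (y + fls_const t *s x) + s *s (pw 1 *s x)"
        by (simp_all add: vec2_eq_iff mat2_vec_component map_matrix_def \<tau>_def x_def y_def s_def)
      then have "mact \<tau> (?L 0) = lat (pw 1 *s x) ((y + fls_const t *s x) + s *s (pw 1 *s x))"
        by (simp only: mact_lat lat_swap)
      also have "\<dots> = lat (pw 1 *s x) (y + fls_const t *s x)"
      proof (rule lat_shear)
        show "dt (pw 1 *s x) (y + fls_const t *s x) \<noteq> 0" using d by (simp add: dt_simps)
        show "s \<in> valuation_ring" using r unfolding s_def .
      qed
      finally show ?thesis by (simp only: lat_swap)
    qed
    ultimately have e: "act_edge \<tau> (homothety_class (?L 0), homothety_class (Vc c)) = (homothety_class (?L t), homothety_class (Vc c))"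
      by (simp only: act_edge_pair act_homothety_class)
    have ed: "(homothety_class (?L 0), homothety_class (Vc c)) \<in> tree_edges"
    proof -
      have "?L 0 \<in> nbs (Vc c)" unfolding V nbs_lat(1)[OF d] by blast
      then have "(homothety_class (Vc c), homothety_class (?L 0)) \<in> tree_edges"
        unfolding tree_edge_iff[OF is_lattice_Vc] by blast
      then show ?thesis by (rule tree_edge_sym)
    qed
    then have "act_edge g (homothety_class (?L 0), homothety_class (Vc c)) \<in> tree_edges"
      using Gamma0_det[OF g] by (intro act_edge_in_tree)
    then have "F (homothety_class (?L 0), homothety_class (Vc c)) = f (act_edge h (act_edge g (homothety_class (?L 0), homothety_class (Vc c))))"
      unfolding F_def by (rule inv[OF h, symmetric])
    also have "act_edge h (act_edge g (homothety_class (?L 0), homothety_class (Vc c))) = act_edge g (homothety_class (?L t), homothety_class (Vc c))"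
      unfolding act_edge_mult[symmetric] hg unfolding act_edge_mult e ..
    finally show ?thesis unfolding down F_def by simp
  qed
  have star: "(\<Sum>e | e \<in> tree_edges \<and> snd e = cvert g c. f e) = (\<Sum>e | e \<in> tree_edges \<and> snd e = homothety_class (Vc c). F e)"
    unfolding cvert_def F_def
    by (rule sum.reindex_bij_betw[symmetric]) (rule bij_betw_star[OF Gamma0_det[OF g]], simp add: homothety_class_in_tree_vertices)
  have F: "F (homothety_class (Vc b), homothety_class (Vc b')) = f (cvert g b, cvert g b')" for b b'
    by (simp add: F_def cvert_def)
  have "divg f (cvert g c) = F (homothety_class (Vc (c + 1)), homothety_class (Vc c)) + (\<Sum>t\<in>UNIV. F (homothety_class (?L t), homothety_class (Vc c)))"
    unfolding divg_def star sum_star[OF is_lattice_Vc]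
    using sum_nbs[OF d, of "\<lambda>L'. F (homothety_class L', homothety_class (Vc c))"] unfolding up V[symmetric] .
  then show "divg f (cvert g c) = f (cvert g (c + 1), cvert g c) + int CARD('a) * f (cvert g (c - 1), cvert g c)"
    unfolding trans F by simp
  show "f e = f (cvert g (c + 1), cvert g c) \<or> f e = f (cvert g (c - 1), cvert g c)"
    if e: "e \<in> tree_edges" "snd e = cvert g c" for e
  proof -
    have "e \<in> act_edge g ` {e \<in> tree_edges. snd e = homothety_class (Vc c)}"
      using e bij_betw_star[OF Gamma0_det[OF g], of "homothety_class (Vc c)"]
      by (auto simp add: bij_betw_def cvert_def homothety_class_in_tree_vertices)
    then obtain e' where e': "e' \<in> tree_edges" "snd e' = homothety_class (Vc c)" "e = act_edge g e'" by blast
    then obtain L' where L': "L' \<in> nbs (Vc c)" "e' = (homothety_class L', homothety_class (Vc c))"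
      using star_eq[OF is_lattice_Vc, of c] by blast
    have "L' = Vc (c + 1) \<or> (\<exists>t. L' = ?L t)" using L'(1) unfolding V nbs_lat(1)[OF d] up by blast
    then have "F e' = F (homothety_class (Vc (c + 1)), homothety_class (Vc c)) \<or> F e' = F (homothety_class (Vc (c - 1)), homothety_class (Vc c))"
      using trans L'(2) by metis
    then show ?thesis unfolding F using e'(3) by (simp add: F_def)
  qed
qed

definition hinv :: "'a::field poly \<Rightarrow> 'a cochain \<Rightarrow> bool" where
  "hinv n f \<longleftrightarrow> (\<forall>e. e \<notin> tree_edges \<longrightarrow> f e = 0) \<and>
     (\<forall>e \<in> tree_edges. f (prod.swap e) = - f e) \<and>
     (\<forall>g \<in> Gamma0 n. \<forall>e \<in> tree_edges. f (act_edge g e) = f e) \<and>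
     (\<forall>v \<in> tree_vertices. divg f v = 0)"

lemma H0_hinv: "f \<in> H0 n \<longleftrightarrow> hinv n f \<and> finite (Gamma0_orbit n ` {e \<in> tree_edges. f e \<noteq> 0})"
  unfolding H0_iff flow_def hinv_def by auto

lemma hinv_act: "hinv n f \<Longrightarrow> g \<in> Gamma0 n \<Longrightarrow> e \<in> tree_edges \<Longrightarrow> f (act_edge g e) = f e"
  unfolding hinv_def by blast

lemma hinv_swap: "hinv n f \<Longrightarrow> f (w, v) = - f (v, w)"
proof -
  assume f: "hinv n f"
  show ?thesis
  proof (cases "(v, w) \<in> tree_edges")
    case True
    then have "f (prod.swap (v, w)) = - f (v, w)" using f unfolding hinv_def by blast
    then show ?thesis by simp
  next
    case False
    then have "(w, v) \<notin> tree_edges" using tree_edge_sym by blast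
    with False f show ?thesis unfolding hinv_def by simp
  qed
qed

lemma finite_range_H0:
  assumes "f \<in> H0 n"
  shows "finite (range f)"
proof -
  have f: "hinv n f" and fin: "finite (Gamma0_orbit n ` {e \<in> tree_edges. f e \<noteq> 0})"
    using assms by (auto simp add: H0_hinv)
  define S where "S = {e \<in> tree_edges. f e \<noteq> 0}"
  have eq: "f e = f (SOME e'. e' \<in> Gamma0_orbit n e)" if "e \<in> S" for e
  proof -
    have "(SOME e'. e' \<in> Gamma0_orbit n e) \<in> Gamma0_orbit n e" by (rule someI) (rule Gamma0_orbit_self)
    then obtain g where "g \<in> Gamma0 n" "(SOME e'. e' \<in> Gamma0_orbit n e) = act_edge g e"
      unfolding mem_Gamma0_orbit by blast
    then show ?thesis using hinv_act[OF f] that by (simp add: S_def)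
  qed
  have "range f \<subseteq> insert 0 ((\<lambda>O'. f (SOME e'. e' \<in> O')) ` Gamma0_orbit n ` S)"
  proof
    fix y assume "y \<in> range f"
    then obtain e where e: "y = f e" by blast
    show "y \<in> insert 0 ((\<lambda>O'. f (SOME e'. e' \<in> O')) ` Gamma0_orbit n ` S)"
    proof (cases "e \<in> S")
      case True
      then show ?thesis using eq[OF True] e by blast
    next
      case False
      then have "f e = 0" using f unfolding S_def hinv_def by blast
      then show ?thesis using e by simp
    qed
  qed
  then show ?thesis by (rule finite_subset) (use fin in \<open>simp add: S_def\<close>)
qed

lemma cusp_vanish:
  fixes f :: "'a::{field,finite} cochain" and n :: "'a poly"
  assumes n: "n \<noteq> 0" and f: "hinv n f" and bdd: "\<And>e. \<bar>f e\<bar> \<le> B"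
    and g: "g \<in> Gamma0 1" and c: "int (degree n) \<le> c" and e: "e \<in> tree_edges" "snd e = cvert g c"
  shows "f e = 0"
proof -
  define a where "a = (\<lambda>b. f (cvert g b, cvert g (b + 1)))"
  have rec: "a b = int CARD('a) * a (b - 1)" if "int (degree n) \<le> b" for b
  proof -
    have "0 = divg f (cvert g b)" using f cvert_in_tree[OF g] by (simp add: hinv_def)
    also have "\<dots> = f (cvert g (b + 1), cvert g b) + int CARD('a) * f (cvert g (b - 1), cvert g b)"
      using n g that hinv_act[OF f] by (rule sum_star_cusp(1))
    finally show ?thesis using hinv_swap[OF f, of "cvert g (b + 1)" "cvert g b"] by (simp add: a_def)
  qed
  have pow: "a (b + int j) = int CARD('a) ^ j * a b" if "int (degree n) \<le> b + 1" for b j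
  proof (induction j)
    case (Suc j)
    have "a (b + int (Suc j)) = int CARD('a) * a (b + int j)"
      using rec[of "b + int (Suc j)"] that by (simp add: algebra_simps)
    then show ?case by (simp add: Suc.IH)
  qed simp
  have zero: "a b = 0" if "int (degree n) \<le> b + 1" for b
  proof (rule ccontr)
    assume "a b \<noteq> 0"
    define q where "q = CARD('a)"
    have q2: "2 \<le> q"
    proof -
      have "card {0, 1 :: 'a} \<le> CARD('a)" by (rule card_mono) auto
      then show ?thesis by (simp add: q_def)
    qed
    define j where "j = nat (B + 1)"
    have "int j < int q ^ j"
    proof -
      have "j < 2 ^ j" by simp
      also have "(2 :: nat) ^ j \<le> q ^ j" using q2 by (rule power_mono) simp
      finally show ?thesis by (metis of_nat_less_iff of_nat_power)
    qed
    also have "\<dots> \<le> int q ^ j * \<bar>a b\<bar>" using \<open>a b \<noteq> 0\<close> q2 by simp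
    also have "\<dots> = \<bar>a (b + int j)\<bar>" using pow[OF that, of j] by (simp add: abs_mult q_def)
    also have "\<dots> \<le> B" unfolding a_def by (rule bdd)
    finally show False by (simp add: j_def split: if_splits)
  qed
  have "f e = f (cvert g (c + 1), cvert g c) \<or> f e = f (cvert g (c - 1), cvert g c)"
    using n g c hinv_act[OF f] e by (rule sum_star_cusp(2))
  moreover have "f (cvert g (c + 1), cvert g c) = 0"
    using zero[of c] c hinv_swap[OF f, of "cvert g (c + 1)" "cvert g c"] by (simp add: a_def)
  moreover have "f (cvert g (c - 1), cvert g c) = 0" using zero[of "c - 1"] c by (simp add: a_def)
  ultimately show ?thesis by auto
qed

lemma support_low:
  fixes f :: "'a::{field,finite} cochain" and n :: "'a poly"
  assumes n: "n \<noteq> 0" and f: "hinv n f" and bdd: "\<And>e. \<bar>f e\<bar> \<le> B" and e: "f e \<noteq> 0"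
  shows "e \<in> tree_edges" "fst e \<in> low_vertices n"
proof -
  show E: "e \<in> tree_edges" using f e unfolding hinv_def by blast
  then have "fst e \<in> tree_vertices" by (auto simp add: tree_edges_def)
  then obtain g c where g: "g \<in> Gamma0 1" "0 \<le> c" "fst e = cvert g c" by (rule tree_vertex_cvert)
  have "\<not> int (degree n) \<le> c"
  proof
    assume "int (degree n) \<le> c"
    then have "f (prod.swap e) = 0"
      using E g by (intro cusp_vanish[OF n f bdd g(1)]) auto
    then show False using e hinv_swap[OF f, of "snd e" "fst e"] by (simp add: prod.swap_def)
  qed
  then show "fst e \<in> low_vertices n" 
    using g unfolding low_vertices_def cvert_def mem_Collect_eq linorder_not_le by blast
qed

lemma coprime_poly_dvd_mult:
  fixes a b c :: "'a::field poly"
  assumes "coprime a b" "a dvd b * c"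
  shows "a dvd c"
proof -
  obtain s t where "s * a + t * b = 1" using assms(1) by (rule coprime_poly_bezout)
  then have "c = (s * a + t * b) * c" by simp
  also have "\<dots> = a * (s * c) + t * (b * c)" by (simp add: algebra_simps)
  finally show ?thesis using assms(2) by (metis dvd_add dvd_mult dvd_triv_left)
qed

lemma coprime_poly_dvd:
  fixes a b n :: "'a::field poly"
  shows "coprime a n \<Longrightarrow> b dvd a \<Longrightarrow> coprime b n"
  unfolding coprime_def by (meson dvd_trans)

lemma monic_degree_0: "lead_coeff d = 1 \<Longrightarrow> degree d = 0 \<Longrightarrow> d = 1" for d :: "'a::field poly"
  by (auto elim!: degree_eq_zeroE simp add: one_pCons)

section \<open>Hecke operators\<close>

definition hmat :: "'a::field poly \<times> 'a poly \<times> 'a poly \<Rightarrow> 'a poly ^ 2 ^ 2" where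
  "hmat = (\<lambda>(a, b, d). vector [vector [a, b], vector [0, d]])"

lemma hmat_component [simp]: "hmat (a, b, d) $ 1 $ 1 = a" "hmat (a, b, d) $ 1 $ 2 = b"
  "hmat (a, b, d) $ 2 $ 1 = 0" "hmat (a, b, d) $ 2 $ 2 = d"
  by (simp_all add: hmat_def)

definition hop :: "'a::field poly \<Rightarrow> 'a poly \<Rightarrow> 'a cochain \<Rightarrow> 'a cochain" where
  "hop n m f = (\<lambda>e. \<Sum>x \<in> hecke_index n m. f (act_edge (hmat x) e))"

lemma hecke_eq: "hecke n m = restrict (hop n m) (H0 n)"
  unfolding hecke_def hop_def by (intro restrict_ext ext sum.cong) (auto simp add: slash_def hmat_def)

lemma hecke_index_det: "x \<in> hecke_index n m \<Longrightarrow> det (hmat x) = m"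
  by (auto simp add: hecke_index_def det_2)

definition residues_set :: "'a::zero poly \<Rightarrow> 'a poly set" where
  "residues_set d = {b. b = 0 \<or> degree b < degree d}"

lemma finite_residues_set: "finite (residues_set (d :: 'a::{zero,finite} poly))"
  by (rule finite_subset[OF _ finite_poly_degree_le[of "degree d"]]) (auto simp add: residues_set_def)

lemma mod_in_residues_set: "d \<noteq> 0 \<Longrightarrow> x mod d \<in> residues_set d" for d :: "'a::field poly"
  using degree_mod_less[of d x] by (auto simp add: residues_set_def)

lemma residues_set_unique:
  fixes d :: "'a::field poly"
  assumes "b \<in> residues_set d" "b' \<in> residues_set d" "d dvd b - b'"
  shows "b = b'"
proof (rule ccontr)
  assume "b \<noteq> b'"
  then have "degree d \<le> degree (b - b')" using assms(3) by (intro dvd_imp_degree_le) auto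
  moreover have "degree (b - b') < degree d"
    using assms(1,2) \<open>b \<noteq> b'\<close> by (auto simp add: residues_set_def intro: degree_diff_less)
  ultimately show False by simp
qed

lemma finite_hecke_index:
  fixes n m :: "'a::{field,finite} poly"
  assumes m: "m \<noteq> 0"
  shows "finite (hecke_index n m)"
proof (rule finite_subset)
  let ?S = "{P :: 'a poly. degree P \<le> degree m}"
  show "hecke_index n m \<subseteq> ?S \<times> ?S \<times> ?S"
  proof
    fix x assume x: "x \<in> hecke_index n m"
    obtain a b d where xe: "x = (a, b, d)" by (cases x) auto
    have h: "a * d = m" "b = 0 \<or> degree b < degree d" using x by (auto simp add: xe hecke_index_def)
    then have "degree a + degree d = degree m" using m by (metis degree_mult_eq mult_eq_0_iff)
    then show "x \<in> ?S \<times> ?S \<times> ?S" using h(2) by (auto simp add: xe)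
  qed
  show "finite (?S \<times> ?S \<times> ?S)" by (intro finite_cartesian_product finite_poly_degree_le)
qed

lemma hecke_coset_unique:
  fixes n m :: "'a::field poly"
  assumes x: "x \<in> hecke_index n m" "y \<in> hecke_index n m" and m: "m \<noteq> 0"
    and g: "g \<in> Gamma0 n" "hmat x = g ** hmat y"
  shows "x = y"
proof -
  obtain a b d where xe: "x = (a, b, d)" by (cases x) auto
  obtain a' b' d' where ye: "y = (a', b', d')" by (cases y) auto
  have h: "lead_coeff a = 1" "lead_coeff d = 1" "a * d = m" "b = 0 \<or> degree b < degree d"
    "lead_coeff a' = 1" "lead_coeff d' = 1" "a' * d' = m" "b' = 0 \<or> degree b' < degree d'"
    using x by (auto simp add: xe ye hecke_index_def)
  have nz: "a \<noteq> 0" "d \<noteq> 0" "a' \<noteq> 0" "d' \<noteq> 0" using h m by auto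
  have e: "a = g $ 1 $ 1 * a'" "b = g $ 1 $ 1 * b' + g $ 1 $ 2 * d'" "0 = g $ 2 $ 1 * a'" "d = g $ 2 $ 1 * b' + g $ 2 $ 2 * d'"
    using g(2) by (simp_all add: xe ye mat2_eq_iff mat2_mult_component)
  have g21: "g $ 2 $ 1 = 0" using e(3) nz by simp
  have "is_unit (g $ 1 $ 1 * g $ 2 $ 2)" using Gamma0_det_unit[OF g(1)] by (simp add: det_2 g21)
  then have u: "is_unit (g $ 1 $ 1)" "is_unit (g $ 2 $ 2)" by (simp_all add: is_unit_mult_iff)
  have one: "k = 1" if "is_unit k" "p = k * q" "lead_coeff p = 1" "lead_coeff q = 1" for k p q :: "'a poly"
  proof -
    obtain c where c: "k = [:c:]" using \<open>is_unit k\<close> by (metis is_unit_poly_iff)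
    then have "p = Polynomial.smult c q" using that(2) by simp
    then have "lead_coeff p = c * lead_coeff q" by (simp only: lead_coeff_smult)
    then show ?thesis using that(3,4) c by (simp add: one_pCons)
  qed
  have "g $ 1 $ 1 = 1" using one[OF u(1) e(1)] h by blast
  moreover have "g $ 2 $ 2 = 1" using one[OF u(2)] e(4) g21 h by auto
  ultimately have eq: "a = a'" "d = d'" "b = b' + g $ 1 $ 2 * d" using e g21 by auto
  then have "d dvd b - b'" by simp
  then have "b = b'" using h eq by (intro residues_set_unique[of b d b']) (auto simp add: residues_set_def)
  with eq show ?thesis by (simp add: xe ye)
qed

lemma hecke_coset_exists:
  fixes n m :: "'a::field poly"
  assumes x: "x \<in> hecke_index n m" and m: "lead_coeff m = 1" and g: "g \<in> Gamma0 n"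
  shows "\<exists>y \<in> hecke_index n m. \<exists>h \<in> Gamma0 n. hmat x ** g = h ** hmat y"
proof -
  obtain a b d where xe: "x = (a, b, d)" by (cases x) auto
  have ad: "lead_coeff a = 1" "lead_coeff d = 1" "a * d = m" "coprime a n" using x by (auto simp add: xe hecke_index_def)
  have m0: "m \<noteq> 0" using m by auto
  define X where "X = hmat x ** g"
  have detX: "det X = m * det g" by (simp add: X_def det_mul hecke_index_det[OF x])
  have detX0: "det X \<noteq> 0" using m0 Gamma0_det[OF g] by (simp add: detX)
  have nC: "n dvd X $ 2 $ 1" using g by (simp add: X_def xe mat2_mult_component Gamma0_def)
  have cA: "coprime (X $ 1 $ 1) n"
  proof (rule coprimeI)
    fix k assume k: "k dvd X $ 1 $ 1" "k dvd n"
    have k21: "k dvd g $ 2 $ 1" using k(2) g by (auto simp add: Gamma0_def)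
    then have "k dvd a * g $ 1 $ 1" using k(1) by (simp add: X_def xe mat2_mult_component dvd_add_left_iff)
    then have "k dvd g $ 1 $ 1" 
    proof (rule coprime_poly_dvd_mult[rotated])
      show "coprime k a" using ad(4) k(2) by (metis coprime_commute coprime_poly_dvd)
    qed
    then have "k dvd det g" using k21 by (simp add: det_2)
    then show "is_unit k" using Gamma0_det_unit[OF g] dvd_unit_imp_unit by blast
  qed
  obtain s t where h: "(s * X $ 1 $ 1 + t * X $ 2 $ 1) dvd X $ 1 $ 1" "(s * X $ 1 $ 1 + t * X $ 2 $ 1) dvd X $ 2 $ 1"
    using poly_bezout by blast
  define h where "h = s * X $ 1 $ 1 + t * X $ 2 $ 1"
  obtain A' where A': "X $ 1 $ 1 = h * A'" using h(1) unfolding h_def by (rule dvdE)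
  obtain C' where C': "X $ 2 $ 1 = h * C'" using h(2) unfolding h_def by (rule dvdE)
  have h0: "h \<noteq> 0"
  proof
    assume "h = 0"
    then have "X $ 1 $ 1 = 0" "X $ 2 $ 1 = 0" using A' C' by simp_all
    then have "det X = 0" by (simp add: det_2)
    with detX0 show False ..
  qed
  have hst: "s * (h * A') + t * (h * C') = h" unfolding A'[symmetric] C'[symmetric] by (rule h_def[symmetric])
  have "h * (s * A' + t * C') = s * (h * A') + t * (h * C')" by (simp add: algebra_simps)
  also have "\<dots> = h * 1" using hst by simp
  finally have st: "s * A' + t * C' = 1" using h0 by (metis mult_left_cancel)
  have ch: "coprime h n" using cA A' by (auto intro: coprime_poly_dvd)
  have nC': "n dvd C'" 
  proof (rule coprime_poly_dvd_mult)
    show "coprime n h" using ch by (simp add: coprime_commute)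
    show "n dvd h * C'" using nC C' by simp
  qed
  define W1 :: "'a poly ^ 2 ^ 2" where "W1 = vector [vector [s, t], vector [- C', A']]"
  have "det W1 = 1" using st by (simp add: W1_def det_2)
  then have W1: "W1 \<in> Gamma0 n" by (rule Gamma0_det1) (simp add: W1_def nC')
  define \<delta> where "\<delta> = - C' * X $ 1 $ 2 + A' * X $ 2 $ 2"
  have h\<delta>: "h * \<delta> = m * det g"
  proof -
    have "h * \<delta> = (h * A') * X $ 2 $ 2 - X $ 1 $ 2 * (h * C')" by (simp add: \<delta>_def algebra_simps)
    then show ?thesis using detX unfolding A'[symmetric] C'[symmetric] by (simp add: det_2)
  qed
  have \<delta>0: "\<delta> \<noteq> 0" using h\<delta> m0 Gamma0_det[OF g] by auto
  define u v where "u = lead_coeff h" and "v = lead_coeff \<delta>"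
  have uv: "u \<noteq> 0" "v \<noteq> 0" using h0 \<delta>0 by (simp_all add: u_def v_def)
  define W2 :: "'a poly ^ 2 ^ 2" where "W2 = vector [vector [[:inverse u:], 0], vector [0, [:inverse v:]]]"
  define W2' :: "'a poly ^ 2 ^ 2" where "W2' = vector [vector [[:u:], 0], vector [0, [:v:]]]"
  have "W2 ** W2' = mat 1" "W2' ** W2 = mat 1"
    unfolding mat2_eq_iff mat2_one_component
    using uv by (simp_all add: W2_def W2'_def mat2_mult_component one_pCons)
  then have "invertible W2" unfolding invertible_def by blast
  then have W2: "W2 \<in> Gamma0 n" by (simp add: Gamma0_def W2_def)
  define h1 d1 where "h1 = Polynomial.smult (inverse u) h" and "d1 = Polynomial.smult (inverse v) \<delta>"
  have mon: "lead_coeff h1 = 1" "lead_coeff d1 = 1" using uv by (simp_all add: h1_def d1_def u_def v_def)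
  define b0 where "b0 = Polynomial.smult (inverse u) (s * X $ 1 $ 2 + t * X $ 2 $ 2)"
  define W3 :: "'a poly ^ 2 ^ 2" where "W3 = vector [vector [1, - (b0 div d1)], vector [0, 1]]"
  have "det W3 = 1" by (simp add: W3_def det_2)
  then have W3: "W3 \<in> Gamma0 n" by (rule Gamma0_det1) (simp add: W3_def)
  define y where "y = (h1, b0 mod d1, d1)"
  have prod: "W3 ** (W2 ** (W1 ** X)) = hmat y"
  proof -
    have e1: "(W1 ** X) $ 1 $ 1 = h" "(W1 ** X) $ 2 $ 1 = 0" "(W1 ** X) $ 2 $ 2 = \<delta>"
      "(W1 ** X) $ 1 $ 2 = s * X $ 1 $ 2 + t * X $ 2 $ 2"
    proof -
      have "C' * (h * A') = A' * (h * C')" by simp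
      then have "C' * X $ 1 $ 1 = A' * X $ 2 $ 1" unfolding A'[symmetric] C'[symmetric] .
      then show "(W1 ** X) $ 1 $ 1 = h" "(W1 ** X) $ 2 $ 1 = 0" "(W1 ** X) $ 2 $ 2 = \<delta>"
        "(W1 ** X) $ 1 $ 2 = s * X $ 1 $ 2 + t * X $ 2 $ 2"
        by (simp_all add: W1_def mat2_mult_component h_def \<delta>_def)
    qed
    have e2: "(W2 ** (W1 ** X)) $ 1 $ 1 = h1" "(W2 ** (W1 ** X)) $ 2 $ 1 = 0" "(W2 ** (W1 ** X)) $ 2 $ 2 = d1"
      "(W2 ** (W1 ** X)) $ 1 $ 2 = b0"
      unfolding mat2_mult_component[of W2] e1 by (simp_all add: W2_def h1_def d1_def b0_def)
    have e3: "b0 - b0 div d1 * d1 = b0 mod d1" by (rule minus_div_mult_eq_mod)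
    show ?thesis unfolding mat2_eq_iff mat2_mult_component[of W3] e2
      using e3 by (simp add: W3_def y_def)
  qed
  have W: "W3 ** W2 ** W1 \<in> Gamma0 n" using W1 W2 W3 by (intro Gamma0_mult)
  have yX: "(W3 ** W2 ** W1) ** X = hmat y" using prod by (simp add: matrix_mul_assoc)
  obtain W' where W': "W' \<in> Gamma0 n" "W' ** (W3 ** W2 ** W1) = mat 1" using W by (rule Gamma0_inverse)
  have "W' ** ((W3 ** W2 ** W1) ** X) = X" using W'(2) by (simp only: matrix_mul_assoc matrix_mul_lid)
  then have X: "X = W' ** hmat y" by (simp only: yX)
  have "y \<in> hecke_index n m"
  proof -
    have "coprime h1 n" using ch by (rule coprime_poly_dvd) (simp add: h1_def smult_dvd_iff uv)
    moreover have "h1 * d1 = m"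
    proof -
      obtain c where c: "det g = [:c:]" using Gamma0_det_unit[OF g] by (metis is_unit_poly_iff)
      define w where "w = inverse v * inverse u * c"
      have "h1 * d1 = Polynomial.smult w m"
        unfolding h1_def d1_def w_def using h\<delta> by (simp add: c ac_simps)
      moreover have "lead_coeff (h1 * d1) = 1" using mon by (simp add: lead_coeff_mult)
      ultimately have "w * lead_coeff m = 1" by (simp only: lead_coeff_smult)
      then have "w = 1" using m by simp
      then show ?thesis using \<open>h1 * d1 = Polynomial.smult w m\<close> by simp
    qed
    moreover have "b0 mod d1 = 0 \<or> degree (b0 mod d1) < degree d1"
      by (rule degree_mod_less) (use mon in auto)
    ultimately show ?thesis using mon by (simp add: y_def hecke_index_def)
  qed
  with X W'(1) show ?thesis unfolding X_def by blast
qed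

lemma hop_hinv:
  fixes f :: "'a::{field,finite} cochain"
  assumes f: "hinv n f" and m: "lead_coeff m = 1"
  shows "hinv n (hop n m f)"
proof -
  have m0: "m \<noteq> 0" using m by auto
  have det: "det (hmat x) \<noteq> 0" if "x \<in> hecke_index n m" for x using hecke_index_det[OF that] m0 by simp
  have "hop n m f e = 0" if "e \<notin> tree_edges" for e
    unfolding hop_def
  proof (rule sum.neutral, rule ballI)
    fix x assume "x \<in> hecke_index n m"
    then have "act_edge (hmat x) e \<notin> tree_edges" using act_edge_in_tree_iff det that by blast
    then show "f (act_edge (hmat x) e) = 0" using f unfolding hinv_def by blast
  qed
  moreover have "hop n m f (prod.swap e) = - hop n m f e" for e
    unfolding hop_def act_edge_swap using hinv_swap[OF f] by (simp add: sum_negf[symmetric] prod.swap_def)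
  moreover have "hop n m f (act_edge g e) = hop n m f e" if g: "g \<in> Gamma0 n" and e: "e \<in> tree_edges" for g e
  proof -
    have "\<forall>x \<in> hecke_index n m. \<exists>y. y \<in> hecke_index n m \<and> (\<exists>h \<in> Gamma0 n. hmat x ** g = h ** hmat y)"
      using hecke_coset_exists[OF _ m g] by blast
    then obtain \<pi> where \<pi>: "\<And>x. x \<in> hecke_index n m \<Longrightarrow> \<pi> x \<in> hecke_index n m"
      "\<And>x. x \<in> hecke_index n m \<Longrightarrow> \<exists>h \<in> Gamma0 n. hmat x ** g = h ** hmat (\<pi> x)" by metis
    have "inj_on \<pi> (hecke_index n m)"
    proof (rule inj_onI)
      fix x y assume xy: "x \<in> hecke_index n m" "y \<in> hecke_index n m" "\<pi> x = \<pi> y"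
      obtain h where h: "h \<in> Gamma0 n" "hmat x ** g = h ** hmat (\<pi> x)" using \<pi>(2)[OF xy(1)] by blast
      obtain k where k: "k \<in> Gamma0 n" "hmat y ** g = k ** hmat (\<pi> x)" using \<pi>(2)[OF xy(2)] xy(3) by auto
      obtain g' where g': "g ** g' = mat 1" using g by (rule Gamma0_inverse)
      obtain k' where k': "k' \<in> Gamma0 n" "k' ** k = mat 1" using k(1) by (rule Gamma0_inverse)
      have "k' ** (hmat y ** g) = hmat (\<pi> x)" unfolding k(2) by (simp only: matrix_mul_assoc k'(2) matrix_mul_lid)
      then have "hmat x ** g = h ** (k' ** (hmat y ** g))" using h(2) by simp
      then have "(hmat x ** g) ** g' = (h ** (k' ** (hmat y ** g))) ** g'" by simp
      then have "hmat x ** (g ** g') = (h ** k') ** (hmat y ** (g ** g'))" by (simp only: matrix_mul_assoc)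
      then have "hmat x = (h ** k') ** hmat y" by (simp add: g')
      then show "x = y" using xy(1,2) m0 Gamma0_mult[OF h(1) k'(1)] by (intro hecke_coset_unique)
    qed
    then have bij: "bij_betw \<pi> (hecke_index n m) (hecke_index n m)"
      using \<pi>(1) finite_hecke_index[OF m0] endo_inj_surj unfolding bij_betw_def by blast
    have "f (act_edge (hmat x) (act_edge g e)) = f (act_edge (hmat (\<pi> x)) e)" if x: "x \<in> hecke_index n m" for x
    proof -
      obtain h where h: "h \<in> Gamma0 n" "hmat x ** g = h ** hmat (\<pi> x)" using \<pi>(2)[OF x] by blast
      have "act_edge (hmat x) (act_edge g e) = act_edge h (act_edge (hmat (\<pi> x)) e)"
        using h(2) by (simp flip: act_edge_mult)
      moreover have "act_edge (hmat (\<pi> x)) e \<in> tree_edges" using e det[OF \<pi>(1)[OF x]] by (rule act_edge_in_tree[rotated])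
      ultimately show ?thesis using hinv_act[OF f h(1)] by simp
    qed
    then have "hop n m f (act_edge g e) = (\<Sum>x \<in> hecke_index n m. f (act_edge (hmat (\<pi> x)) e))"
      unfolding hop_def by (intro sum.cong) auto
    also have "\<dots> = hop n m f e" unfolding hop_def by (rule sum.reindex_bij_betw[OF bij])
    finally show ?thesis .
  qed
  moreover have "divg (hop n m f) v = 0" if v: "v \<in> tree_vertices" for v
  proof -
    have "divg (hop n m f) v = (\<Sum>x \<in> hecke_index n m. \<Sum>e | e \<in> tree_edges \<and> snd e = v. f (act_edge (hmat x) e))"
      unfolding divg_def hop_def by (rule sum.swap)
    also have "\<dots> = (\<Sum>x \<in> hecke_index n m. divg f (act_vertex (hmat x) v))"
    proof (rule sum.cong[OF refl])
      fix x assume "x \<in> hecke_index n m"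
      then show "(\<Sum>e | e \<in> tree_edges \<and> snd e = v. f (act_edge (hmat x) e)) = divg f (act_vertex (hmat x) v)"
        unfolding divg_def by (intro sum.reindex_bij_betw bij_betw_star det v)
    qed
    also have "\<dots> = 0"
      using f act_vertex_in_tree[OF det v] by (intro sum.neutral) (auto simp add: hinv_def)
    finally show ?thesis .
  qed
  ultimately show ?thesis unfolding hinv_def by blast
qed

lemma bounded_H0:
  fixes f :: "'a::{field,finite} cochain"
  assumes n: "n \<noteq> 0" and f: "hinv n f" and bdd: "\<And>e. \<bar>f e\<bar> \<le> B"
  shows "f \<in> H0 n"
proof -
  have "{e \<in> tree_edges. f e \<noteq> 0} \<subseteq> {e \<in> tree_edges. fst e \<in> low_vertices n}"
    using support_low[OF n f bdd] by blast
  then have "finite (Gamma0_orbit n ` {e \<in> tree_edges. f e \<noteq> 0})"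
    using finite_subset[OF image_mono low_edges_finite(1)[OF n]] by blast
  with f show ?thesis by (simp add: H0_hinv)
qed

lemma H0_bounded:
  assumes "f \<in> H0 n"
  obtains B where "\<And>e. \<bar>f e\<bar> \<le> B"
proof -
  have fin: "finite (range f)" using assms by (rule finite_range_H0)
  have "\<bar>f e\<bar> \<le> Max ((\<lambda>x. \<bar>x\<bar>) ` range f)" for e by (rule Max_ge) (use fin in auto)
  then show ?thesis by (rule that)
qed

lemma hop_H0:
  fixes f :: "'a::{field,finite} cochain"
  assumes n: "n \<noteq> 0" and f: "f \<in> H0 n" and m: "lead_coeff m = 1"
  shows "hop n m f \<in> H0 n"
proof -
  obtain B where B: "\<And>e. \<bar>f e\<bar> \<le> B" using f by (rule H0_bounded) blast
  have "\<bar>hop n m f e\<bar> \<le> int (card (hecke_index n m)) * B" for e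
  proof -
    have "\<bar>hop n m f e\<bar> \<le> (\<Sum>x \<in> hecke_index n m. \<bar>f (act_edge (hmat x) e)\<bar>)" unfolding hop_def by (rule sum_abs)
    also have "\<dots> \<le> (\<Sum>x \<in> hecke_index n m. B)" by (intro sum_mono B)
    finally show ?thesis by simp
  qed
  moreover have "hinv n (hop n m f)" using f m by (intro hop_hinv) (simp_all add: H0_hinv)
  ultimately show ?thesis using n by (intro bounded_H0)
qed

section \<open>The Eisenstein operators are injective\<close>

lemma ideal_norm_eq:
  fixes l :: "'a::{field,finite} poly"
  assumes "l \<noteq> 0"
  shows "ideal_norm l = card (residues_set l)"
proof -
  let ?r = "{(x, y). l dvd x - y}"
  have "bij_betw (\<lambda>b. ?r `` {b}) (residues_set l) (UNIV // ?r)"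
    unfolding bij_betw_def
  proof (intro conjI)
    show "inj_on (\<lambda>b. ?r `` {b}) (residues_set l)"
    proof (rule inj_onI)
      fix b b' assume b: "b \<in> residues_set l" "b' \<in> residues_set l" "?r `` {b} = ?r `` {b'}"
      then have "b' \<in> ?r `` {b}" by auto
      then show "b = b'" using b by (intro residues_set_unique) auto
    qed
    show "(\<lambda>b. ?r `` {b}) ` residues_set l = UNIV // ?r"
    proof
      show "UNIV // ?r \<subseteq> (\<lambda>b. ?r `` {b}) ` residues_set l"
      proof
        fix X assume "X \<in> UNIV // ?r"
        then obtain x where X: "X = ?r `` {x}" by (auto simp add: quotient_def)
        have "l dvd x mod l - x" by (metis dvd_minus_mod dvd_minus_iff minus_diff_eq)
        then have "l dvd x - y \<longleftrightarrow> l dvd x mod l - y" for y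
          by (metis (no_types, opaque_lifting) diff_add_cancel dvd_add_right_iff add_diff_eq)
        then have "X = ?r `` {x mod l}" unfolding X by auto
        then show "X \<in> (\<lambda>b. ?r `` {b}) ` residues_set l" using mod_in_residues_set[OF assms] by blast
      qed
    qed (auto simp add: quotient_def)
  qed
  then show ?thesis unfolding ideal_norm_def by (metis bij_betw_same_card)
qed

lemma hecke_index_prime:
  fixes l n :: "'a::{field,finite} poly"
  assumes l: "lead_coeff l = 1" "prime_elem l" "\<not> l dvd n"
  shows "hecke_index n l = insert (l, 0, 1) ((\<lambda>b. (1, b, l)) ` residues_set l)"
proof (rule Set.set_eqI)
  fix x :: "'a poly \<times> 'a poly \<times> 'a poly"
  obtain a b d where x: "x = (a, b, d)" by (cases x) auto
  have l0: "l \<noteq> 0" "degree l \<noteq> 0" using l(2) unfolding prime_elem_def by (auto simp add: is_unit_iff_degree)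
  have cl: "coprime l n"
  proof (rule coprimeI)
    fix c assume c: "c dvd l" "c dvd n"
    then obtain k where k: "l = c * k" by (auto elim: dvdE)
    then have "l dvd c \<or> l dvd k" using l(2) by (metis dvd_refl prime_elem_dvd_multD)
    then show "is_unit c"
    proof
      assume "l dvd c"
      then show ?thesis using c l(3) dvd_trans by blast
    next
      assume "l dvd k"
      then obtain j where "k = l * j" by (rule dvdE)
      then have "l * (c * j) = l * 1" using k by (simp add: mult.left_commute)
      then have "c * j = 1" using l0 by (metis mult_left_cancel)
      then show ?thesis by (metis dvdI)
    qed
  qed
  show "x \<in> hecke_index n l \<longleftrightarrow> x \<in> insert (l, 0, 1) ((\<lambda>b. (1, b, l)) ` residues_set l)"
  proof
    assume "x \<in> hecke_index n l"
    then have h: "lead_coeff a = 1" "lead_coeff d = 1" "a * d = l" "b = 0 \<or> degree b < degree d"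
      by (auto simp add: x hecke_index_def)
    have nz: "a \<noteq> 0" "d \<noteq> 0" using h by auto
    have "l dvd a \<or> l dvd d" using h(3) l(2) by (metis dvd_refl prime_elem_dvd_multD)
    then consider "degree d = 0" | "degree a = 0"
    proof (elim disjE)
      assume "l dvd a"
      then have "degree l \<le> degree a" using nz by (intro dvd_imp_degree_le)
      moreover have "degree l = degree a + degree d" using h(3) nz degree_mult_eq by blast
      ultimately show ?thesis using that by simp
    next
      assume "l dvd d"
      then have "degree l \<le> degree d" using nz by (intro dvd_imp_degree_le)
      moreover have "degree l = degree a + degree d" using h(3) nz degree_mult_eq by blast
      ultimately show ?thesis using that by simp
    qed
    then show "x \<in> insert (l, 0, 1) ((\<lambda>b. (1, b, l)) ` residues_set l)"
    proof cases
      case 1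
      then have "d = 1" using h(2) monic_degree_0 by blast
      then show ?thesis using h by (auto simp add: x)
    next
      case 2
      then have "a = 1" using h(1) monic_degree_0 by blast
      then show ?thesis using h by (auto simp add: x residues_set_def)
    qed
  qed (use l cl in \<open>auto simp add: hecke_index_def residues_set_def\<close>)
qed

lemma card_hecke_index_prime:
  fixes l n :: "'a::{field,finite} poly"
  assumes l: "lead_coeff l = 1" "prime_elem l" "\<not> l dvd n"
  shows "card (hecke_index n l) = ideal_norm l + 1"
proof -
  have "l \<noteq> 0" "\<not> is_unit l" using l(2) by (auto simp add: prime_elem_def)
  then have "(l, 0, 1) \<notin> (\<lambda>b. (1, b, l)) ` residues_set l" by auto
  moreover have "card ((\<lambda>b. (1 :: 'a poly, b, l)) ` residues_set l) = card (residues_set l)"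
    by (rule card_image) (simp add: inj_on_def)
  ultimately show ?thesis
    unfolding hecke_index_prime[OF l] ideal_norm_eq[OF \<open>l \<noteq> 0\<close>] by (simp add: finite_residues_set)
qed

lemma hecke_ray:
  fixes v :: "'a::{field,finite} tree_vertex" and l :: "'a poly"
  assumes v: "v \<in> tree_vertices" and l: "degree l \<noteq> 0"
  shows "\<exists>j. \<exists>h \<in> Gamma0 1. \<exists>c. K \<le> c \<and> (act_vertex (hmat (l, 0, 1)) ^^ j) v = cvert h c"
proof -
  obtain L where L: "is_lattice L" "v = homothety_class L" using v by (rule tree_vertexE)
  have l0: "l \<noteq> 0" using l by auto
  define e1 :: "'a fls ^ 2" where "e1 = vector [1, 0]"
  have "e1 \<noteq> 0" by (simp add: e1_def vec2_eq_iff)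
  then obtain i where i: "e1 \<in> sc i L" "e1 \<notin> sc (i + 1) L" using L(1) ex_sc_exact by blast
  have "is_lattice (sc i L)" using L by auto
  then obtain y where y: "dt e1 y \<noteq> 0" "sc i L = lat e1 y"
    using i lattice_basis[of "sc i L" e1] by (auto simp add: sc_sc add.commute)
  have v': "v = homothety_class (lat e1 y)" using L y(2) by (metis homothety_class_sc)
  have y2: "y $ 2 \<noteq> 0" using y(1) by (simp add: dt_def e1_def)
  have step: "(act_vertex (hmat (l, 0, 1)) ^^ j) v = homothety_class (lat e1 (vector [y $ 1, y $ 2 / embed_poly l ^ j]))" for j
  proof (induction j)
    case 0
    have "vector [y $ 1, y $ 2] = y" by (simp add: vec2_eq_iff)
    then show ?case by (simp add: v')
  next
    case (Suc j)
    let ?y = "vector [y $ 1, y $ 2 / embed_poly l ^ j] :: 'a fls ^ 2"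
    let ?y' = "vector [y $ 1, y $ 2 / embed_poly l ^ Suc j] :: 'a fls ^ 2"
    have "dt e1 ?y' \<noteq> 0" using y2 l0 by (simp add: dt_def e1_def)
    then have lat: "is_lattice (lat e1 ?y')" by auto
    have "mact (hmat (l, 0, 1)) (lat e1 ?y) = scale_lattice (embed_poly l) (lat e1 ?y')"
    proof -
      have "map_matrix embed_poly (hmat (l, 0, 1)) *v e1 = embed_poly l *s e1"
        "map_matrix embed_poly (hmat (l, 0, 1)) *v ?y = embed_poly l *s ?y'"
        using l0 by (simp_all add: vec2_eq_iff mat2_vec_component map_matrix_def e1_def)
      then show ?thesis by (simp only: mact_lat scale_lat)
    qed
    then show ?case using lat l0 by (simp add: Suc.IH act_homothety_class scale_unit homothety_class_sc)
  qed
  define j where "j = nat (\<bar>K\<bar> + \<bar>fls_subdegree (y $ 2)\<bar>)"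
  define z :: "'a fls ^ 2" where "z = vector [y $ 1, y $ 2 / embed_poly l ^ j]"
  have z2: "z $ 2 \<noteq> 0" using y2 l0 by (simp add: z_def)
  have "fls_subdegree (z $ 2) = fls_subdegree (y $ 2) + int j * int (degree l)"
    using y2 l0 by (simp add: z_def fls_divide_subdegree fls_subdegree_pow embed_poly_subdegree)
  moreover have "int j * 1 \<le> int j * int (degree l)" using l by (intro mult_left_mono) auto
  moreover have "int j = \<bar>K\<bar> + \<bar>fls_subdegree (y $ 2)\<bar>" by (simp add: j_def)
  ultimately have deg: "\<bar>K\<bar> \<le> fls_subdegree (z $ 2)" by linarith
  obtain h where h: "h \<in> Gamma0 1" "lat (vector [1, 0]) z = mact h (Vc (fls_subdegree (z $ 2)))"
    using lat_e1[OF z2] deg by force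
  have "(act_vertex (hmat (l, 0, 1)) ^^ j) v = cvert h (fls_subdegree (z $ 2))"
    unfolding step cvert_def act_homothety_class h(2)[symmetric] by (simp add: e1_def z_def)
  with h(1) deg show ?thesis by (intro exI[of _ j] bexI[of _ h] exI[of _ "fls_subdegree (z $ 2)"]) auto
qed

text \<open>Maximum principle: the set where a cuspidal eigenfunction is maximal would reach the cusps.\<close>

lemma eisenstein_operator_injective:
  fixes l n :: "'a::{field,finite} poly"
  assumes l: "lead_coeff l = 1" "prime_elem l" "\<not> l dvd n" and n: "n \<noteq> 0" and f: "f \<in> H0 n"
    and eq: "\<And>e. hop n l f e = int (ideal_norm l + 1) * f e"
  shows "f e = 0"
proof (rule ccontr)
  assume fe: "f e \<noteq> 0"
  have l0: "l \<noteq> 0" "degree l \<noteq> 0" using l(2) unfolding prime_elem_def by (auto simp add: is_unit_iff_degree)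
  have hf: "hinv n f" using f by (simp add: H0_hinv)
  obtain B where B: "\<And>e. \<bar>f e\<bar> \<le> B" using f by (rule H0_bounded) blast
  define A where "A = Max (range f)"
  have fin: "finite (range f)" using f by (rule finite_range_H0)
  have le: "f e \<le> A" for e unfolding A_def by (rule Max_ge) (use fin in auto)
  have "A \<in> range f" unfolding A_def by (rule Max_in) (use fin in auto)
  then obtain e0 where e0: "f e0 = A" by auto
  have A: "0 < A"
    using fe le[of e] le[of "prod.swap e"] hinv_swap[OF hf, of "snd e" "fst e"] by (simp add: prod.swap_def)
  have step: "f (act_edge (hmat (l, 0, 1)) e) = A" if e: "f e = A" for e
  proof -
    have fi: "finite (hecke_index n l)" using l0 by (intro finite_hecke_index)
    have "(\<Sum>x \<in> hecke_index n l. A - f (act_edge (hmat x) e)) = int (card (hecke_index n l)) * A - hop n l f e"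
      by (simp add: sum_subtractf hop_def)
    also have "\<dots> = 0" unfolding card_hecke_index_prime[OF l] eq e by simp
    finally have "\<forall>x \<in> hecke_index n l. A - f (act_edge (hmat x) e) = 0"
      using fi le by (subst (asm) sum_nonneg_eq_0_iff) auto
    moreover have "(l, 0, 1) \<in> hecke_index n l" unfolding hecke_index_prime[OF l] by simp
    ultimately show ?thesis by fastforce
  qed
  have it: "f ((act_edge (hmat (l, 0, 1)) ^^ j) e0) = A" for j by (induction j) (simp_all add: e0 step)
  have snd: "snd ((act_edge (hmat (l, 0, 1)) ^^ j) e0) = (act_vertex (hmat (l, 0, 1)) ^^ j) (snd e0)" for j
    by (induction j) (simp_all add: act_edge_def)
  have E: "e \<in> tree_edges" if "f e = A" for e using that A hf unfolding hinv_def by (metis less_irrefl)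
  have "snd e0 \<in> tree_vertices" using E[OF e0] by (auto simp add: tree_edges_def)
  then obtain j h c where h: "h \<in> Gamma0 1" "int (degree n) \<le> c" "(act_vertex (hmat (l, 0, 1)) ^^ j) (snd e0) = cvert h c"
    using hecke_ray[OF _ l0(2)] by blast
  have "f ((act_edge (hmat (l, 0, 1)) ^^ j) e0) = 0"
    using E[OF it] snd h by (intro cusp_vanish[OF n hf B h(1,2)]) auto
  with it A show False by simp
qed

section \<open>Hecke operators on the gradient\<close>

lemma card_translation_stable:
  fixes t :: "'a::{field,finite} \<Rightarrow> 'v::ab_group_add"
  assumes add: "\<And>a b. t (a + b) = t a + t b" and inj: "inj t" and fin: "finite S"
    and stable: "\<And>x c. x \<in> S \<Longrightarrow> x + t c \<in> S"
  shows "CARD('a) dvd card S"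
proof -
  have t0: "t 0 = 0" using add[of 0 0] by simp
  define C where "C = (\<lambda>x. range (\<lambda>c. x + t c)) ` S"
  have U: "\<Union>C = S"
  proof
    show "\<Union>C \<subseteq> S" using stable by (auto simp add: C_def)
    show "S \<subseteq> \<Union>C"
    proof
      fix x assume x: "x \<in> S"
      have "x = x + t 0" by (simp add: t0)
      then have "x \<in> range (\<lambda>c. x + t c)" by blast
      then show "x \<in> \<Union>C" using x unfolding C_def by blast
    qed
  qed
  have "CARD('a) * card C = card (\<Union>C)"
  proof (rule card_partition)
    show "finite C" unfolding C_def using fin by simp
    show "finite (\<Union>C)" unfolding U by (rule fin)
    show "card c = CARD('a)" if "c \<in> C" for c
    proof -
      obtain x where "c = range (\<lambda>c. x + t c)" using \<open>c \<in> C\<close> unfolding C_def by blast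
      moreover have "inj (\<lambda>c. x + t c)" using inj by (simp add: inj_def)
      ultimately show ?thesis by (simp add: card_image)
    qed
    show "c1 \<inter> c2 = {}" if c: "c1 \<in> C" "c2 \<in> C" "c1 \<noteq> c2" for c1 c2
    proof (rule ccontr)
      assume "c1 \<inter> c2 \<noteq> {}"
      then obtain z where z: "z \<in> c1" "z \<in> c2" by blast
      have *: "c = range (\<lambda>b. z + t b)" if "c \<in> C" "z \<in> c" for c
      proof -
        obtain x where x: "c = range (\<lambda>b. x + t b)" using \<open>c \<in> C\<close> unfolding C_def by blast
        then obtain a where a: "z = x + t a" using \<open>z \<in> c\<close> by blast
        have "x + t b = z + t (b - a)" "z + t b = x + t (a + b)" for b
          using add[of a "b - a"] by (simp_all add: a add algebra_simps)
        then show ?thesis unfolding x by blast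
      qed
      show False using *[OF c(1) z(1)] *[OF c(2) z(2)] c(3) by simp
    qed
  qed
  then show ?thesis unfolding U by (metis dvd_triv_left)
qed

lemma card_Lam_sc:
  fixes L :: "('a::{field,finite} fls ^ 2) set"
  assumes L: "is_lattice L"
  shows "int CARD('a) dvd int (card (Lam d \<inter> sc i L)) - (if i \<le> Mx d L then 0 else 1)"
proof (cases "i \<le> Mx d L")
  case True
  then obtain w where w: "w \<in> Lam d" "w \<noteq> 0" "w \<in> sc i L" using le_Mx_iff[OF L] by blast
  have "CARD('a) dvd card (Lam d \<inter> sc i L)"
  proof (rule card_translation_stable[of "\<lambda>c. fls_const c *s w"])
    show "fls_const (a + b) *s w = fls_const a *s w + fls_const b *s w" for a b
      by (simp add: vector_sadd_rdistrib flip: fls_plus_const)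
    show "inj (\<lambda>c. fls_const c *s w)"
    proof (rule injI)
      fix a b assume "fls_const a *s w = fls_const b *s w"
      then have "fls_const (a - b) * w $ 1 = 0" "fls_const (a - b) * w $ 2 = 0"
        by (simp_all add: vec2_eq_iff left_diff_distrib flip: fls_minus_const)
      then show "a = b" using w(2) by (auto simp add: vec2_eq_iff)
    qed
    show "finite (Lam d \<inter> sc i L)" using L by (intro finite_Lam_lattice is_lattice_sc)
    fix x c assume x: "x \<in> Lam d \<inter> sc i L"
    have "fls_const c *s w \<in> sc i L" using is_lattice_sc[OF L] w(3) by - (rule lattice_scale, auto)
    then show "x + fls_const c *s w \<in> Lam d \<inter> sc i L"
      using x w Lam_add Lam_scale_const lattice_add[OF is_lattice_sc[OF L]] by blast
  qed
  then show ?thesis using True by (simp only: if_True diff_zero of_nat_dvd_iff)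
next
  case False
  have "0 \<in> sc i L" using L by (intro lattice_0 is_lattice_sc)
  then have "Lam d \<inter> sc i L = {0}" using False le_Mx_iff[OF L, of i d] by auto
  then show ?thesis using False by simp
qed

definition Phi :: "'a::field poly \<Rightarrow> 'a poly \<Rightarrow> ('a fls ^ 2) set" where
  "Phi D E = Lam D - Lam E"

lemma card_Phi_sc:
  fixes L :: "('a::{field,finite} fls ^ 2) set"
  assumes L: "is_lattice L" and DE: "D dvd E"
  shows "Mx E L \<le> Mx D L"
    and "int CARD('a) dvd int (card (Phi D E \<inter> sc i L)) + (if i \<in> {Mx E L<..Mx D L} then 1 else 0)"
proof -
  have sub: "Lam E \<subseteq> Lam D" using DE by (rule Lam_mono)
  show le: "Mx E L \<le> Mx D L"
    using le_Mx_iff[OF L, of "Mx E L" E] sub by (subst le_Mx_iff[OF L]) blast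
  have fin: "finite (Lam D \<inter> sc i L)" "finite (Lam E \<inter> sc i L)" using L by (auto intro: finite_Lam_lattice)
  have "Phi D E \<inter> sc i L = (Lam D \<inter> sc i L) - (Lam E \<inter> sc i L)" by (auto simp add: Phi_def)
  moreover have "Lam E \<inter> sc i L \<subseteq> Lam D \<inter> sc i L" using sub by blast
  ultimately have c: "int (card (Phi D E \<inter> sc i L)) = int (card (Lam D \<inter> sc i L)) - int (card (Lam E \<inter> sc i L))"
    using fin by (simp add: card_Diff_subset card_mono of_nat_diff)
  have "int (card (Phi D E \<inter> sc i L)) + (if i \<in> {Mx E L<..Mx D L} then 1 else 0) =
      (int (card (Lam D \<inter> sc i L)) - (if i \<le> Mx D L then 0 else 1)) -
      (int (card (Lam E \<inter> sc i L)) - (if i \<le> Mx E L then 0 else 1))"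
    unfolding c using le by auto
  then show "int CARD('a) dvd int (card (Phi D E \<inter> sc i L)) + (if i \<in> {Mx E L<..Mx D L} then 1 else 0)"
    using card_Lam_sc[OF L, of D i] card_Lam_sc[OF L, of E i] by (metis dvd_diff)
qed

lemma sum_card_Phi:
  fixes L :: "('a::{field,finite} fls ^ 2) set"
  assumes L: "is_lattice L" and DE: "D dvd E" and I: "finite I" "{Mx E L<..Mx D L} \<subseteq> I"
  shows "int CARD('a) dvd (\<Sum>i\<in>I. int (card (Phi D E \<inter> sc i L))) + (Mx D L - Mx E L)"
proof -
  have "int CARD('a) dvd (\<Sum>i\<in>I. int (card (Phi D E \<inter> sc i L)) + (if i \<in> {Mx E L<..Mx D L} then 1 else 0))"
    using card_Phi_sc(2)[OF L DE] by (intro dvd_sum)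
  also have "(\<Sum>i\<in>I. int (card (Phi D E \<inter> sc i L)) + (if i \<in> {Mx E L<..Mx D L} then 1 else 0)) =
      (\<Sum>i\<in>I. int (card (Phi D E \<inter> sc i L))) + (\<Sum>i\<in>I. if i \<in> {Mx E L<..Mx D L} then 1 else 0)"
    by (rule sum.distrib)
  also have "(\<Sum>i\<in>I. if i \<in> {Mx E L<..Mx D L} then 1 else 0 :: int) = (\<Sum>i \<in> I \<inter> {Mx E L<..Mx D L}. 1)"
    using I(1) by (rule sum.inter_restrict[symmetric])
  also have "I \<inter> {Mx E L<..Mx D L} = {Mx E L<..Mx D L}" using I(2) by blast
  also have "(\<Sum>i \<in> {Mx E L<..Mx D L}. 1 :: int) = Mx D L - Mx E L"
    using card_Phi_sc(1)[OF L DE] by simp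
  finally show ?thesis .
qed

lemma card_residues_dvd:
  fixes d x w :: "'a::{field,finite} poly"
  assumes d: "d \<noteq> 0"
  shows "int CARD('a) dvd int (card {b \<in> residues_set d. d dvd x + b * w}) - (if coprime d w then 1 else 0)"
proof (cases "coprime d w")
  case True
  obtain s t where st: "s * d + t * w = 1" using True by (rule coprime_poly_bezout)
  define b0 where "b0 = (- x * t) mod d"
  have b0: "b0 \<in> residues_set d" unfolding b0_def using d by (rule mod_in_residues_set)
  have "d dvd x + b0 * w"
  proof -
    obtain k where k: "- x * t - b0 = d * k" unfolding b0_def by (metis dvd_minus_mod dvdE)
    have "b0 = - x * t - d * k" using k by (simp add: algebra_simps)
    then have "x + b0 * w = x + (- x * t - d * k) * w" by simp
    also have "\<dots> = x * (1 - t * w) - d * (k * w)" by (simp add: algebra_simps)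
    also have "1 - t * w = s * d" using st by (simp add: algebra_simps)
    also have "x * (s * d) - d * (k * w) = d * (x * s - k * w)" by (simp add: algebra_simps)
    finally show ?thesis by simp
  qed
  moreover have "b = b0" if b: "b \<in> residues_set d" "d dvd x + b * w" for b
  proof (rule residues_set_unique[OF b(1) b0])
    have "d dvd (x + b * w) - (x + b0 * w)" using b(2) \<open>d dvd x + b0 * w\<close> by (rule dvd_diff)
    also have "(x + b * w) - (x + b0 * w) = w * (b - b0)" by (simp add: algebra_simps)
    finally show "d dvd b - b0" using True by (rule coprime_poly_dvd_mult[rotated])
  qed
  ultimately have "{b \<in> residues_set d. d dvd x + b * w} = {b0}" using b0 by blast
  then show ?thesis using True by simp
next
  case False
  then obtain g where g: "g dvd d" "g dvd w" "\<not> is_unit g" by (auto simp add: coprime_def)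
  obtain d' where d': "d = g * d'" using g(1) by (rule dvdE)
  obtain w' where w': "w = g * w'" using g(2) by (rule dvdE)
  have nz: "g \<noteq> 0" "d' \<noteq> 0" using d d' by auto
  have "degree g \<noteq> 0" using g(3) nz by (simp add: is_unit_iff_degree)
  then have deg: "degree d' < degree d" using nz by (simp add: d' degree_mult_eq)
  have "CARD('a) dvd card {b \<in> residues_set d. d dvd x + b * w}"
  proof (rule card_translation_stable[of "\<lambda>c. Polynomial.smult c d'"])
    show "Polynomial.smult (a + b) d' = Polynomial.smult a d' + Polynomial.smult b d'" for a b by (rule smult_add_left)
    show "inj (\<lambda>c. Polynomial.smult c d')"
    proof (rule injI)
      fix a b assume "Polynomial.smult a d' = Polynomial.smult b d'"
      then have "Polynomial.smult (a - b) d' = 0" by (simp add: smult_diff_left)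
      then show "a = b" using nz by simp
    qed
    show "finite {b \<in> residues_set d. d dvd x + b * w}" using finite_residues_set[of d] by simp
    fix b c assume b: "b \<in> {b \<in> residues_set d. d dvd x + b * w}"
    have "Polynomial.smult c d' \<in> residues_set d"
      using deg degree_smult_le[of c d'] by (auto simp add: residues_set_def)
    then have "b + Polynomial.smult c d' \<in> residues_set d"
      using b deg by (auto simp add: residues_set_def intro: degree_add_less)
    moreover have "x + (b + Polynomial.smult c d') * w = (x + b * w) + d * Polynomial.smult c w'"
      by (simp add: d' w' algebra_simps)
    moreover have "d dvd (x + b * w) + d * Polynomial.smult c w'"
      by (rule dvd_add[OF _ dvd_triv_left]) (use b in simp)
    ultimately show "b + Polynomial.smult c d' \<in> {b \<in> residues_set d. d dvd x + b * w}"
      by (simp only: mem_Collect_eq simp_thms)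
  qed
  then show ?thesis using False by (simp only: if_False diff_zero of_nat_dvd_iff)
qed

text \<open>
  For every \<open>(x, y)\<close> with \<open>y \<noteq> 0\<close> there is exactly one pair \<open>(a, d)\<close> for which the number of admissible
  \<open>b\<close> is not divisible by \<open>q\<close>, namely the one where \<open>a\<close> is the greatest common divisor of \<open>m\<close> and \<open>y\<close>.
\<close>

lemma hecke_multiplicity:
  fixes m n x y D r P :: "'a::{field,finite} poly"
  assumes m: "lead_coeff m = 1" and r: "prime_elem r" and n: "n = P * (D * r)" and P: "P dvd D"
  shows "int CARD('a) dvd int (card {z \<in> hecke_index n m. case z of (a, b, d) \<Rightarrow>
      \<exists>w1 w2. a * x + b * y = m * w1 \<and> d * y = m * w2 \<and> D dvd w2 \<and> \<not> D * r dvd w2})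
    - (if coprime m D then 1 else 0) * (if D dvd y \<and> \<not> D * r dvd y then 1 else 0)"
    (is "_ dvd int (card ?Z) - _")
proof -
  have m0: "m \<noteq> 0" using m by auto
  define Prs where "Prs = {(a, d). lead_coeff a = 1 \<and> lead_coeff d = 1 \<and> a * d = m \<and> coprime a n \<and> a dvd y}"
  have Zmem: "(a, b, d) \<in> ?Z \<longleftrightarrow> (a, d) \<in> Prs \<and> b \<in> residues_set d \<and> d dvd x + b * (y div a) \<and> D dvd y \<and> \<not> D * r dvd y"
    for a b d
  proof -
    have aux: "(\<exists>w1 w2. a * x + b * y = m * w1 \<and> d * y = m * w2 \<and> D dvd w2 \<and> \<not> D * r dvd w2) \<longleftrightarrow>
        a dvd y \<and> d dvd x + b * (y div a) \<and> D dvd y \<and> \<not> D * r dvd y"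
      if h: "a * d = m" "coprime a n"
    proof -
      have nz: "a \<noteq> 0" "d \<noteq> 0" using h m0 by auto
      have cD: "k dvd n \<Longrightarrow> k dvd w2 \<longleftrightarrow> k dvd a * w2" for k w2
      proof
        assume k: "k dvd n" "k dvd a * w2"
        have "coprime k a" using h(2) k(1) by (metis coprime_commute coprime_poly_dvd)
        then show "k dvd w2" using k(2) by (rule coprime_poly_dvd_mult)
      qed simp
      have Dn: "D dvd n" "D * r dvd n" unfolding n by (simp_all add: dvd_mult)
      show ?thesis
      proof
        assume "\<exists>w1 w2. a * x + b * y = m * w1 \<and> d * y = m * w2 \<and> D dvd w2 \<and> \<not> D * r dvd w2"
        then obtain w1 w2 where w: "a * x + b * y = m * w1" "d * y = m * w2" "D dvd w2" "\<not> D * r dvd w2" by blast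
        have "d * y = d * (a * w2)" using w(2) h(1) by (simp add: ac_simps)
        then have y: "y = a * w2" using nz by simp
        have "a * (x + b * w2) = a * (d * w1)" using w(1) h(1) y by (simp add: algebra_simps)
        then have "x + b * w2 = d * w1" using nz by simp
        then show "a dvd y \<and> d dvd x + b * (y div a) \<and> D dvd y \<and> \<not> D * r dvd y"
          using w(3,4) y nz cD[OF Dn(1)] cD[OF Dn(2)] by auto
      next
        assume c: "a dvd y \<and> d dvd x + b * (y div a) \<and> D dvd y \<and> \<not> D * r dvd y"
        obtain w2 where w2: "y = a * w2" using c by (auto elim: dvdE)
        then have "d dvd x + b * w2" using c nz by simp
        then obtain w1 where w1: "x + b * w2 = d * w1" by (rule dvdE)
        have "a * x + b * y = a * (x + b * w2)" by (simp add: w2 algebra_simps)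
        then have "a * x + b * y = m * w1" using w1 h(1) by (simp add: mult.assoc)
        moreover have "d * y = m * w2" using h(1) w2 by (simp add: ac_simps)
        moreover have "D dvd w2" "\<not> D * r dvd w2" using c w2 cD[OF Dn(1)] cD[OF Dn(2)] by auto
        ultimately show "\<exists>w1 w2. a * x + b * y = m * w1 \<and> d * y = m * w2 \<and> D dvd w2 \<and> \<not> D * r dvd w2" by blast
      qed
    qed
    then show ?thesis by (auto simp add: hecke_index_def Prs_def residues_set_def)
  qed
  show ?thesis
  proof (cases "D dvd y \<and> \<not> D * r dvd y")
    case False
    have Z: "?Z = {}"
    proof -
      have "z \<notin> ?Z" for z
      proof -
        obtain a b d where "z = (a, b, d)" by (cases z) auto
        then show ?thesis using Zmem[of a b d] False by blast
      qed
      then show ?thesis by blast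
    qed
    show ?thesis
      unfolding Z by (simp only: False if_False card.empty of_nat_0 mult_zero_right diff_zero dvd_0_right)
  next
    case True
    define S where "S = (\<lambda>(a, d). {b \<in> residues_set d. d dvd x + b * (y div a)})"
    have "bij_betw (\<lambda>((a, d), b). (a, b, d)) (Sigma Prs S) ?Z"
      by (rule bij_betw_byWitness[of _ "\<lambda>(a, b, d). ((a, d), b)"]) (use Zmem True in \<open>auto simp add: S_def\<close>)
    then have "card ?Z = card (Sigma Prs S)" by (rule bij_betw_same_card[symmetric])
    also have "\<dots> = (\<Sum>z\<in>Prs. card (S z))"
    proof (rule card_SigmaI)
      have "Prs \<subseteq> {P. degree P \<le> degree m} \<times> {P. degree P \<le> degree m}"
      proof
        fix z assume "z \<in> Prs"
        then obtain a d where z: "z = (a, d)" "a * d = m" by (auto simp add: Prs_def)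
        then have "degree a + degree d = degree m" using m0 by (metis degree_mult_eq mult_eq_0_iff)
        then show "z \<in> {P. degree P \<le> degree m} \<times> {P. degree P \<le> degree m}" by (simp add: z)
      qed
      then show "finite Prs" by (rule finite_subset) (intro finite_cartesian_product finite_poly_degree_le)
      show "\<forall>z\<in>Prs. finite (S z)"
      proof
        fix z assume "z \<in> Prs"
        obtain a d where "z = (a, d)" by (cases z) auto
        then have "S z \<subseteq> residues_set d" by (auto simp add: S_def)
        then show "finite (S z)" using finite_residues_set by (rule finite_subset)
      qed
    qed
    finally have cZ: "int (card ?Z) = (\<Sum>z\<in>Prs. int (card (S z)))" by simp
    obtain s t where h: "(s * m + t * y) dvd m" "(s * m + t * y) dvd y" using poly_bezout by blast
    define h0 where "h0 = s * m + t * y"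
    have h00: "h0 \<noteq> 0" using h(1) m0 unfolding h0_def by auto
    define h1 where "h1 = Polynomial.smult (inverse (lead_coeff h0)) h0"
    have h1: "lead_coeff h1 = 1" "h1 \<noteq> 0" using h00 by (simp_all add: h1_def)
    have h1d: "h1 dvd m" "h1 dvd y" using h h00 unfolding h1_def h0_def[symmetric] by (simp_all add: smult_dvd_iff)
    have common: "k dvd h1" if "k dvd m" "k dvd y" for k
      unfolding h1_def h0_def using that by (simp add: dvd_smult)
    obtain d1 where d1: "m = h1 * d1" using h1d(1) by (rule dvdE)
    obtain y1 where y1: "y = h1 * y1" using h1d(2) by (rule dvdE)
    have d1m: "lead_coeff d1 = 1" using m h1(1) by (simp add: d1 lead_coeff_mult)
    have cop1: "coprime d1 y1"
    proof (rule coprimeI)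
      fix k assume "k dvd d1" "k dvd y1"
      then have "h1 * k dvd h1" by (intro common) (auto simp add: d1 y1)
      then show "is_unit k" using h1(2) by (metis dvd_times_left_cancel_iff mult_1_right)
    qed
    have uniq: "a = h1 \<and> d = d1" if ad: "(a, d) \<in> Prs" and c: "coprime d (y div a)" for a d
    proof -
      have h: "lead_coeff a = 1" "lead_coeff d = 1" "a * d = m" "a dvd y" using ad by (auto simp add: Prs_def)
      have a0: "a \<noteq> 0" using h m0 by auto
      have "a dvd h1" using h by (intro common) auto
      then obtain k where k: "h1 = a * k" by (rule dvdE)
      have "a * d = a * (k * d1)" using h(3) d1 k by (simp add: mult.assoc)
      then have "k dvd d" using a0 by simp
      moreover have "y = a * (k * y1)" using y1 k by (simp add: mult.assoc)
      then have "k dvd y div a" using a0 by simp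
      ultimately have "is_unit k" using c by (simp add: coprime_def)
      moreover have "lead_coeff k = 1" using h1(1) h(1) by (simp add: k lead_coeff_mult)
      ultimately have "k = 1" by (metis is_unit_iff_degree monic_degree_0 not_is_unit_0)
      then have "a = h1" using k by simp
      moreover have "h1 * d = h1 * d1" using h(3) d1 \<open>a = h1\<close> by simp
      then have "d = d1" using h1(2) by simp
      ultimately show ?thesis ..
    qed
    have cop_iff: "coprime h1 n \<longleftrightarrow> coprime m D"
    proof
      assume c: "coprime h1 n"
      show "coprime m D"
      proof (rule coprimeI)
        fix k assume k: "k dvd m" "k dvd D"
        then have "k dvd h1" using True by (intro common) (auto intro: dvd_trans)
        moreover have "k dvd n" using k(2) unfolding n by (simp add: dvd_mult dvd_mult2)
        ultimately show "is_unit k" using c by (simp add: coprime_def)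
      qed
    next
      assume c: "coprime m D"
      have hD: "coprime h1 D" using c h1d(1) by (rule coprime_poly_dvd)
      have nr: "\<not> r dvd h1"
      proof
        assume rh: "r dvd h1"
        then have "r dvd m" "r dvd y" using h1d by (auto intro: dvd_trans)
        then have "coprime r D" using c coprime_poly_dvd by blast
        obtain y' where y': "y = D * y'" using True by (auto elim: dvdE)
        have "r dvd y'" using \<open>coprime r D\<close> \<open>r dvd y\<close> unfolding y' by (rule coprime_poly_dvd_mult)
        then have "D * r dvd y" unfolding y' by simp
        then show False using True by blast
      qed
      show "coprime h1 n"
      proof (rule coprimeI)
        fix k assume k: "k dvd h1" "k dvd n"
        have kD: "coprime k D" using hD k(1) by (rule coprime_poly_dvd)
        then have kP: "coprime k P" using P by (metis coprime_commute coprime_poly_dvd)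
        have "k dvd D * r" using kP k(2) unfolding n by (rule coprime_poly_dvd_mult)
        with kD have "k dvd r" by (rule coprime_poly_dvd_mult)
        then obtain j where j: "r = k * j" by (rule dvdE)
        then have "r dvd k \<or> r dvd j" using r by (metis dvd_refl prime_elem_dvd_multD)
        moreover have "\<not> r dvd k" using nr k(1) dvd_trans by blast
        ultimately obtain i where i: "j = r * i" by (auto elim: dvdE)
        have "r * (k * i) = k * (r * i)" by (simp add: ac_simps)
        also have "\<dots> = r * 1" by (simp only: i[symmetric] j[symmetric] mult_1_right)
        finally have "k * i = 1" using r by (metis mult_left_cancel prime_elem_def)
        then show "is_unit k" by (metis dvdI)
      qed
    qed
    define ind where "ind = (\<lambda>(a, d). if coprime d (y div a) then 1 else (0 :: int))"
    have sum1: "(\<Sum>z\<in>Prs. ind z) = (if coprime m D then 1 else 0)"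
    proof (cases "coprime m D")
      case True
      have in1: "(h1, d1) \<in> Prs" using True cop_iff h1 d1 d1m h1d(2) by (simp add: Prs_def)
      have "finite Prs"
      proof (rule finite_subset)
        show "Prs \<subseteq> {P. degree P \<le> degree m} \<times> {P. degree P \<le> degree m}"
        proof
          fix z assume "z \<in> Prs"
          then obtain a d where z: "z = (a, d)" "a * d = m" by (auto simp add: Prs_def)
          then have "degree a + degree d = degree m" using m0 by (metis degree_mult_eq mult_eq_0_iff)
          then show "z \<in> {P. degree P \<le> degree m} \<times> {P. degree P \<le> degree m}" by (simp add: z)
        qed
        show "finite ({P :: 'a poly. degree P \<le> degree m} \<times> {P :: 'a poly. degree P \<le> degree m})"
          by (intro finite_cartesian_product finite_poly_degree_le)
      qed
      then have "(\<Sum>z\<in>Prs. ind z) =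
          (\<Sum>z\<in>{(h1, d1)}. ind z)"
      proof (rule sum.mono_neutral_right)
        show "{(h1, d1)} \<subseteq> Prs" using in1 by blast
        show "\<forall>z\<in>Prs - {(h1, d1)}. ind z = 0"
        proof
          fix z assume z: "z \<in> Prs - {(h1, d1)}"
          obtain a d where zz: "z = (a, d)" by (cases z) auto
          then have "\<not> coprime d (y div a)" using uniq[of a d] z by blast
          then show "ind z = 0" by (simp add: zz ind_def)
        qed
      qed
      also have "y div h1 = y1" using h1(2) unfolding y1 by (rule nonzero_mult_div_cancel_left)
      then have "(\<Sum>z\<in>{(h1, d1)}. ind z) = 1" using cop1 by (simp add: ind_def)
      finally show ?thesis using True by simp
    next
      case False
      have "(\<Sum>z\<in>Prs. ind z) = 0"
      proof (rule sum.neutral, rule ballI)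
        fix z assume z: "z \<in> Prs"
        obtain a d where zz: "z = (a, d)" by (cases z) auto
        have "\<not> coprime d (y div a)"
        proof
          assume "coprime d (y div a)"
          then have "a = h1" using uniq z zz by blast
          then have "coprime h1 n" using z zz by (simp add: Prs_def)
          with False cop_iff show False by blast
        qed
        then show "ind z = 0" by (simp add: zz ind_def)
      qed
      then show ?thesis using False by simp
    qed
    have "int CARD('a) dvd (\<Sum>z\<in>Prs. int (card (S z)) - ind z)"
    proof (rule dvd_sum)
      fix z assume z: "z \<in> Prs"
      obtain a d where zz: "z = (a, d)" by (cases z) auto
      have "d \<noteq> 0" using z by (auto simp add: zz Prs_def)
      then show "int CARD('a) dvd int (card (S z)) - ind z"
        unfolding zz S_def ind_def prod.case by (rule card_residues_dvd)
    qed
    then show ?thesis unfolding sum_subtractf cZ[symmetric] sum1 using True by simp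
  qed
qed

lemma Lam_1_matrix: "x \<in> Lam 1 \<Longrightarrow> map_matrix embed_poly g *v x \<in> Lam 1"
proof -
  assume "x \<in> Lam 1"
  then obtain a b where "x = vector [embed_poly a, embed_poly b]" unfolding Lam_1_iff by blast
  then show ?thesis
    by (intro LamI[of _ "g $ 1 $ 1 * a + g $ 1 $ 2 * b" _ "g $ 2 $ 1 * a + g $ 2 $ 2 * b"])
      (simp_all add: mat2_vec_component map_matrix_def embed_poly_add embed_poly_mult)
qed

lemma Phi_iff: "w \<in> Phi D E \<longleftrightarrow> (\<exists>w1 w2. w = vector [embed_poly w1, embed_poly w2] \<and> D dvd w2 \<and> \<not> E dvd w2)"
proof
  assume w: "w \<in> Phi D E"
  then obtain a b where ab: "w $ 1 = embed_poly a" "w $ 2 = embed_poly (D * b)" by (auto simp add: Phi_def Lam_def)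
  have "\<not> E dvd D * b"
  proof
    assume "E dvd D * b"
    then obtain c where "D * b = E * c" by (rule dvdE)
    then have "w \<in> Lam E" using ab by (intro LamI[of _ a _ c]) simp_all
    then show False using w by (simp add: Phi_def)
  qed
  then show "\<exists>w1 w2. w = vector [embed_poly w1, embed_poly w2] \<and> D dvd w2 \<and> \<not> E dvd w2"
    using ab by (intro exI[of _ a] exI[of _ "D * b"]) (simp add: vec2_eq_iff)
next
  assume "\<exists>w1 w2. w = vector [embed_poly w1, embed_poly w2] \<and> D dvd w2 \<and> \<not> E dvd w2"
  then obtain w1 w2 where w: "w = vector [embed_poly w1, embed_poly w2]" "D dvd w2" "\<not> E dvd w2" by blast
  obtain b where b: "w2 = D * b" using w(2) by (rule dvdE)
  have "w \<in> Lam D" by (rule LamI[of _ w1 _ b]) (simp_all add: w b)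
  moreover have "w \<notin> Lam E"
  proof
    assume "w \<in> Lam E"
    then obtain c where "w $ 2 = embed_poly (E * c)" by (auto simp add: Lam_def)
    then have "w2 = E * c" using w(1) by simp
    then show False using w(3) by simp
  qed
  ultimately show "w \<in> Phi D E" by (simp add: Phi_def)
qed

lemma card_Phi_mact:
  fixes L :: "('a::{field,finite} fls ^ 2) set"
  assumes L: "is_lattice L" and g: "det g = m" "m \<noteq> 0"
  shows "card (Phi D E \<inter> sc i (mact g L)) =
    card {u \<in> Lam 1 \<inter> sc (i - int (degree m)) L. \<exists>w \<in> Phi D E. map_matrix embed_poly g *v u = embed_poly m *s w}"
proof -
  let ?g = "map_matrix embed_poly g" and ?h = "map_matrix embed_poly (adjm g)" and ?m = "embed_poly m"
  have hg: "?h *v (?g *v z) = ?m *s z" "?g *v (?h *v z) = ?m *s z" for z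
    unfolding g(1)[symmetric]
    by (simp_all add: vec2_eq_iff mat2_vec_component map_matrix_def det_2 embed_poly_diff embed_poly_mult
        embed_poly_uminus algebra_simps)
  have m0: "?m \<noteq> 0" using g(2) by simp
  have cancel: "?m *s z = ?m *s z' \<Longrightarrow> z = z'" for z z' :: "'a fls ^ 2" using m0 by (simp add: vec2_eq_iff)
  have sub: "Phi D E \<subseteq> Lam 1" unfolding Phi_def using Lam_subset_1 by blast
  have scl: "sc (i - int (degree m)) L = scale_lattice ?m (sc i L)"
    using L m0 by (simp add: scale_unit is_lattice_sc sc_sc embed_poly_subdegree)
  have gs: "sc i (mact g L) = mact g (sc i L)" by (simp add: mact_sc)
  have hs: "?g *v (k *s z) = k *s (?g *v z)" "?h *v (k *s z) = k *s (?h *v z)" for k z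
    by (simp_all add: vec2_eq_iff mat2_vec_component algebra_simps)
  let ?U = "{u \<in> Lam 1 \<inter> sc (i - int (degree m)) L. \<exists>w \<in> Phi D E. ?g *v u = ?m *s w}"
  have "bij_betw (\<lambda>w. ?h *v w) (Phi D E \<inter> sc i (mact g L)) ?U"
    unfolding bij_betw_def
  proof (intro conjI equalityI subsetI)
    have "det (adjm g) \<noteq> 0" using g by simp
    then show "inj_on (\<lambda>w. ?h *v w) (Phi D E \<inter> sc i (mact g L))" using inj_embed_matrix inj_on_subset by blast
  next
    fix u assume "u \<in> (\<lambda>w. ?h *v w) ` (Phi D E \<inter> sc i (mact g L))"
    then obtain w where w: "w \<in> Phi D E" "w \<in> mact g (sc i L)" "u = ?h *v w" unfolding gs by blast
    then obtain z where z: "z \<in> sc i L" "w = ?g *v z" unfolding mact_def by blast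
    have "u = ?m *s z" unfolding w(3) z(2) hg ..
    then have "u \<in> sc (i - int (degree m)) L" using z(1) unfolding scl scale_lattice_def by blast
    moreover have "u \<in> Lam 1" unfolding w(3) using w(1) sub by (intro Lam_1_matrix) auto
    moreover have "?g *v u = ?m *s w" unfolding w(3) by (rule hg)
    ultimately show "u \<in> ?U" using w(1) by blast
  next
    fix u assume "u \<in> ?U"
    then obtain w where w: "u \<in> scale_lattice ?m (sc i L)" "w \<in> Phi D E" "?g *v u = ?m *s w" unfolding scl by blast
    obtain z where z: "z \<in> sc i L" "u = ?m *s z" using w(1) unfolding scale_lattice_def by blast
    have "w = ?g *v z" using w(3) unfolding z(2) hs by (rule cancel[symmetric])
    then have "w \<in> mact g (sc i L)" using z(1) unfolding mact_def by blast
    moreover have "u = ?h *v w" unfolding \<open>w = ?g *v z\<close> hg z(2) ..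
    ultimately show "u \<in> (\<lambda>w. ?h *v w) ` (Phi D E \<inter> sc i (mact g L))" using w(2) unfolding gs by blast
  qed
  then show ?thesis by (rule bij_betw_same_card)
qed

lemma hecke_Mx:
  fixes L :: "('a::{field,finite} fls ^ 2) set" and m n D r P :: "'a poly"
  assumes L: "is_lattice L" and m: "lead_coeff m = 1" and r: "prime_elem r" and n: "n = P * (D * r)" and P: "P dvd D"
  shows "int CARD('a) dvd (\<Sum>x \<in> hecke_index n m. Mx D (mact (hmat x) L) - Mx (D * r) (mact (hmat x) L))
    - (if coprime m D then 1 else 0) * (Mx D L - Mx (D * r) L)"
proof -
  define E where "E = D * r"
  define lam :: int where "lam = (if coprime m D then 1 else 0)"
  define k where "k = int (degree m)"
  have m0: "m \<noteq> 0" using m by auto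
  have DE: "D dvd E" by (simp add: E_def)
  let ?X = "hecke_index n m"
  have finX: "finite ?X" using m0 by (rule finite_hecke_index)
  define N where "N = (\<lambda>i L. int (card (Phi D E \<inter> sc i L)))"
  have step: "int CARD('a) dvd (\<Sum>x\<in>?X. N i (mact (hmat x) L)) - lam * N (i - k) L" for i
  proof -
    define U where "U = Lam 1 \<inter> sc (i - k) L"
    have finU: "finite U" unfolding U_def using L by (intro finite_Lam_lattice is_lattice_sc)
    define R where "R = (\<lambda>x u. \<exists>w \<in> Phi D E. map_matrix embed_poly (hmat x) *v u = embed_poly m *s w)"
    have "N i (mact (hmat x) L) = (\<Sum>u\<in>U. if R x u then 1 else 0)" if "x \<in> ?X" for x
      unfolding N_def card_Phi_mact[OF L hecke_index_det[OF that] m0] U_def[symmetric, unfolded k_def]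
      using finU by (simp add: sum.If_cases Int_def R_def)
    then have "(\<Sum>x\<in>?X. N i (mact (hmat x) L)) = (\<Sum>x\<in>?X. \<Sum>u\<in>U. if R x u then 1 else 0)" by (rule sum.cong[OF refl])
    also have "\<dots> = (\<Sum>u\<in>U. \<Sum>x\<in>?X. if R x u then 1 else 0)" by (rule sum.swap)
    also have "\<dots> = (\<Sum>u\<in>U. int (card {x \<in> ?X. R x u}))" using finX by (simp add: sum.If_cases Int_def)
    finally have s1: "(\<Sum>x\<in>?X. N i (mact (hmat x) L)) = (\<Sum>u\<in>U. int (card {x \<in> ?X. R x u}))" .
    have "N (i - k) L = (\<Sum>u\<in>U. if u \<in> Phi D E then 1 else 0)"
    proof -
      have "Phi D E \<inter> sc (i - k) L = {u \<in> U. u \<in> Phi D E}" unfolding U_def Phi_def using Lam_subset_1 by blast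
      then show ?thesis unfolding N_def using finU by (simp add: sum.If_cases Int_def)
    qed
    then have s2: "(\<Sum>x\<in>?X. N i (mact (hmat x) L)) - lam * N (i - k) L =
        (\<Sum>u\<in>U. int (card {x \<in> ?X. R x u}) - lam * (if u \<in> Phi D E then 1 else 0))"
      unfolding s1 by (simp add: sum_subtractf sum_distrib_left)
    show ?thesis unfolding s2
    proof (rule dvd_sum)
      fix u assume "u \<in> U"
      then obtain x y where u: "u = vector [embed_poly x, embed_poly y]" unfolding U_def using Lam_1_iff by blast
      have Rz: "R z u \<longleftrightarrow> (case z of (a, b, d) \<Rightarrow> \<exists>w1 w2. a * x + b * y = m * w1 \<and> d * y = m * w2 \<and> D dvd w2 \<and> \<not> D * r dvd w2)" for z
      proof -
        obtain a b d where z: "z = (a, b, d)" by (cases z) auto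
        have "map_matrix embed_poly (hmat z) *v u = vector [embed_poly (a * x + b * y), embed_poly (d * y)]"
          by (simp add: vec2_eq_iff mat2_vec_component map_matrix_def z u embed_poly_add embed_poly_mult)
        moreover have "embed_poly m *s vector [embed_poly w1, embed_poly w2] = (vector [embed_poly (m * w1), embed_poly (m * w2)] :: 'a fls ^ 2)" for w1 w2
          by (simp add: vec2_eq_iff embed_poly_mult)
        moreover have "vector [embed_poly p1, embed_poly p2] = (vector [embed_poly p3, embed_poly p4] :: 'a fls ^ 2) \<longleftrightarrow> p1 = p3 \<and> p2 = p4" for p1 p2 p3 p4
          by (simp add: vec2_eq_iff)
        ultimately show ?thesis unfolding R_def Bex_def Phi_iff z prod.case E_def by metis
      qed
      then have c: "{z \<in> ?X. R z u} = {z \<in> ?X. case z of (a, b, d) \<Rightarrow>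
          \<exists>w1 w2. a * x + b * y = m * w1 \<and> d * y = m * w2 \<and> D dvd w2 \<and> \<not> D * r dvd w2}" by (simp only: Rz)
      have "u \<in> Phi D E \<longleftrightarrow> D dvd y \<and> \<not> D * r dvd y"
        unfolding Phi_iff u E_def by (auto simp add: vec2_eq_iff)
      then show "int CARD('a) dvd int (card {x \<in> ?X. R x u}) - lam * (if u \<in> Phi D E then 1 else 0)"
        unfolding c lam_def using hecke_multiplicity[OF m r n P, of x y] by simp
    qed
  qed
  define B where "B = (\<Sum>x\<in>?X. \<bar>Mx D (mact (hmat x) L)\<bar> + \<bar>Mx E (mact (hmat x) L)\<bar>) + \<bar>Mx D L\<bar> + \<bar>Mx E L\<bar> + k"
  define I where "I = {- B - 1..B}"
  have k0: "0 \<le> k" by (simp add: k_def)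
  have Bx: "\<bar>Mx D (mact (hmat x) L)\<bar> + \<bar>Mx E (mact (hmat x) L)\<bar> \<le> B" if "x \<in> ?X" for x
  proof -
    have "\<bar>Mx D (mact (hmat x) L)\<bar> + \<bar>Mx E (mact (hmat x) L)\<bar> \<le> (\<Sum>x\<in>?X. \<bar>Mx D (mact (hmat x) L)\<bar> + \<bar>Mx E (mact (hmat x) L)\<bar>)"
      using that finX by (intro member_le_sum) auto
    then show ?thesis using k0 by (simp add: B_def)
  qed
  have BL: "\<bar>Mx D L\<bar> + \<bar>Mx E L\<bar> + k \<le> B" unfolding B_def by (simp add: sum_nonneg)
  have a: "int CARD('a) dvd (\<Sum>x\<in>?X. (\<Sum>i\<in>I. N i (mact (hmat x) L)) + (Mx D (mact (hmat x) L) - Mx E (mact (hmat x) L)))"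
  proof (rule dvd_sum)
    fix x assume x: "x \<in> ?X"
    have "{Mx E (mact (hmat x) L)<..Mx D (mact (hmat x) L)} \<subseteq> I" using Bx[OF x] by (auto simp add: I_def)
    moreover have "is_lattice (mact (hmat x) L)" using hecke_index_det[OF x] m0 L by (intro is_lattice_mact) auto
    ultimately show "int CARD('a) dvd (\<Sum>i\<in>I. N i (mact (hmat x) L)) + (Mx D (mact (hmat x) L) - Mx E (mact (hmat x) L))"
      unfolding N_def using DE by (intro sum_card_Phi) (auto simp add: I_def)
  qed
  have b: "int CARD('a) dvd (\<Sum>i\<in>I. N (i - k) L) + (Mx D L - Mx E L)"
  proof -
    have "(\<Sum>i\<in>I. N (i - k) L) = (\<Sum>i \<in> (\<lambda>i. i - k) ` I. N i L)" by (simp add: sum.reindex inj_on_def)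
    also have "(\<lambda>i. i - k) ` I = {- B - 1 - k..B - k}"
    proof (intro equalityI subsetI)
      fix z assume "z \<in> {- B - 1 - k..B - k}"
      then have "z = (z + k) - k" "z + k \<in> I" by (auto simp add: I_def)
      then show "z \<in> (\<lambda>i. i - k) ` I" by blast
    qed (auto simp add: I_def)
    finally show ?thesis unfolding N_def using BL k0
      by (simp only:) (intro sum_card_Phi[OF L DE], auto)
  qed
  have c: "int CARD('a) dvd (\<Sum>i\<in>I. (\<Sum>x\<in>?X. N i (mact (hmat x) L)) - lam * N (i - k) L)" using step by (intro dvd_sum)
  let ?s1 = "\<Sum>x\<in>?X. \<Sum>i\<in>I. N i (mact (hmat x) L)"
  let ?s2 = "\<Sum>x\<in>?X. Mx D (mact (hmat x) L) - Mx E (mact (hmat x) L)"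
  let ?s3 = "\<Sum>i\<in>I. N (i - k) L"
  have a': "int CARD('a) dvd ?s1 + ?s2" using a by (simp only: sum.distrib)
  have c': "int CARD('a) dvd ?s1 - lam * ?s3" using c by (simp only: sum_subtractf sum_distrib_left sum.swap[of _ I])
  have "int CARD('a) dvd (?s1 + ?s2) - (?s1 - lam * ?s3) - lam * (?s3 + (Mx D L - Mx E L))"
    by (intro dvd_diff a' c' dvd_mult b)
  also have "(?s1 + ?s2) - (?s1 - lam * ?s3) - lam * (?s3 + (Mx D L - Mx E L)) = ?s2 - lam * (Mx D L - Mx E L)"
    by (simp add: algebra_simps)
  finally show ?thesis unfolding E_def lam_def .
qed

lemma hop_gradient:
  fixes e :: "'a::{field,finite} tree_edge" and m n D r P :: "'a poly"
  assumes e: "e \<in> tree_edges" and m: "lead_coeff m = 1" and r: "prime_elem r" and n: "n = P * (D * r)" and P: "P dvd D"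
  shows "int CARD('a) dvd (\<Sum>x \<in> hecke_index n m. Gv D (D * r) (snd (act_edge (hmat x) e)) - Gv D (D * r) (fst (act_edge (hmat x) e)))
    - (if coprime m D then 1 else 0) * (Gv D (D * r) (snd e) - Gv D (D * r) (fst e))"
proof -
  let ?lam = "if coprime m D then 1 else 0 :: int"
  have m0: "m \<noteq> 0" using m by auto
  have vertex: "int CARD('a) dvd (\<Sum>x \<in> hecke_index n m. Gv D (D * r) (act_vertex (hmat x) v)) - ?lam * Gv D (D * r) v"
    if "v \<in> tree_vertices" for v
  proof -
    obtain L where L: "is_lattice L" "v = homothety_class L" using \<open>v \<in> tree_vertices\<close> by (rule tree_vertexE)
    have "Gv D (D * r) (act_vertex (hmat x) v) = Mx D (mact (hmat x) L) - Mx (D * r) (mact (hmat x) L)"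
      if "x \<in> hecke_index n m" for x
      using hecke_index_det[OF that] m0 L by (simp add: act_homothety_class Gv_class is_lattice_mact)
    then have "(\<Sum>x \<in> hecke_index n m. Gv D (D * r) (act_vertex (hmat x) v)) =
        (\<Sum>x \<in> hecke_index n m. Mx D (mact (hmat x) L) - Mx (D * r) (mact (hmat x) L))" by (rule sum.cong[OF refl])
    then show ?thesis using hecke_Mx[OF L(1) m r n P] by (simp only: L(2) Gv_class[OF L(1)])
  qed
  have "fst e \<in> tree_vertices" "snd e \<in> tree_vertices" using e by (auto simp add: tree_edges_def)
  from dvd_diff[OF vertex[OF this(2)] vertex[OF this(1)]] show ?thesis
    by (simp add: act_edge_def sum_subtractf algebra_simps)
qed

lemma Gv_nonconstant:
  fixes D r :: "'a::{field,finite} poly"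
  assumes D: "D \<noteq> 0" and r: "degree r \<noteq> 0"
  shows "\<exists>e \<in> tree_edges. \<bar>Gv D (D * r) (snd e) - Gv D (D * r) (fst e)\<bar> = 1"
proof (rule ccontr)
  assume c: "\<not> ?thesis"
  have const: "Gv D (D * r) w = Gv D (D * r) v" if "(v, w) \<in> tree_edges" for v w
  proof -
    obtain L L' where L: "is_lattice L" "L' \<in> nbs L" "v = homothety_class L" "w = homothety_class L'"
      using \<open>(v, w) \<in> tree_edges\<close> by (rule tree_edgeE)
    have "Mx d L' = Mx d L \<or> Mx d L' = Mx d L - 1" for d using Mx_nbs[OF L(1,2), of d] by auto
    from this[of D] this[of "D * r"]
    have "\<bar>Gv D (D * r) w - Gv D (D * r) v\<bar> \<le> 1"
      using L(1) nbs_lattice[OF L(2)] by (auto simp add: L(3,4) Gv_class)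
    moreover have "\<bar>Gv D (D * r) w - Gv D (D * r) v\<bar> \<noteq> 1" using c that by fastforce
    ultimately show ?thesis by linarith
  qed
  have all: "Gv D (D * r) w = Gv D (D * r) v" if "(v, w) \<in> tree_edges\<^sup>*" for v w
    using that by (induction rule: rtrancl_induct) (auto dest: const)
  define c where "c = - int (degree (D * r))"
  have r0: "r \<noteq> 0" using r by auto
  have deg: "degree (D * r) = degree D + degree r" using D r0 by (rule degree_mult_eq)
  have in_sc: "w \<in> sc i (Vc b) \<longleftrightarrow> w $ 1 / pw i \<in> valuation_ring \<and> w $ 2 / pw (i + b) \<in> valuation_ring" for w :: "'a fls ^ 2" and i b
    by (simp add: in_sc_iff in_Vc_iff pw_uminus pw_add field_simps)
  have small: "Mx d (Vc b) < 1" if d: "d \<noteq> 0" and b: "- int (degree d) \<le> b" for d :: "'a poly" and b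
  proof (rule ccontr)
    assume "\<not> Mx d (Vc b) < 1"
    then have "1 \<le> Mx d (Vc b)" by simp
    then obtain w where w: "w \<in> Lam d" "w \<noteq> 0" "w \<in> sc 1 (Vc b)"
      using le_Mx_iff[OF is_lattice_Vc[of b], of 1 d] by blast
    obtain s t where st: "w $ 1 = embed_poly s" "w $ 2 = embed_poly (d * t)" using w(1) by (auto simp add: Lam_def)
    have "s = 0" using w(3) unfolding in_sc st divide_pw_in_valuation_ring by (auto simp add: embed_poly_subdegree)
    moreover have "d * t = 0 \<or> 1 + b \<le> - int (degree (d * t))"
      using w(3) unfolding in_sc st divide_pw_in_valuation_ring by (auto simp add: embed_poly_subdegree)
    then have "t = 0"
    proof (rule contrapos_pp)
      assume t: "t \<noteq> 0"
      then have "degree (d * t) = degree d + degree t" using d by (intro degree_mult_eq)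
      then show "\<not> (d * t = 0 \<or> 1 + b \<le> - int (degree (d * t)))" using t d b by simp
    qed
    ultimately show False using w(2) st by (simp add: vec2_eq_iff)
  qed
  have big: "0 \<le> Mx d (Vc b)" for d :: "'a poly" and b :: int
    unfolding le_Mx_iff[OF is_lattice_Vc]
    by (rule bexI[of _ "vector [1, 0]"]) (auto intro!: LamI[of _ 1 _ 0] simp add: vec2_eq_iff in_Vc_iff)
  have G0: "Gv D (D * r) (homothety_class (Vc 0)) = 0"
    using small[of D 0] small[of "D * r" 0] big[of D 0] big[of "D * r" 0] D r0 by (simp add: Gv_class)
  have "1 \<le> Mx D (Vc c)"
    unfolding le_Mx_iff[OF is_lattice_Vc]
  proof (rule bexI[of _ "vector [0, embed_poly D]"])
    show "vector [0, embed_poly D] \<in> Lam D" by (rule LamI[of _ 0 _ 1]) simp_all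
    show "vector [0, embed_poly D] \<noteq> (0 :: 'a fls ^ 2) \<and> vector [0, embed_poly D] \<in> sc 1 (Vc c)"
      using D r unfolding in_sc divide_pw_in_valuation_ring by (simp add: vec2_eq_iff embed_poly_subdegree c_def deg)
  qed
  moreover have "Mx (D * r) (Vc c) < 1" using D r0 by (intro small) (simp_all add: c_def)
  ultimately have "Gv D (D * r) (homothety_class (Vc c)) \<noteq> 0" by (simp add: Gv_class)
  moreover have "Gv D (D * r) (homothety_class (Vc c)) = Gv D (D * r) (homothety_class (Vc 0))"
    by (intro all tree_connected homothety_class_in_tree_vertices is_lattice_Vc)
  ultimately show False using G0 by simp
qed

section \<open>Subgroups of free abelian groups of finite rank\<close>

lemma subgroup_finitely_generated:
  fixes A :: "('y \<Rightarrow> int) set"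
  assumes "finite J" and "(\<lambda>y. 0) \<in> A"
    and "\<And>f g. f \<in> A \<Longrightarrow> g \<in> A \<Longrightarrow> (\<lambda>y. f y - g y) \<in> A"
    and "\<And>f. f \<in> A \<Longrightarrow> (\<forall>j\<in>J. f j = 0) \<Longrightarrow> f = (\<lambda>y. 0)"
  shows "\<exists>B. finite B \<and> B \<subseteq> A \<and> (\<forall>f\<in>A. \<exists>c. f = (\<lambda>y. \<Sum>b\<in>B. c b * b y))"
  using assms
proof (induction J arbitrary: A rule: finite_induct)
  case empty
  then have "\<forall>f\<in>A. f = (\<lambda>y. 0)" by blast
  then show ?case by (intro exI[of _ "{}"]) simp
next
  case (insert j J)
  have sub: "\<And>f g. f \<in> A \<Longrightarrow> g \<in> A \<Longrightarrow> (\<lambda>y. f y - g y) \<in> A" and zero: "(\<lambda>y. 0) \<in> A" by fact+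
  have neg: "(\<lambda>y. - f y) \<in> A" if "f \<in> A" for f using sub[OF zero that] by simp
  have nmul: "(\<lambda>y. int k * f y) \<in> A" if "f \<in> A" for f k
  proof (induction k)
    case (Suc k)
    have "(\<lambda>y. int k * f y - - f y) \<in> A" using Suc neg[OF that] by (rule sub)
    then show ?case by (simp add: algebra_simps)
  qed (simp add: zero)
  have mul: "(\<lambda>y. k * f y) \<in> A" if "f \<in> A" for f k
    using nmul[OF that, of "nat k"] nmul[OF neg[OF that], of "nat (- k)"] by (cases "0 \<le> k") simp_all
  show ?case
  proof (cases "\<forall>f\<in>A. f j = 0")
    case True
    show ?thesis
      by (rule insert.IH[OF zero sub]) (use insert.prems(3) True in auto)
  next
    case False
    then obtain f1 where f1: "f1 \<in> A" "f1 j \<noteq> 0" by blast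
    have "\<exists>f. f \<in> A \<and> 0 < f j"
    proof (cases "0 < f1 j")
      case False
      then show ?thesis using f1 neg[OF f1(1)] by (intro exI[of _ "\<lambda>y. - f1 y"]) auto
    qed (use f1 in blast)
    then obtain f2 where f2: "f2 \<in> A \<and> 0 < f2 j" by blast
    obtain f0 where f0: "f0 \<in> A" "0 < f0 j" and min: "\<And>f. f \<in> A \<Longrightarrow> 0 < f j \<Longrightarrow> nat (f0 j) \<le> nat (f j)"
      using ex_has_least_nat[of "\<lambda>f. f \<in> A \<and> 0 < f j", OF f2, of "\<lambda>f. nat (f j)"] by blast
    define A' where "A' = {f \<in> A. f j = 0}"
    have "\<exists>B. finite B \<and> B \<subseteq> A' \<and> (\<forall>f\<in>A'. \<exists>c. f = (\<lambda>y. \<Sum>b\<in>B. c b * b y))"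
    proof (rule insert.IH)
      show "(\<lambda>y. 0) \<in> A'" using zero by (simp add: A'_def)
      show "(\<lambda>y. f y - g y) \<in> A'" if "f \<in> A'" "g \<in> A'" for f g using that sub by (simp add: A'_def)
      show "f = (\<lambda>y. 0)" if "f \<in> A'" "\<forall>j\<in>J. f j = 0" for f
        using that insert.prems(3)[of f] by (simp add: A'_def)
    qed
    then obtain B where B: "finite B" "B \<subseteq> A'" "\<forall>f\<in>A'. \<exists>c. f = (\<lambda>y. \<Sum>b\<in>B. c b * b y)" by blast
    have nB: "f0 \<notin> B" using B(2) f0(2) by (auto simp add: A'_def)
    show ?thesis
    proof (rule exI[of _ "insert f0 B"], intro conjI ballI)
      show "finite (insert f0 B)" using B(1) by simp
      show "insert f0 B \<subseteq> A" using B(2) f0(1) by (auto simp add: A'_def)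
      fix f assume f: "f \<in> A"
      define q where "q = f j div f0 j"
      define f' where "f' = (\<lambda>y. f y - q * f0 y)"
      have f'A: "f' \<in> A" unfolding f'_def by (rule sub[OF f mul[OF f0(1)]])
      have f'j: "f' j = f j mod f0 j" by (simp add: f'_def q_def minus_div_mult_eq_mod)
      have "f' j = 0"
      proof (rule ccontr)
        assume "f' j \<noteq> 0"
        moreover have "0 \<le> f' j" "f' j < f0 j" unfolding f'j using f0(2) by auto
        ultimately show False using min[OF f'A] by simp
      qed
      then have "f' \<in> A'" using f'A by (simp add: A'_def)
      then obtain c where c: "f' = (\<lambda>y. \<Sum>b\<in>B. c b * b y)" using B(3) by blast
      have "f y = (\<Sum>b\<in>insert f0 B. (c(f0 := q)) b * b y)" for y
      proof -
        have "(\<Sum>b\<in>B. (c(f0 := q)) b * b y) = (\<Sum>b\<in>B. c b * b y)" using nB by (intro sum.cong) auto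
        also have "\<dots> = f y - q * f0 y" using fun_cong[OF c, of y] by (simp add: f'_def)
        finally show ?thesis using B(1) nB by simp
      qed
      then show "\<exists>c. f = (\<lambda>y. \<Sum>b\<in>insert f0 B. c b * b y)" by blast
    qed
  qed
qed

lemma integral_relation:
  fixes v :: "nat \<Rightarrow> 'y \<Rightarrow> int"
  assumes J: "finite J" and det: "\<And>c k. (\<forall>j\<in>J. (\<Sum>i<k. c i * v i j) = 0) \<Longrightarrow> (\<lambda>y. \<Sum>i<k. c i * v i y) = (\<lambda>y. 0)"
  shows "\<exists>K c. v K = (\<lambda>y. \<Sum>i<K. c i * v i y)"
proof -
  define A where "A = (\<lambda>k. {(\<lambda>y. \<Sum>i<k. c i * v i y) | c :: nat \<Rightarrow> int. True})"
  have up: "A k \<subseteq> A k'" if "k \<le> k'" for k k'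
  proof
    fix f assume "f \<in> A k"
    then obtain c where c: "f = (\<lambda>y. \<Sum>i<k. c i * v i y)" by (auto simp add: A_def)
    have "(\<Sum>i<k'. (if i < k then c i else 0) * v i y) = (\<Sum>i<k. c i * v i y)" for y
    proof -
      have "(\<Sum>i<k'. (if i < k then c i else 0) * v i y) = (\<Sum>i<k. (if i < k then c i else 0) * v i y)"
        using that by (intro sum.mono_neutral_right) auto
      then show ?thesis by simp
    qed
    then have "f = (\<lambda>y. \<Sum>i<k'. (if i < k then c i else 0) * v i y)" unfolding c by simp
    then show "f \<in> A k'"
      unfolding A_def by (intro CollectI exI[of _ "\<lambda>i. if i < k then c i else 0"] conjI TrueI)
  qed
  have sub: "(\<lambda>y. f y - g y) \<in> A k" if fg: "f \<in> A k" "g \<in> A k" for f g k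
  proof -
    obtain c where c: "f = (\<lambda>y. \<Sum>i<k. c i * v i y)" using fg(1) by (auto simp add: A_def)
    obtain d where d: "g = (\<lambda>y. \<Sum>i<k. d i * v i y)" using fg(2) by (auto simp add: A_def)
    have "(\<lambda>y. f y - g y) = (\<lambda>y. \<Sum>i<k. (c i - d i) * v i y)" by (simp add: c d left_diff_distrib sum_subtractf)
    then show ?thesis unfolding A_def by (intro CollectI exI[of _ "\<lambda>i. c i - d i"]) simp
  qed
  have "\<exists>B. finite B \<and> B \<subseteq> (\<Union>k. A k) \<and> (\<forall>f\<in>(\<Union>k. A k). \<exists>c. f = (\<lambda>y. \<Sum>b\<in>B. c b * b y))"
  proof (rule subgroup_finitely_generated[OF J])
    show "(\<lambda>y. 0) \<in> (\<Union>k. A k)" unfolding A_def by (intro UN_I[of 0] CollectI exI[of _ "\<lambda>i. 0"]) simp_all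
    show "(\<lambda>y. f y - g y) \<in> (\<Union>k. A k)" if fg: "f \<in> (\<Union>k. A k)" "g \<in> (\<Union>k. A k)" for f g
    proof -
      obtain k k' where k: "f \<in> A k" "g \<in> A k'" using fg by blast
      then have "f \<in> A (max k k')" "g \<in> A (max k k')" using up[of k "max k k'"] up[of k' "max k k'"] by auto
      then show ?thesis using sub by blast
    qed
    show "f = (\<lambda>y. 0)" if f: "f \<in> (\<Union>k. A k)" "\<forall>j\<in>J. f j = 0" for f
    proof -
      obtain k c where c: "f = (\<lambda>y. \<Sum>i<k. c i * v i y)" using f(1) by (auto simp add: A_def)
      show ?thesis using det[where k = k and c = c] f(2) by (simp add: c)
    qed
  qed
  then obtain B where B: "finite B" "B \<subseteq> (\<Union>k. A k)" "\<forall>f\<in>(\<Union>k. A k). \<exists>c. f = (\<lambda>y. \<Sum>b\<in>B. c b * b y)" by blast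
  have "\<exists>K. B \<subseteq> A K" using B(1,2)
  proof (induction B rule: finite_induct)
    case (insert b B)
    then obtain K k where "B \<subseteq> A K" "b \<in> A k" by blast
    then have "insert b B \<subseteq> A (max K k)" using up[of K "max K k"] up[of k "max K k"] by auto
    then show ?case by blast
  qed simp
  then obtain K where K: "B \<subseteq> A K" ..
  have vK: "v K \<in> A (Suc K)"
  proof -
    have "v K = (\<lambda>y. \<Sum>i<Suc K. (if i = K then 1 else 0) * v i y)" by (simp add: if_distrib[of "\<lambda>x. x * _"] cong: if_cong)
    then show ?thesis unfolding A_def by (intro CollectI exI[of _ "\<lambda>i. if i = K then 1 else 0"]) simp
  qed
  then obtain d where d: "v K = (\<lambda>y. \<Sum>b\<in>B. d b * b y)" using B(3) by blast
  have "\<forall>b\<in>B. \<exists>c. b = (\<lambda>y. \<Sum>i<K. c i * v i y)" using K by (auto simp add: A_def)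
  then obtain c where c: "\<And>b. b \<in> B \<Longrightarrow> b = (\<lambda>y. \<Sum>i<K. c b i * v i y)" by metis
  have "v K y = (\<Sum>i<K. (\<Sum>b\<in>B. d b * c b i) * v i y)" for y
  proof -
    have "v K y = (\<Sum>b\<in>B. d b * (\<Sum>i<K. c b i * v i y))"
      unfolding d using c by (intro sum.cong refl) metis
    also have "\<dots> = (\<Sum>b\<in>B. \<Sum>i<K. d b * c b i * v i y)" by (simp add: sum_distrib_left mult.assoc)
    also have "\<dots> = (\<Sum>i<K. \<Sum>b\<in>B. d b * c b i * v i y)" by (rule sum.swap)
    finally show ?thesis by (simp add: sum_distrib_right)
  qed
  then have "v K = (\<lambda>y. \<Sum>i<K. (\<Sum>b\<in>B. d b * c b i) * v i y)" by (rule ext)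
  then show ?thesis by (intro exI)
qed

section \<open>The ring of endomorphisms\<close>

lemma H0_add: "f \<in> H0 n \<Longrightarrow> g \<in> H0 n \<Longrightarrow> (\<lambda>e. f e + g e) \<in> H0 n"
  by (simp add: H0_iff flow_add divg_add)

lemma H0_scale: "f \<in> H0 n \<Longrightarrow> (\<lambda>e. c * f e) \<in> H0 n"
  by (simp add: H0_iff flow_scale divg_scale)

lemma H0_uminus: "f \<in> H0 n \<Longrightarrow> (\<lambda>e. - f e) \<in> H0 n"
  using H0_scale[of f n "- 1"] by simp

lemma H0_diff: "f \<in> H0 n \<Longrightarrow> g \<in> H0 n \<Longrightarrow> (\<lambda>e. f e - g e) \<in> H0 n"
  using H0_add[of f n "\<lambda>e. - g e"] H0_uminus[of g n] by simp

lemma H0_zero: "(\<lambda>e. 0) \<in> H0 n"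
  by (simp add: H0_iff flow_zero divg_def)

lemma H0_sum: "(\<And>b. b \<in> B \<Longrightarrow> b \<in> H0 n) \<Longrightarrow> (\<lambda>e. \<Sum>b\<in>B. c b * b e) \<in> H0 n"
  by (induction B rule: infinite_finite_induct) (auto simp add: H0_zero intro!: H0_add H0_scale)

lemma H0_determined:
  fixes n :: "'a::{field,finite} poly"
  assumes n: "n \<noteq> 0"
  obtains R where "finite R" "\<And>f. f \<in> H0 n \<Longrightarrow> (\<forall>e\<in>R. f e = 0) \<Longrightarrow> f = (\<lambda>e. 0)"
proof -
  obtain R where R: "finite R" "R \<subseteq> {e \<in> tree_edges. fst e \<in> low_vertices n}"
    "\<And>e. e \<in> {e \<in> tree_edges. fst e \<in> low_vertices n} \<Longrightarrow> \<exists>r \<in> R. r \<in> Gamma0_orbit n e"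
    using low_edges_finite(1)[OF n] by (rule orbit_reps) blast
  have "f = (\<lambda>e. 0)" if f: "f \<in> H0 n" "\<forall>e\<in>R. f e = 0" for f
  proof (rule ccontr)
    assume "f \<noteq> (\<lambda>e. 0)"
    then obtain e where e: "f e \<noteq> 0" by blast
    obtain B where B: "\<And>e. \<bar>f e\<bar> \<le> B" using f(1) by (rule H0_bounded) blast
    have hf: "hinv n f" using f(1) by (simp add: H0_hinv)
    have el: "e \<in> tree_edges" "fst e \<in> low_vertices n" using support_low[OF n hf B e] by auto
    then obtain r g where "r \<in> R" "g \<in> Gamma0 n" "r = act_edge g e" using R(3)[of e] unfolding mem_Gamma0_orbit by blast
    then have "f e = 0" using f(2) hinv_act[OF hf _ el(1)] by metis
    with e show False ..
  qed
  with R(1) that show ?thesis by blast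
qed

lemma End_H0_carrier: "\<phi> \<in> carrier (End_H0 n) \<longleftrightarrow> \<phi> \<in> extensional (H0 n) \<and> (\<forall>f \<in> H0 n. \<phi> f \<in> H0 n) \<and>
    (\<forall>f \<in> H0 n. \<forall>g \<in> H0 n. \<phi> (\<lambda>e. f e + g e) = (\<lambda>e. \<phi> f e + \<phi> g e))"
  by (auto simp add: End_H0_def PiE_iff)

lemma End_H0_simps:
  "one (End_H0 n) = (\<lambda>f\<in>H0 n. f)"
  "zero (End_H0 n) = (\<lambda>f\<in>H0 n. \<lambda>e. 0)"
  "add (End_H0 n) \<phi> \<psi> = (\<lambda>f\<in>H0 n. \<lambda>e. \<phi> f e + \<psi> f e)"
  "monoid.mult (End_H0 n) \<phi> \<psi> = (\<lambda>f\<in>H0 n. \<phi> (\<psi> f))"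
  by (simp_all add: End_H0_def)

lemma End_H0_eqI: "\<phi> \<in> carrier (End_H0 n) \<Longrightarrow> \<psi> \<in> carrier (End_H0 n) \<Longrightarrow> (\<And>f e. f \<in> H0 n \<Longrightarrow> \<phi> f e = \<psi> f e) \<Longrightarrow> \<phi> = \<psi>"
  unfolding End_H0_carrier by (rule extensionalityI) auto

lemma End_H0_add_closed:
  "\<phi> \<in> carrier (End_H0 n) \<Longrightarrow> \<psi> \<in> carrier (End_H0 n) \<Longrightarrow> add (End_H0 n) \<phi> \<psi> \<in> carrier (End_H0 n)"
  by (simp add: End_H0_carrier End_H0_simps H0_add algebra_simps)

lemma End_H0_mult_closed:
  "\<phi> \<in> carrier (End_H0 n) \<Longrightarrow> \<psi> \<in> carrier (End_H0 n) \<Longrightarrow> monoid.mult (End_H0 n) \<phi> \<psi> \<in> carrier (End_H0 n)"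
  by (simp add: End_H0_carrier End_H0_simps H0_add)

lemma End_H0_one_closed: "one (End_H0 n) \<in> carrier (End_H0 n)"
  and End_H0_zero_closed: "zero (End_H0 n) \<in> carrier (End_H0 n)"
  by (simp_all add: End_H0_carrier End_H0_simps H0_add H0_zero)

lemma End_H0_neg_closed: "\<phi> \<in> carrier (End_H0 n) \<Longrightarrow> (\<lambda>f\<in>H0 n. \<lambda>e. - \<phi> f e) \<in> carrier (End_H0 n)"
  by (simp add: End_H0_carrier H0_add H0_uminus)

lemma ring_End_H0: "ring (End_H0 n)"
proof (rule ringI)
  show "abelian_group (End_H0 n)"
  proof (rule abelian_groupI)
    fix x assume x: "x \<in> carrier (End_H0 n)"
    show "zero (End_H0 n) \<oplus>\<^bsub>End_H0 n\<^esub> x = x"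
      by (rule End_H0_eqI[OF _ x]) (simp_all add: End_H0_add_closed End_H0_zero_closed x, simp add: End_H0_simps)
    show "\<exists>y \<in> carrier (End_H0 n). y \<oplus>\<^bsub>End_H0 n\<^esub> x = zero (End_H0 n)"
      by (rule bexI[OF _ End_H0_neg_closed[OF x]]) (simp add: End_H0_simps restrict_def fun_eq_iff)
  qed (simp_all add: End_H0_add_closed End_H0_zero_closed, simp_all add: End_H0_simps restrict_def fun_eq_iff algebra_simps)
  show "monoid (End_H0 n)"
  proof (rule monoidI)
    fix x y z assume x: "x \<in> carrier (End_H0 n)" and y: "y \<in> carrier (End_H0 n)" and z: "z \<in> carrier (End_H0 n)"
    show "x \<otimes>\<^bsub>End_H0 n\<^esub> y \<otimes>\<^bsub>End_H0 n\<^esub> z = x \<otimes>\<^bsub>End_H0 n\<^esub> (y \<otimes>\<^bsub>End_H0 n\<^esub> z)"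
      using z by (auto simp add: End_H0_simps End_H0_carrier restrict_def fun_eq_iff)
  next
    fix x assume x: "x \<in> carrier (End_H0 n)"
    show "one (End_H0 n) \<otimes>\<^bsub>End_H0 n\<^esub> x = x"
      by (rule End_H0_eqI[OF _ x]) (simp add: End_H0_mult_closed End_H0_one_closed x, use x in \<open>simp add: End_H0_simps End_H0_carrier\<close>)
    show "x \<otimes>\<^bsub>End_H0 n\<^esub> one (End_H0 n) = x"
      by (rule End_H0_eqI[OF _ x]) (simp add: End_H0_mult_closed End_H0_one_closed x, simp add: End_H0_simps)
  qed (simp_all add: End_H0_mult_closed End_H0_one_closed)
next
  fix x y z assume x: "x \<in> carrier (End_H0 n)" and y: "y \<in> carrier (End_H0 n)" and z: "z \<in> carrier (End_H0 n)"
  show "(x \<oplus>\<^bsub>End_H0 n\<^esub> y) \<otimes>\<^bsub>End_H0 n\<^esub> z = x \<otimes>\<^bsub>End_H0 n\<^esub> z \<oplus>\<^bsub>End_H0 n\<^esub> y \<otimes>\<^bsub>End_H0 n\<^esub> z"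
    using z by (auto simp add: End_H0_simps End_H0_carrier restrict_def fun_eq_iff)
  show "z \<otimes>\<^bsub>End_H0 n\<^esub> (x \<oplus>\<^bsub>End_H0 n\<^esub> y) = z \<otimes>\<^bsub>End_H0 n\<^esub> x \<oplus>\<^bsub>End_H0 n\<^esub> z \<otimes>\<^bsub>End_H0 n\<^esub> y"
    using x y z by (intro ext) (simp add: End_H0_simps End_H0_carrier restrict_def)
qed

lemma End_H0_a_inv: "\<phi> \<in> carrier (End_H0 n) \<Longrightarrow> a_inv (End_H0 n) \<phi> = (\<lambda>f\<in>H0 n. \<lambda>e. - \<phi> f e)"
proof -
  assume \<phi>: "\<phi> \<in> carrier (End_H0 n)"
  interpret ring "End_H0 n" by (rule ring_End_H0)
  show ?thesis
    by (rule minus_equality[OF _ \<phi> End_H0_neg_closed[OF \<phi>]]) (simp add: End_H0_simps restrict_def fun_eq_iff)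
qed

lemma End_H0_linear:
  assumes \<phi>: "\<phi> \<in> carrier (End_H0 n)" and f: "f \<in> H0 n"
  shows "\<phi> (\<lambda>e. 0) = (\<lambda>e. 0)" and "\<phi> (\<lambda>e. c * f e) = (\<lambda>e. c * \<phi> f e)"
proof -
  have add: "\<phi> (\<lambda>e. f e + g e) = (\<lambda>e. \<phi> f e + \<phi> g e)" if "f \<in> H0 n" "g \<in> H0 n" for f g
    using \<phi> that by (simp add: End_H0_carrier)
  have "\<phi> (\<lambda>e. 0 + 0) = (\<lambda>e. \<phi> (\<lambda>e. 0) e + \<phi> (\<lambda>e. 0) e)" by (rule add[OF H0_zero H0_zero])
  then have z: "\<phi> (\<lambda>e. 0) e = \<phi> (\<lambda>e. 0) e + \<phi> (\<lambda>e. 0) e" for e by (metis add_0)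
  then show zero: "\<phi> (\<lambda>e. 0) = (\<lambda>e. 0)" by (intro ext) (metis add_cancel_right_right)
  have nat: "\<phi> (\<lambda>e. int k * g e) = (\<lambda>e. int k * \<phi> g e)" if g: "g \<in> H0 n" for k g
  proof (induction k)
    case (Suc k)
    have "\<phi> (\<lambda>e. int k * g e + g e) = (\<lambda>e. int k * \<phi> g e + \<phi> g e)"
      using add[OF H0_scale[OF g] g, of "int k"] Suc.IH by simp
    then show ?case by (simp add: algebra_simps)
  qed (simp add: zero)
  have neg: "\<phi> (\<lambda>e. - f e) = (\<lambda>e. - \<phi> f e)"
  proof
    fix e
    have "\<phi> (\<lambda>e. f e + - f e) = (\<lambda>e. \<phi> f e + \<phi> (\<lambda>e. - f e) e)" by (rule add[OF f H0_uminus[OF f]])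
    from fun_cong[OF this, of e] have "0 = \<phi> f e + \<phi> (\<lambda>e. - f e) e" using zero by simp
    then show "\<phi> (\<lambda>e. - f e) e = - \<phi> f e" by simp
  qed
  show "\<phi> (\<lambda>e. c * f e) = (\<lambda>e. c * \<phi> f e)"
    using nat[OF f, of "nat c"] nat[OF H0_uminus[OF f], of "nat (- c)"] neg by (cases "0 \<le> c") simp_all
qed

lemma End_H0_sum:
  assumes \<phi>: "\<phi> \<in> carrier (End_H0 n)" and B: "\<And>b. b \<in> B \<Longrightarrow> b \<in> H0 n"
  shows "\<phi> (\<lambda>e. \<Sum>b\<in>B. c b * b e) = (\<lambda>e. \<Sum>b\<in>B. c b * \<phi> b e)"
  using B
proof (induction B rule: infinite_finite_induct)
  case (insert b B)
  have "\<phi> (\<lambda>e. c b * b e + (\<Sum>b\<in>B. c b * b e)) = (\<lambda>e. \<phi> (\<lambda>e. c b * b e) e + \<phi> (\<lambda>e. \<Sum>b\<in>B. c b * b e) e)"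
    using \<phi> insert.prems by (simp add: End_H0_carrier H0_scale H0_sum)
  then show ?case using insert End_H0_linear(2)[OF \<phi>] by simp
qed (simp_all add: End_H0_linear(1)[OF \<phi> H0_zero])

lemma hop_linear: "hop n m (\<lambda>e. f e + g e) = (\<lambda>e. hop n m f e + hop n m g e)"
  by (simp add: hop_def sum.distrib)

lemma hecke_in_carrier:
  fixes n :: "'a::{field,finite} poly"
  shows "n \<noteq> 0 \<Longrightarrow> lead_coeff m = 1 \<Longrightarrow> hecke n m \<in> carrier (End_H0 n)"
  unfolding End_H0_carrier hecke_eq by (simp add: hop_H0 H0_add hop_linear)

section \<open>The Eisenstein ideal\<close>

lemma eisenstein_generator_eq:
  assumes T: "hecke n l \<in> carrier (End_H0 n)" and f: "f \<in> H0 n"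
  shows "(hecke n l \<ominus>\<^bsub>End_H0 n\<^esub> [N] \<cdot>\<^bsub>End_H0 n\<^esub> \<one>\<^bsub>End_H0 n\<^esub> \<ominus>\<^bsub>End_H0 n\<^esub> \<one>\<^bsub>End_H0 n\<^esub>) f e
    = hop n l f e - int (N + 1) * f e"
proof -
  interpret ring "End_H0 n" by (rule ring_End_H0)
  have pow: "[k] \<cdot>\<^bsub>End_H0 n\<^esub> \<one>\<^bsub>End_H0 n\<^esub> = (\<lambda>f\<in>H0 n. \<lambda>e. int k * f e)" for k :: nat
  proof (induction k)
    case 0
    then show ?case by (simp add: End_H0_simps)
  next
    case (Suc k)
    have "[Suc k] \<cdot>\<^bsub>End_H0 n\<^esub> \<one>\<^bsub>End_H0 n\<^esub> = [k] \<cdot>\<^bsub>End_H0 n\<^esub> \<one>\<^bsub>End_H0 n\<^esub> \<oplus>\<^bsub>End_H0 n\<^esub> \<one>\<^bsub>End_H0 n\<^esub>"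
      by (simp add: add_pow_def)
    also have "\<dots> = (\<lambda>f\<in>H0 n. \<lambda>e. int (Suc k) * f e)"
      unfolding Suc.IH by (simp add: End_H0_simps restrict_def fun_eq_iff algebra_simps)
    finally show ?case .
  qed
  have c: "[N] \<cdot>\<^bsub>End_H0 n\<^esub> \<one>\<^bsub>End_H0 n\<^esub> \<in> carrier (End_H0 n)" by simp
  show ?thesis
    unfolding a_minus_def End_H0_a_inv[OF c] End_H0_a_inv[OF one_closed]
    unfolding pow using f by (simp add: End_H0_simps hecke_eq algebra_simps)
qed

lemma hecke_quotient:
  fixes n D r P :: "'a::{field,finite} poly" and p k :: nat and Q :: "'a poly \<Rightarrow> bool"
  assumes p: "prime p" "CARD('a) = p ^ k"
    and P: "prime_elem P" "P dvd D" and r: "prime_elem r" and D0: "D \<noteq> 0" and n: "n = P * (D * r)"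
    and S: "S = {hecke n m | m. lead_coeff m = 1 \<and> Q m}"
    and Q: "\<And>l. prime_elem l \<Longrightarrow> \<not> l dvd n \<Longrightarrow> Q l"
    and W: "W = (End_H0 n)\<lparr>carrier := generate_ring (End_H0 n) S\<rparr>"
    and I: "I = Idl\<^bsub>W\<^esub> (eisenstein_generators n)"
  shows "finite (carrier (W Quot I)) \<and> p dvd card (carrier (W Quot I))"
proof -
  have r0: "r \<noteq> 0" "degree r \<noteq> 0" using r unfolding prime_elem_def by (auto simp add: is_unit_iff_degree)
  have P0: "P \<noteq> 0" using P(1) by (simp add: prime_elem_def)
  have n0: "n \<noteq> 0" using r0 P0 D0 by (simp add: n)
  define R where "R = End_H0 n"
  interpret R: ring R unfolding R_def by (rule ring_End_H0)
  define T where "T = generate_ring R S"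
  have SR: "S \<subseteq> carrier R" unfolding S R_def using hecke_in_carrier[OF n0] by blast
  have subT: "subring T R" unfolding T_def using SR by (rule R.generate_ring_is_subring)
  have W': "W = R\<lparr>carrier := T\<rparr>" by (simp add: W R_def T_def)
  interpret W: ring W unfolding W' using subT by (rule R.subring_is_ring)
  have cW: "carrier W = T" by (simp add: W')
  have ops: "add W = add R" "monoid.mult W = monoid.mult R" "one W = one R" "zero W = zero R" by (simp_all add: W')
  have TR: "T \<subseteq> carrier R" using subT by (rule subringE(1))
  have ev: "\<phi> \<in> extensional (H0 n)" "f \<in> H0 n \<Longrightarrow> \<phi> f \<in> H0 n" if "\<phi> \<in> T" for \<phi> f
    using that TR by (auto simp add: R_def End_H0_carrier)
  have Tadd: "(\<lambda>f\<in>H0 n. \<lambda>e. \<phi> f e + \<psi> f e) \<in> T" if "\<phi> \<in> T" "\<psi> \<in> T" for \<phi> \<psi>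
    using subringE(7)[OF subT that] by (simp add: R_def End_H0_simps)
  have Tmult: "(\<lambda>f\<in>H0 n. \<phi> (\<psi> f)) \<in> T" if "\<phi> \<in> T" "\<psi> \<in> T" for \<phi> \<psi>
    using subringE(6)[OF subT that] by (simp add: R_def End_H0_simps)
  have Tneg: "(\<lambda>f\<in>H0 n. \<lambda>e. - \<phi> f e) \<in> T" if "\<phi> \<in> T" for \<phi>
    using subringE(5)[OF subT that] End_H0_a_inv[of \<phi> n] that TR by (auto simp add: R_def)
  have Tone: "(\<lambda>f\<in>H0 n. f) \<in> T" using subringE(3)[OF subT] by (simp add: R_def End_H0_simps)
  have Tzero: "(\<lambda>f\<in>H0 n. \<lambda>e. 0) \<in> T" using subringE(2)[OF subT] by (simp add: R_def End_H0_simps)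
  have Tnat: "(\<lambda>f\<in>H0 n. \<lambda>e. int j * \<phi> f e) \<in> T" if "\<phi> \<in> T" for \<phi> j
  proof (induction j)
    case (Suc j)
    have "(\<lambda>f\<in>H0 n. \<lambda>e. int (Suc j) * \<phi> f e) = (\<lambda>f\<in>H0 n. \<lambda>e. (\<lambda>f\<in>H0 n. \<lambda>e. int j * \<phi> f e) f e + \<phi> f e)"
      by (simp add: restrict_def fun_eq_iff algebra_simps)
    then show ?case by (rule ssubst) (rule Tadd[OF Suc that])
  qed (use Tzero in \<open>simp add: restrict_def\<close>)
  have Tint: "(\<lambda>f\<in>H0 n. \<lambda>e. c * \<phi> f e) \<in> T" if "\<phi> \<in> T" for \<phi> c
  proof (cases "0 \<le> c")
    case True
    then show ?thesis using Tnat[OF that, of "nat c"] by simp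
  next
    case False
    have "(\<lambda>f\<in>H0 n. \<lambda>e. c * \<phi> f e) = (\<lambda>f\<in>H0 n. \<lambda>e. - (\<lambda>f\<in>H0 n. \<lambda>e. int (nat (- c)) * \<phi> f e) f e)"
      using False by (simp add: restrict_def fun_eq_iff)
    then show ?thesis by (rule ssubst) (rule Tneg[OF Tnat[OF that]])
  qed
  have Tsum: "(\<lambda>f\<in>H0 n. \<lambda>e. \<Sum>b\<in>B. c b * \<Phi> b f e) \<in> T" if "finite B" "\<And>b. b \<in> B \<Longrightarrow> \<Phi> b \<in> T"
    for B :: "'b set" and c :: "'b \<Rightarrow> int" and \<Phi>
    using that
  proof (induction B rule: finite_induct)
    case (insert b B)
    have "(\<lambda>f\<in>H0 n. \<lambda>e. (\<lambda>f\<in>H0 n. \<lambda>e. c b * \<Phi> b f e) f e + (\<lambda>f\<in>H0 n. \<lambda>e. \<Sum>b\<in>B. c b * \<Phi> b f e) f e) \<in> T" (is "?x \<in> _")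
      using insert by (intro Tadd Tint) auto
    moreover have "?x = (\<lambda>f\<in>H0 n. \<lambda>e. \<Sum>b\<in>insert b B. c b * \<Phi> b f e)"
      using insert(1,2) by (simp add: restrict_def fun_eq_iff)
    ultimately show ?case by (simp only:)
  qed (use Tzero in \<open>simp add: restrict_def\<close>)
  have heckeT: "hecke n m \<in> T" if "lead_coeff m = 1" "Q m" for m
    unfolding T_def S using that by (intro generate_ring.incl) blast
  define eta where "eta = (\<lambda>l f e. hop n l f e - int (ideal_norm l + 1) * f e)"
  have eta: "restrict (eta l) (H0 n) \<in> T" if "lead_coeff l = 1" "Q l" for l
  proof -
    have "(\<lambda>f\<in>H0 n. \<lambda>e. hecke n l f e + (\<lambda>f\<in>H0 n. \<lambda>e. - int (ideal_norm l + 1) * (\<lambda>f\<in>H0 n. f) f e) f e) \<in> T" (is "?x \<in> _")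
      by (rule Tadd[OF heckeT[OF that] Tint[OF Tone]])
    moreover have "?x = restrict (eta l) (H0 n)" by (simp add: restrict_def fun_eq_iff eta_def hecke_eq algebra_simps)
    ultimately show ?thesis by (simp only:)
  qed
  have gens: "eisenstein_generators n = {restrict (eta l) (H0 n) | l. lead_coeff l = 1 \<and> prime_elem l \<and> \<not> l dvd n}"
  proof -
    have "hecke n l \<ominus>\<^bsub>End_H0 n\<^esub> [ideal_norm l] \<cdot>\<^bsub>End_H0 n\<^esub> \<one>\<^bsub>End_H0 n\<^esub> \<ominus>\<^bsub>End_H0 n\<^esub> \<one>\<^bsub>End_H0 n\<^esub> = restrict (eta l) (H0 n)"
      if l: "lead_coeff l = 1" "prime_elem l" "\<not> l dvd n" for l
    proof (rule End_H0_eqI)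
      interpret E: ring "End_H0 n" by (rule ring_End_H0)
      have h: "hecke n l \<in> carrier (End_H0 n)" using n0 l(1) by (rule hecke_in_carrier)
      then show "hecke n l \<ominus>\<^bsub>End_H0 n\<^esub> [ideal_norm l] \<cdot>\<^bsub>End_H0 n\<^esub> \<one>\<^bsub>End_H0 n\<^esub> \<ominus>\<^bsub>End_H0 n\<^esub> \<one>\<^bsub>End_H0 n\<^esub> \<in> carrier (End_H0 n)"
        by simp
      show "restrict (eta l) (H0 n) \<in> carrier (End_H0 n)" using eta[OF l(1) Q[OF l(2,3)]] TR by (auto simp add: R_def)
      show "(hecke n l \<ominus>\<^bsub>End_H0 n\<^esub> [ideal_norm l] \<cdot>\<^bsub>End_H0 n\<^esub> \<one>\<^bsub>End_H0 n\<^esub> \<ominus>\<^bsub>End_H0 n\<^esub> \<one>\<^bsub>End_H0 n\<^esub>) f e = restrict (eta l) (H0 n) f e"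
        if "f \<in> H0 n" for f e
        using eisenstein_generator_eq[OF h that] that by (simp add: eta_def)
    qed
    then show ?thesis unfolding eisenstein_generators_def by (intro Collect_cong) metis
  qed
  have gT: "eisenstein_generators n \<subseteq> carrier W" unfolding gens cW using eta Q by blast
  interpret I: ideal I W unfolding I using gT by (rule W.genideal_ideal)
  have gI: "eisenstein_generators n \<subseteq> I" unfolding I using gT by (rule W.genideal_self)
  have Imult: "(\<lambda>f\<in>H0 n. \<phi> (\<psi> f)) \<in> I" if "\<phi> \<in> I" "\<psi> \<in> T" for \<phi> \<psi>
    using I.I_r_closed[OF that(1), of \<psi>] that(2) by (simp add: cW ops) (simp add: R_def End_H0_simps)
  have a_minus_W: "a_minus W \<phi> \<psi> = (\<lambda>f\<in>H0 n. \<lambda>e. \<phi> f e - \<psi> f e)" if "\<phi> \<in> T" "\<psi> \<in> T" for \<phi> \<psi>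
  proof -
    have "a_inv W \<psi> = (\<lambda>f\<in>H0 n. \<lambda>e. - \<psi> f e)"
    proof (rule W.minus_equality)
      show "(\<lambda>f\<in>H0 n. \<lambda>e. - \<psi> f e) \<oplus>\<^bsub>W\<^esub> \<psi> = zero W"
        unfolding ops by (simp add: R_def End_H0_simps restrict_def fun_eq_iff)
    qed (use that Tneg in \<open>simp_all add: cW\<close>)
    then show ?thesis unfolding a_minus_def ops by (simp add: R_def End_H0_simps restrict_def fun_eq_iff)
  qed
  have fn: "(\<lambda>f\<in>H0 n. \<lambda>e. c * f e) \<in> T" for c
  proof -
    have "(\<lambda>f\<in>H0 n. \<lambda>e. c * (\<lambda>f\<in>H0 n. f) f e) = (\<lambda>f\<in>H0 n. \<lambda>e. c * f e)" by (simp add: restrict_def fun_eq_iff)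
    then show ?thesis using Tint[OF Tone, of c] by simp
  qed

  obtain e1 where e1: "e1 \<in> tree_edges" "\<bar>Gv D (D * r) (snd e1) - Gv D (D * r) (fst e1)\<bar> = 1"
    using Gv_nonconstant[OF D0 r0(2)] by blast
  have pq: "int p dvd int CARD('a)"
  proof -
    have "card {0, 1 :: 'a} \<le> CARD('a)" by (rule card_mono) auto
    then have "k \<noteq> 0" using p(2) by (cases k) auto
    then show ?thesis by (simp add: p(2))
  qed
  define dG where "dG = (\<lambda>e. Gv D (D * r) (snd e) - Gv D (D * r) (fst e))"
  have Dn: "D dvd n" "D * r dvd n" "P * D dvd n" "P * (D * r) dvd n" "P ^ 2 dvd n"
    using P(2) unfolding n by (auto simp add: power2_eq_square dvd_mult mult_dvd_mono dvd_mult2 mult.assoc[symmetric])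
  obtain M f0 where f0: "coprime M (int p)" "f0 \<in> H0 n" "\<And>e. e \<in> tree_edges \<Longrightarrow> int p dvd f0 e - M * dG e"
  proof (rule gradient_lift[OF p n0, of "Gv D (D * r)"])
    show "Gv D (D * r) (act_vertex g v) = Gv D (D * r) v" if "g \<in> Gamma0 n" "v \<in> tree_vertices" for g v
      using that(1) Dn(1,2) that(2) by (rule Gv_act)
    show "int p dvd (\<Sum>e | e \<in> tree_edges \<and> snd e = v. Gv D (D * r) (snd e) - Gv D (D * r) (fst e))"
      if "v \<in> tree_vertices" for v
      using pq Gv_harmonic[OF that] by (rule dvd_trans)
    show "Gv D (D * r) w = Gv D (D * r) v"
      if "g \<in> Gamma0 n" "unipotent g" "act_vertex g v = v" "(v, w) \<in> tree_edges" for g v w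
      using P(1) Dn(5) P(2) Dn(3) dvd_mult2[OF P(2)] Dn(4) that by (rule Gv_unipotent)
  qed (use that in \<open>auto simp add: dG_def\<close>)
  define V where "V = {f \<in> H0 n. \<exists>c. \<forall>e \<in> tree_edges. int p dvd f e - c * dG e}"
  have f0V: "f0 \<in> V" unfolding V_def using f0(2,3) by blast
  have hopV: "\<exists>c'. \<forall>e \<in> tree_edges. int p dvd hop n m f e - c' * dG e \<and> (prime_elem m \<and> \<not> m dvd n \<longrightarrow> c' = c)"
    if f: "\<forall>e \<in> tree_edges. int p dvd f e - c * dG e" and m: "lead_coeff m = 1" for f c m
  proof -
    define lam :: int where "lam = (if coprime m D then 1 else 0)"
    have m0: "m \<noteq> 0" using m by auto
    have "int p dvd hop n m f e - (c * lam) * dG e" if e: "e \<in> tree_edges" for e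
    proof -
      have "int p dvd (\<Sum>x \<in> hecke_index n m. f (act_edge (hmat x) e) - c * dG (act_edge (hmat x) e))"
      proof (rule dvd_sum)
        fix x assume "x \<in> hecke_index n m"
        then have "det (hmat x) \<noteq> 0" using hecke_index_det m0 by metis
        then have "act_edge (hmat x) e \<in> tree_edges" by (rule act_edge_in_tree[OF _ e])
        then show "int p dvd f (act_edge (hmat x) e) - c * dG (act_edge (hmat x) e)" using f by blast
      qed
      then have a: "int p dvd hop n m f e - c * (\<Sum>x \<in> hecke_index n m. dG (act_edge (hmat x) e))"
        by (simp add: hop_def sum_subtractf sum_distrib_left)
      have "int p dvd (\<Sum>x \<in> hecke_index n m. dG (act_edge (hmat x) e)) - lam * dG e"
        unfolding dG_def lam_def using pq hop_gradient[OF e m r n P(2)] by (rule dvd_trans)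
      then have b: "int p dvd c * ((\<Sum>x \<in> hecke_index n m. dG (act_edge (hmat x) e)) - lam * dG e)" by (rule dvd_mult)
      have "hop n m f e - c * (\<Sum>x \<in> hecke_index n m. dG (act_edge (hmat x) e)) +
          c * ((\<Sum>x \<in> hecke_index n m. dG (act_edge (hmat x) e)) - lam * dG e) = hop n m f e - (c * lam) * dG e"
        by (simp add: algebra_simps)
      with dvd_add[OF a b] show ?thesis by simp
    qed
    moreover have "c * lam = c" if l: "prime_elem m" "\<not> m dvd n"
    proof -
      have "coprime m D"
      proof (rule coprimeI)
        fix j assume j: "j dvd m" "j dvd D"
        then obtain i where i: "m = j * i" by (auto elim: dvdE)
        then have "m dvd j \<or> m dvd i" using l(1) by (metis dvd_refl prime_elem_dvd_multD)
        moreover have "\<not> m dvd j" using j(2) Dn(1) l(2) dvd_trans by blast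
        ultimately obtain i' where i': "i = m * i'" by (auto elim: dvdE)
        have "m * (j * i') = j * (m * i')" by (simp add: ac_simps)
        also have "\<dots> = m * 1" by (simp only: i'[symmetric] i[symmetric] mult_1_right)
        finally have "j * i' = 1" using m0 by (metis mult_left_cancel)
        then show "is_unit j" by (metis dvdI)
      qed
      then show ?thesis by (simp add: lam_def)
    qed
    ultimately show ?thesis by (intro exI[of _ "c * lam"]) blast
  qed
  have TV: "\<phi> f \<in> V" if "\<phi> \<in> T" "f \<in> V" for \<phi> f
    using that unfolding T_def
  proof (induction \<phi> arbitrary: f rule: generate_ring.induct)
    case one
    then show ?case by (simp add: R_def End_H0_simps V_def)
  next
    case (incl h)
    then obtain m where m: "h = hecke n m" "lead_coeff m = 1" unfolding S by blast
    obtain c where c: "f \<in> H0 n" "\<forall>e \<in> tree_edges. int p dvd f e - c * dG e" using incl.prems by (auto simp add: V_def)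
    have "h f = hop n m f" using c(1) by (simp add: m(1) hecke_eq)
    then show ?case unfolding V_def using hopV[OF c(2) m(2)] hop_H0[OF n0 c(1) m(2)] by auto
  next
    case (a_inv h)
    have h: "h \<in> carrier (End_H0 n)" using a_inv.hyps TR by (auto simp add: T_def R_def)
    have fH: "f \<in> H0 n" using a_inv.prems by (simp add: V_def)
    obtain c where c: "h f \<in> H0 n" "\<forall>e \<in> tree_edges. int p dvd h f e - c * dG e" using a_inv.IH[OF a_inv.prems] by (auto simp add: V_def)
    have *: "\<forall>e \<in> tree_edges. int p dvd - h f e - (- c) * dG e"
    proof
      fix e :: "'a tree_edge" assume "e \<in> tree_edges"
      then have "int p dvd h f e - c * dG e" using c(2) by blast
      then have "int p dvd - (h f e - c * dG e)" by (simp only: dvd_minus_iff)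
      then show "int p dvd - h f e - (- c) * dG e" by (simp add: algebra_simps)
    qed
    have "(\<lambda>e. - h f e) \<in> V" unfolding V_def using H0_uminus[OF c(1)] * by blast
    then show ?case using fH by (simp add: R_def End_H0_a_inv[OF h])
  next
    case (eng_add h1 h2)
    have fH: "f \<in> H0 n" using eng_add.prems by (simp add: V_def)
    obtain c where c: "h1 f \<in> H0 n" "\<forall>e \<in> tree_edges. int p dvd h1 f e - c * dG e" using eng_add.IH(1)[OF eng_add.prems] by (auto simp add: V_def)
    obtain d where d: "h2 f \<in> H0 n" "\<forall>e \<in> tree_edges. int p dvd h2 f e - d * dG e" using eng_add.IH(2)[OF eng_add.prems] by (auto simp add: V_def)
    have "\<forall>e \<in> tree_edges. int p dvd (h1 f e + h2 f e) - (c + d) * dG e"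
    proof
      fix e :: "'a tree_edge" assume "e \<in> tree_edges"
      then have "int p dvd (h1 f e - c * dG e) + (h2 f e - d * dG e)" using c(2) d(2) by (intro dvd_add) auto
      then show "int p dvd (h1 f e + h2 f e) - (c + d) * dG e" by (simp add: algebra_simps)
    qed
    then show ?case unfolding V_def using fH H0_add[OF c(1) d(1)] by (auto simp add: R_def End_H0_simps)
  next
    case (eng_mult h1 h2)
    have fH: "f \<in> H0 n" using eng_mult.prems by (simp add: V_def)
    have "h1 (h2 f) \<in> V" by (rule eng_mult.IH(1)[OF eng_mult.IH(2)[OF eng_mult.prems]])
    then show ?case using fH by (simp add: R_def End_H0_simps)
  qed
  define J where "J = {\<phi> \<in> T. \<forall>f \<in> V. \<forall>e. int p dvd \<phi> f e}"
  have VH: "V \<subseteq> H0 n" by (auto simp add: V_def)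
  have J: "ideal J W"
  proof (rule idealI)
    show "ring W" by (rule W.ring_axioms)
    have JV: "int p dvd \<phi> f e" if "\<phi> \<in> J" "f \<in> V" for \<phi> f e
      using that unfolding J_def by blast
    show "subgroup J (add_monoid W)"
    proof (rule W.add.subgroupI)
      show "J \<subseteq> carrier W" by (auto simp add: J_def cW)
      have "(\<lambda>f\<in>H0 n. \<lambda>e. 0) \<in> J" using Tzero VH by (auto simp add: J_def)
      then show "J \<noteq> {}" by blast
      show "\<ominus>\<^bsub>W\<^esub> \<phi> \<in> J" if "\<phi> \<in> J" for \<phi>
      proof -
        have \<phi>: "\<phi> \<in> T" using that by (simp add: J_def)
        have "a_inv W \<phi> = (\<lambda>f\<in>H0 n. \<lambda>e. - \<phi> f e)"
        proof (rule W.minus_equality)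
          show "(\<lambda>f\<in>H0 n. \<lambda>e. - \<phi> f e) \<oplus>\<^bsub>W\<^esub> \<phi> = zero W"
            unfolding ops by (simp add: R_def End_H0_simps restrict_def fun_eq_iff)
        qed (use \<phi> Tneg in \<open>simp_all add: cW\<close>)
        then show ?thesis using Tneg[OF \<phi>] JV[OF that] VH by (auto simp add: J_def)
      qed
      show "\<phi> \<oplus>\<^bsub>W\<^esub> \<psi> \<in> J" if "\<phi> \<in> J" "\<psi> \<in> J" for \<phi> \<psi>
      proof -
        have "\<phi> \<in> T" "\<psi> \<in> T" using that by (simp_all add: J_def)
        from Tadd[OF this] show ?thesis
          using JV[OF that(1)] JV[OF that(2)] VH unfolding ops
          by (auto simp add: J_def R_def End_H0_simps intro!: dvd_add)
      qed
    qed
    fix \<phi> \<psi> assume \<phi>: "\<phi> \<in> J" and \<psi>: "\<psi> \<in> carrier W"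
    have T: "\<phi> \<in> T" "\<psi> \<in> T" using \<phi> \<psi> by (simp_all add: J_def cW)
    show "\<psi> \<otimes>\<^bsub>W\<^esub> \<phi> \<in> J"
    proof -
      have "int p dvd \<psi> (\<phi> f) e" if f: "f \<in> V" for f e
      proof -
        define g where "g = (\<lambda>e. \<phi> f e div int p)"
        have e: "\<phi> f = (\<lambda>e. int p * g e)" unfolding g_def using JV[OF \<phi> f] by (intro ext) simp
        have "\<phi> f \<in> H0 n" using ev(2)[OF T(1)] f VH by blast
        then have "g \<in> H0 n"
        proof -
          assume h: "\<phi> f \<in> H0 n"
          have p0: "int p \<noteq> 0" using p(1) by auto
          have *: "{e \<in> tree_edges. g e \<noteq> 0} = {e \<in> tree_edges. \<phi> f e \<noteq> 0}" using p0 by (simp add: e)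
          have "g (prod.swap e) = - g e" if "e \<in> tree_edges" for e
          proof -
            have "\<phi> f (prod.swap e) = - \<phi> f e" using h that unfolding H0_iff flow_def by blast
            then have "int p * g (prod.swap e) = int p * (- g e)" unfolding e by (simp only: mult_minus_right)
            then show ?thesis by (simp only: mult_left_cancel[OF p0])
          qed
          then show ?thesis
            using h p0 unfolding H0_iff flow_def * by (simp add: e divg_scale)
        qed
        then have "\<psi> (\<phi> f) = (\<lambda>e. int p * \<psi> g e)"
          unfolding e using End_H0_linear(2)[of \<psi> n g "int p"] T(2) TR by (auto simp add: R_def)
        then show ?thesis by simp
      qed
      then show ?thesis using Tmult[OF T(2,1)] VH unfolding ops by (auto simp add: J_def R_def End_H0_simps)
    qed
    show "\<phi> \<otimes>\<^bsub>W\<^esub> \<psi> \<in> J"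
      using Tmult[OF T] VH JV[OF \<phi> TV[OF T(2)]] unfolding ops by (auto simp add: J_def R_def End_H0_simps)
  qed
  have "eisenstein_generators n \<subseteq> J"
  proof
    fix x assume "x \<in> eisenstein_generators n"
    then obtain l where l: "x = restrict (eta l) (H0 n)" "lead_coeff l = 1" "prime_elem l" "\<not> l dvd n" unfolding gens by blast
    have "int p dvd eta l f e" if f: "f \<in> V" for f e
    proof (cases "e \<in> tree_edges")
      case True
      obtain c where c: "f \<in> H0 n" "\<forall>e \<in> tree_edges. int p dvd f e - c * dG e" using f by (auto simp add: V_def)
      have x: "int p dvd hop n l f e - c * dG e" using hopV[OF c(2) l(2)] l(3,4) True by blast
      have y: "int p dvd f e - c * dG e" using c(2) True by blast
      from dvd_diff[OF x y] have a: "int p dvd hop n l f e - f e" by simp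
      have l0: "l \<noteq> 0" "degree l \<noteq> 0" using l(3) unfolding prime_elem_def by (auto simp add: is_unit_iff_degree)
      have "int CARD('a) dvd int (ideal_norm l)"
      proof -
        have "{b \<in> residues_set l. l dvd 0 + b * 0} = residues_set l" by simp
        moreover have "\<not> coprime l 0" using l(3) unfolding prime_elem_def coprime_def by (metis dvd_0_right dvd_refl)
        ultimately show ?thesis using card_residues_dvd[OF l0(1), of 0 0] ideal_norm_eq[OF l0(1)] by simp
      qed
      then have "int p dvd int (ideal_norm l) * f e" using pq dvd_trans dvd_mult2 by blast
      with a have "int p dvd (hop n l f e - f e) - int (ideal_norm l) * f e" by (rule dvd_diff)
      then show ?thesis by (simp add: eta_def algebra_simps)
    next
      case False
      have fH: "f \<in> H0 n" using f by (simp add: V_def)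
      then have "f e = 0" "hop n l f e = 0"
        using False hop_H0[OF n0 fH l(2)] unfolding H0_iff flow_def by blast+
      then show ?thesis by (simp add: eta_def)
    qed
    then show "x \<in> J" using eta[OF l(2) Q[OF l(3,4)]] VH by (auto simp add: J_def l(1))
  qed
  then have IJ: "I \<subseteq> J" unfolding I using J by (intro W.genideal_minimal)

  obtain l where l: "lead_coeff l = 1" "prime_elem l" "\<not> l dvd n"
  proof -
    have "degree (1 + pCons 0 n) > 0" using n0 by (simp add: degree_add_eq_right)
    then obtain l where l: "lead_coeff l = 1" "prime_elem l" "l dvd 1 + pCons 0 n" by (rule poly_prime_divisor)
    have "\<not> l dvd n"
    proof
      assume "l dvd n"
      then have "l dvd [:0, 1:] * n" by (rule dvd_mult)
      then have "l dvd pCons 0 n" by simp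
      then have "l dvd 1" using l(3) by (metis dvd_add_left_iff)
      then show False using l(2) by (simp add: prime_elem_def)
    qed
    with l that show ?thesis by blast
  qed
  have etaH: "eta l f \<in> H0 n" if "f \<in> H0 n" for f
    using ev(2)[OF eta[OF l(1) Q[OF l(2,3)]] that] that by simp
  have eta_inj: "f = (\<lambda>e. 0)" if f: "f \<in> H0 n" "eta l f = (\<lambda>e. 0)" for f
  proof
    fix e
    have "hop n l f e = int (ideal_norm l + 1) * f e" for e using fun_cong[OF f(2), of e] by (simp add: eta_def)
    then show "f e = 0" using eisenstein_operator_injective[OF l n0 f(1)] by blast
  qed
  define pows where "pows = (\<lambda>i f. (eta l ^^ i) f)"
  have powsH: "pows i f \<in> H0 n" if "f \<in> H0 n" for i f
    unfolding pows_def using that by (induction i) (auto intro: etaH)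
  have powsT: "restrict (pows i) (H0 n) \<in> T" for i
  proof (induction i)
    case (Suc i)
    have "(\<lambda>f\<in>H0 n. restrict (eta l) (H0 n) (restrict (pows i) (H0 n) f)) \<in> T" (is "?x \<in> _")
      by (rule Tmult[OF eta[OF l(1) Q[OF l(2,3)]] Suc.IH])
    moreover have "?x = restrict (pows (Suc i)) (H0 n)"
      using powsH by (intro ext) (simp add: restrict_def pows_def)
    ultimately show ?case by (simp only:)
  qed (use Tone in \<open>simp add: pows_def restrict_def\<close>)
  obtain R0 where R0: "finite R0" "\<And>f. f \<in> H0 n \<Longrightarrow> (\<forall>e\<in>R0. f e = 0) \<Longrightarrow> f = (\<lambda>e. 0)"
    using n0 by (rule H0_determined) blast
  have "\<exists>B. finite B \<and> B \<subseteq> H0 n \<and> (\<forall>f\<in>H0 n. \<exists>c. f = (\<lambda>y. \<Sum>b\<in>B. c b * b y))"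
    by (rule subgroup_finitely_generated[OF R0(1)]) (use R0(2) H0_zero H0_diff in auto)
  then obtain B0 where B0: "finite B0" "B0 \<subseteq> H0 n" "\<forall>f\<in>H0 n. \<exists>c. f = (\<lambda>y. \<Sum>b\<in>B0. c b * b y)" by blast
  define evl where "evl = (\<lambda>\<phi> :: 'a cochain \<Rightarrow> 'a cochain. \<lambda>(f, e). if f \<in> H0 n then \<phi> f e else 0)"
  have Tdet: "evl \<phi> = (\<lambda>y. 0)" if \<phi>: "\<phi> \<in> T" "\<forall>j \<in> B0 \<times> R0. evl \<phi> j = 0" for \<phi>
  proof
    fix y :: "'a cochain \<times> 'a tree_edge"
    obtain f e where y: "y = (f, e)" by (cases y) auto
    have z: "\<phi> b = (\<lambda>e. 0)" if b: "b \<in> B0" for b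
    proof (rule R0(2))
      have bH: "b \<in> H0 n" using b B0(2) by blast
      then show "\<phi> b \<in> H0 n" by (rule ev(2)[OF \<phi>(1)])
      show "\<forall>e\<in>R0. \<phi> b e = 0"
      proof
        fix e assume "e \<in> R0"
        then have "evl \<phi> (b, e) = 0" using \<phi>(2) b by blast
        then show "\<phi> b e = 0" using bH by (simp add: evl_def)
      qed
    qed
    have "\<phi> f = (\<lambda>e. 0)" if f: "f \<in> H0 n"
    proof -
      obtain c where c: "f = (\<lambda>y. \<Sum>b\<in>B0. c b * b y)" using B0(3) f by blast
      have "\<phi> f = (\<lambda>e. \<Sum>b\<in>B0. c b * \<phi> b e)"
        unfolding c using \<phi>(1) TR B0(2) by (intro End_H0_sum) (auto simp add: R_def)
      also have "\<dots> = (\<lambda>e. 0)" using z by (intro ext sum.neutral) simp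
      finally show ?thesis .
    qed
    then show "evl \<phi> y = 0" by (simp add: y evl_def)
  qed
  have finJ: "finite (B0 \<times> R0)" using B0(1) R0(1) by simp
  have "\<exists>K c. evl (pows K) = (\<lambda>y. \<Sum>i<K. c i * evl (pows i) y)"
  proof (rule integral_relation[OF finJ])
    fix c :: "nat \<Rightarrow> int" and j :: nat
    assume z: "\<forall>y\<in>B0 \<times> R0. (\<Sum>i<j. c i * evl (pows i) y) = 0"
    define \<phi> where "\<phi> = (\<lambda>f\<in>H0 n. \<lambda>e. \<Sum>i<j. c i * restrict (pows i) (H0 n) f e)"
    have \<phi>T: "\<phi> \<in> T" unfolding \<phi>_def by (rule Tsum) (rule finite_lessThan finite_atMost powsT)+
    have e: "evl \<phi> = (\<lambda>y. \<Sum>i<j. c i * evl (pows i) y)" by (auto simp add: evl_def \<phi>_def fun_eq_iff)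
    show "(\<lambda>y. \<Sum>i<j. c i * evl (pows i) y) = (\<lambda>y. 0)"
      using Tdet[OF \<phi>T] z unfolding e by blast
  qed
  then obtain K c0 where K: "evl (pows K) = (\<lambda>y. \<Sum>i<K. c0 i * evl (pows i) y)" by blast
  define c where "c = (\<lambda>i. if i = K then - 1 else c0 i)"
  have rel: "(\<Sum>i\<le>K. c i * pows i f e) = 0" if f: "f \<in> H0 n" for f e
  proof -
    have "(\<Sum>i\<le>K. c i * pows i f e) = (\<Sum>i<K. c0 i * pows i f e) - pows K f e"
      by (simp add: c_def lessThan_Suc_atMost[symmetric])
    also have "pows K f e = (\<Sum>i<K. c0 i * pows i f e)" using fun_cong[OF K, of "(f, e)"] f by (simp add: evl_def)
    finally show ?thesis by simp
  qed
  define j where "j = (LEAST i. c i \<noteq> 0)"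
  have cj: "c j \<noteq> 0" and jK: "j \<le> K" and cmin: "\<And>i. i < j \<Longrightarrow> c i = 0"
    unfolding j_def by (rule LeastI[of _ K], simp add: c_def) (rule Least_le, simp add: c_def, use not_less_Least in blast)
  have etalin: "(eta l ^^ i) (\<lambda>e. \<Sum>a\<in>A. d a * F a e) = (\<lambda>e. \<Sum>a\<in>A. d a * (eta l ^^ i) (F a) e)"
    for i and A :: "nat set" and d F
  proof (induction i)
    case (Suc i)
    have "eta l (\<lambda>e. \<Sum>a\<in>A. d a * G a e) = (\<lambda>e. \<Sum>a\<in>A. d a * eta l (G a) e)" for G
    proof
      fix e
      have "hop n l (\<lambda>e. \<Sum>a\<in>A. d a * G a e) e = (\<Sum>a\<in>A. d a * hop n l (G a) e)"
        unfolding hop_def by (subst sum.swap) (simp add: sum_distrib_left)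
      then show "eta l (\<lambda>e. \<Sum>a\<in>A. d a * G a e) e = (\<Sum>a\<in>A. d a * eta l (G a) e)"
        by (simp add: eta_def right_diff_distrib sum_subtractf sum_distrib_left mult.left_commute)
    qed
    then show ?case by (simp add: Suc.IH)
  qed simp
  define \<psi> where "\<psi> = (\<lambda>f\<in>H0 n. \<lambda>e. \<Sum>i\<in>{..<K - j}. - c (Suc (i + j)) * restrict (pows i) (H0 n) f e)"
  have \<psi>T: "\<psi> \<in> T" unfolding \<psi>_def by (rule Tsum) (rule finite_lessThan finite_atMost powsT)+
  have key: "eta l (\<psi> f) = (\<lambda>e. c j * f e)" if f: "f \<in> H0 n" for f
  proof -
    define g where "g = (\<lambda>e. \<Sum>i\<in>{..K - j}. c (i + j) * pows i f e)"
    have gH: "g \<in> H0 n"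
    proof -
      have "(\<lambda>f\<in>H0 n. \<lambda>e. \<Sum>i\<in>{..K - j}. c (i + j) * restrict (pows i) (H0 n) f e) \<in> T" by (rule Tsum) (rule finite_lessThan finite_atMost powsT)+
      from ev(2)[OF this f] show ?thesis using f by (simp add: g_def)
    qed
    have "(eta l ^^ j) g = (\<lambda>e. 0)"
    proof
      fix e
      have "(eta l ^^ j) g e = (\<Sum>i\<in>{..K - j}. c (i + j) * pows (i + j) f e)"
        unfolding g_def etalin pows_def by (simp add: funpow_add add.commute[of _ j])
      also have "\<dots> = (\<Sum>i\<in>{j..K}. c i * pows i f e)"
        by (rule sum.reindex_bij_witness[of _ "\<lambda>i. i - j" "\<lambda>i. i + j"]) (use jK in auto)
      also have "\<dots> = (\<Sum>i\<le>K. c i * pows i f e)"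
        by (rule sum.mono_neutral_left) (use cmin in auto)
      finally show "(eta l ^^ j) g e = 0" using rel[OF f] by simp
    qed
    moreover have "g = (\<lambda>e. 0)" if "(eta l ^^ i) g = (\<lambda>e. 0)" for i
      using that
    proof (induction i)
      case (Suc i)
      have "(eta l ^^ i) g \<in> H0 n" using powsH[OF gH, of i] by (simp add: pows_def)
      then have "(eta l ^^ i) g = (\<lambda>e. 0)" by (rule eta_inj) (use Suc.prems in simp)
      then show ?case by (rule Suc.IH)
    qed simp
    ultimately have g0: "g = (\<lambda>e. 0)" by blast
    show ?thesis
    proof
      fix e
      have \<psi>f: "\<psi> f = (\<lambda>e. \<Sum>i\<in>{..<K - j}. - c (Suc (i + j)) * pows i f e)" using f by (simp add: \<psi>_def)
      have "eta l (\<psi> f) = (\<lambda>e. \<Sum>i\<in>{..<K - j}. - c (Suc (i + j)) * pows (Suc i) f e)"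
        using etalin[of 1 "\<lambda>i. - c (Suc (i + j))" "\<lambda>i. pows i f" "{..<K - j}"] unfolding \<psi>f by (simp add: pows_def)
      then have "eta l (\<psi> f) e = - (\<Sum>i\<in>{..<K - j}. c (Suc i + j) * pows (Suc i) f e)" by (simp add: sum_negf)
      also have "(\<Sum>i\<in>{..<K - j}. c (Suc i + j) * pows (Suc i) f e) = g e - c j * f e"
        unfolding g_def lessThan_Suc_atMost[symmetric] sum.lessThan_Suc_shift by (simp add: pows_def)
      finally show "eta l (\<psi> f) e = c j * f e" by (simp add: g0)
    qed
  qed
  define N where "N = c j"
  have NI: "(\<lambda>f\<in>H0 n. \<lambda>e. N * f e) \<in> I"
  proof -
    have "restrict (eta l) (H0 n) \<in> I" using gI l unfolding gens by blast
    from Imult[OF this \<psi>T] have "(\<lambda>f\<in>H0 n. restrict (eta l) (H0 n) (\<psi> f)) \<in> I" (is "?x \<in> _") .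
    moreover have "?x = (\<lambda>f\<in>H0 n. \<lambda>e. N * f e)"
      using ev(2)[OF \<psi>T] key by (intro ext) (simp add: restrict_def N_def)
    ultimately show ?thesis by (simp only:)
  qed
  have "\<exists>B. finite B \<and> B \<subseteq> evl ` T \<and> (\<forall>f\<in>evl ` T. \<exists>c. f = (\<lambda>y. \<Sum>b\<in>B. c b * b y))"
  proof (rule subgroup_finitely_generated[OF finJ])
    show "(\<lambda>y. 0) \<in> evl ` T" by (rule image_eqI[OF _ Tzero]) (auto simp add: evl_def fun_eq_iff)
    show "(\<lambda>y. f y - g y) \<in> evl ` T" if fg: "f \<in> evl ` T" "g \<in> evl ` T" for f g
    proof -
      obtain \<phi> \<psi> where "\<phi> \<in> T" "\<psi> \<in> T" "f = evl \<phi>" "g = evl \<psi>" using fg by blast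
      then show ?thesis
        by (intro image_eqI[OF _ Tadd[OF \<open>\<phi> \<in> T\<close> Tneg[OF \<open>\<psi> \<in> T\<close>]]]) (auto simp add: evl_def fun_eq_iff)
    qed
    show "f = (\<lambda>y. 0)" if "f \<in> evl ` T" "\<forall>j\<in>B0 \<times> R0. f j = 0" for f using that Tdet by blast
  qed
  then obtain B where B: "finite B" "B \<subseteq> evl ` T" "\<forall>f\<in>evl ` T. \<exists>c. f = (\<lambda>y. \<Sum>b\<in>B. c b * b y)" by blast
  have "\<forall>b\<in>B. \<exists>\<phi>. \<phi> \<in> T \<and> b = evl \<phi>" using B(2) by blast
  then obtain \<Phi> where \<Phi>: "\<And>b. b \<in> B \<Longrightarrow> \<Phi> b \<in> T" "\<And>b. b \<in> B \<Longrightarrow> b = evl (\<Phi> b)" by metis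
  define comb where "comb = (\<lambda>d. \<lambda>f\<in>H0 n. \<lambda>e. \<Sum>b\<in>B. d b * \<Phi> b f e)"
  have combT: "comb d \<in> T" for d unfolding comb_def by (rule Tsum[OF B(1) \<Phi>(1)])
  have cQ: "carrier (W Quot I) = (\<lambda>x. I +>\<^bsub>W\<^esub> x) ` T"
    by (auto simp add: FactRing_def A_RCOSETS_def' cW)
  have fin: "finite (carrier (W Quot I))"
  proof (rule finite_subset)
    let ?F = "B \<rightarrow>\<^sub>E {0..<\<bar>N\<bar>}"
    show "finite ((\<lambda>d. I +>\<^bsub>W\<^esub> comb d) ` ?F)" using B(1) by (intro finite_imageI finite_PiE) auto
    show "carrier (W Quot I) \<subseteq> (\<lambda>d. I +>\<^bsub>W\<^esub> comb d) ` ?F"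
    proof
      fix X assume "X \<in> carrier (W Quot I)"
      then obtain x where x: "x \<in> T" "X = I +>\<^bsub>W\<^esub> x" unfolding cQ by blast
      obtain d where d: "evl x = (\<lambda>y. \<Sum>b\<in>B. d b * b y)" using B(3) x(1) by blast
      have xe: "x f e = (\<Sum>b\<in>B. d b * \<Phi> b f e)" if "f \<in> H0 n" for f e
      proof -
        have "x f e = (\<Sum>b\<in>B. d b * b (f, e))" using fun_cong[OF d, of "(f, e)"] that by (simp add: evl_def)
        also have "\<dots> = (\<Sum>b\<in>B. d b * \<Phi> b f e)"
        proof (rule sum.cong[OF refl])
          fix b assume b: "b \<in> B"
          have "b (f, e) = \<Phi> b f e" using fun_cong[OF \<Phi>(2)[OF b], of "(f, e)"] that by (simp add: evl_def)
          then show "d b * b (f, e) = d b * \<Phi> b f e" by simp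
        qed
        finally show ?thesis .
      qed
      have N0: "\<bar>N\<bar> > 0" using cj by (simp add: N_def)
      define d' where "d' = (\<lambda>b\<in>B. d b mod \<bar>N\<bar>)"
      have d'F: "d' \<in> ?F" using N0 by (auto simp add: d'_def)
      define z where "z = comb (\<lambda>b. sgn N * (d b div \<bar>N\<bar>))"
      have zT: "z \<in> T" unfolding z_def by (rule combT)
      have "a_minus W x (comb d') = (\<lambda>f\<in>H0 n. (\<lambda>f\<in>H0 n. \<lambda>e. N * f e) (z f))"
        unfolding a_minus_W[OF x(1) combT]
      proof (rule ext)
        fix f
        show "(\<lambda>f\<in>H0 n. \<lambda>e. x f e - comb d' f e) f = (\<lambda>f\<in>H0 n. (\<lambda>f\<in>H0 n. \<lambda>e. N * f e) (z f)) f"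
        proof (cases "f \<in> H0 n")
          case True
          have "x f e - comb d' f e = N * z f e" for e
          proof -
            have "x f e - comb d' f e = (\<Sum>b\<in>B. (d b - d b mod \<bar>N\<bar>) * \<Phi> b f e)"
              unfolding xe[OF True] using True by (simp add: comb_def d'_def left_diff_distrib sum_subtractf)
            also have "\<dots> = (\<Sum>b\<in>B. N * (sgn N * (d b div \<bar>N\<bar>) * \<Phi> b f e))"
            proof (rule sum.cong[OF refl])
              fix b
              have "d b - d b mod \<bar>N\<bar> = \<bar>N\<bar> * (d b div \<bar>N\<bar>)" by (rule minus_mod_eq_mult_div)
              also have "\<bar>N\<bar> = N * sgn N" by (rule abs_sgn)
              finally show "(d b - d b mod \<bar>N\<bar>) * \<Phi> b f e = N * (sgn N * (d b div \<bar>N\<bar>) * \<Phi> b f e)"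
                by (simp add: abs_sgn mult.assoc)
            qed
            also have "\<dots> = N * z f e" using True by (simp add: z_def comb_def sum_distrib_left)
            finally show ?thesis .
          qed
          then show ?thesis using True ev(2)[OF zT True] by simp
        qed simp
      qed
      also have "\<dots> \<in> I" by (rule Imult[OF NI zT])
      finally have "I +>\<^bsub>W\<^esub> x = I +>\<^bsub>W\<^esub> comb d'"
        using W.quotient_eq_iff_same_a_r_cos[OF I.ideal_axioms, of x "comb d'"] x(1) combT by (simp add: cW)
      then show "X \<in> (\<lambda>d. I +>\<^bsub>W\<^esub> comb d) ` ?F" using x(2) d'F by blast
    qed
  qed
  define q where "q = card (carrier (W Quot I))"
  have "p dvd q"
  proof -
    interpret QR: ring "W Quot I" by (rule I.quotient_is_ring)
    let ?A = "add_monoid (W Quot I)"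
    have hom: "(+>\<^bsub>W\<^esub>) I \<in> ring_hom W (W Quot I)" by (rule I.rcos_ring_hom)
    have pow: "(I +>\<^bsub>W\<^esub> one W) [^]\<^bsub>?A\<^esub> i = I +>\<^bsub>W\<^esub> (\<lambda>f\<in>H0 n. \<lambda>e. int i * f e)" for i :: nat
    proof (induction i)
      case 0
      have p0: "(I +>\<^bsub>W\<^esub> one W) [^]\<^bsub>?A\<^esub> (0 :: nat) = I" by (simp add: FactRing_def)
      have z: "zero W = (\<lambda>f\<in>H0 n. \<lambda>e. int 0 * f e)" unfolding ops by (simp add: R_def End_H0_simps restrict_def)
      have c: "I +>\<^bsub>W\<^esub> zero W = I" by (rule W.a_coset_add_zero[OF I.a_subset])
      show ?case by (simp only: p0 z[symmetric] c)
    next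
      case (Suc i)
      have "I +>\<^bsub>W\<^esub> ((\<lambda>f\<in>H0 n. \<lambda>e. int i * f e) \<oplus>\<^bsub>W\<^esub> one W) =
          (I +>\<^bsub>W\<^esub> (\<lambda>f\<in>H0 n. \<lambda>e. int i * f e)) \<oplus>\<^bsub>W Quot I\<^esub> (I +>\<^bsub>W\<^esub> one W)"
        using ring_hom_add[OF hom] fn W.one_closed by (simp add: cW)
      moreover have "(\<lambda>f\<in>H0 n. \<lambda>e. int i * f e) \<oplus>\<^bsub>W\<^esub> one W = (\<lambda>f\<in>H0 n. \<lambda>e. int (Suc i) * f e)"
        unfolding ops by (simp add: R_def End_H0_simps restrict_def fun_eq_iff algebra_simps)
      ultimately show ?case using Suc.IH by (metis QR.add.nat_pow_Suc add_pow_def)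
    qed
    have "I +>\<^bsub>W\<^esub> one W \<in> carrier ?A" using subringE(3)[OF subT] by (simp add: cQ ops)
    then have "(I +>\<^bsub>W\<^esub> one W) [^]\<^bsub>?A\<^esub> order ?A = \<one>\<^bsub>?A\<^esub>"
      by (rule group.pow_order_eq_1[OF QR.a_group])
    then have "I +>\<^bsub>W\<^esub> (\<lambda>f\<in>H0 n. \<lambda>e. int q * f e) = I"
      unfolding pow by (simp add: order_def q_def FactRing_def)
    then have "(\<lambda>f\<in>H0 n. \<lambda>e. int q * f e) \<in> I"
      using I.a_rcos_self[of "\<lambda>f\<in>H0 n. \<lambda>e. int q * f e"] fn by (simp add: cW)
    then have "(\<lambda>f\<in>H0 n. \<lambda>e. int q * f e) \<in> J" using IJ by blast
    then have "int p dvd (\<lambda>f\<in>H0 n. \<lambda>e. int q * f e) f0 e1" using f0V unfolding J_def by blast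
    then have a: "int p dvd int q * f0 e1" using f0(2) by simp
    have pp: "prime (int p)" using p(1) by simp
    have "\<not> int p dvd f0 e1"
    proof
      assume "int p dvd f0 e1"
      then have "int p dvd f0 e1 - (f0 e1 - M * dG e1)" using f0(3)[OF e1(1)] by (rule dvd_diff)
      then have "int p dvd M * dG e1" by simp
      moreover have "\<bar>dG e1\<bar> = 1" using e1(2) by (simp add: dG_def)
      then have "is_unit (dG e1)" by simp
      ultimately have "int p dvd M" by (simp add: dvd_mult_unit_iff)
      then show False using f0(1) pp by (metis coprime_common_divisor dvd_refl not_prime_unit)
    qed
    then have "int p dvd int q" using a pp prime_dvd_mult_iff by blast
    then show ?thesis by simp
  qed
  with fin show ?thesis by (simp add: q_def)
qed

theorem theorem8p1:
  fixes \<nn> \<pp> \<mm> :: "'a::{field, finite} poly" and p k :: nat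
  assumes "prime p" and "CARD('a) = p ^ k"
    and "lead_coeff \<pp> = 1" and "prime_elem \<pp>"
    and "lead_coeff \<mm> = 1" and "\<mm> \<noteq> 1"
    and "\<nn> = \<pp>\<^sup>2 * \<mm>"
  shows "(finite (carrier (hecke_algebra \<nn> Quot eisenstein_ideal \<nn>)) \<and>
          p dvd card (carrier (hecke_algebra \<nn> Quot eisenstein_ideal \<nn>))) \<and>
         (finite (carrier (hecke_algebra0 \<nn> Quot eisenstein_ideal0 \<nn>)) \<and>
          p dvd card (carrier (hecke_algebra0 \<nn> Quot eisenstein_ideal0 \<nn>)))"
proof -
  have "degree \<mm> > 0" using monic_degree_0[OF assms(5)] assms(6) by blast
  then obtain r where r: "prime_elem r" "r dvd \<mm>" by (rule poly_prime_divisor) blast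
  obtain s where s: "\<mm> = r * s" using r(2) by (rule dvdE)
  have m0: "\<mm> \<noteq> 0" "\<pp> \<noteq> 0" using assms(3,5) by auto
  define D where "D = \<pp> * s"
  have D: "\<pp> dvd D" "D \<noteq> 0" "\<nn> = \<pp> * (D * r)"
    using m0 s by (auto simp add: D_def assms(7) power2_eq_square ac_simps)
  have cop: "coprime l \<nn>" if l: "prime_elem l" "\<not> l dvd \<nn>" for l
  proof (rule coprimeI)
    fix j assume j: "j dvd l" "j dvd \<nn>"
    then obtain i where i: "l = j * i" by (auto elim: dvdE)
    then have "l dvd j \<or> l dvd i" using l(1) by (metis dvd_refl prime_elem_dvd_multD)
    moreover have "\<not> l dvd j" using j(2) l(2) dvd_trans by blast
    ultimately obtain i' where i': "i = l * i'" by (auto elim: dvdE)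
    have "l * (j * i') = j * (l * i')" by (simp add: ac_simps)
    also have "\<dots> = l * 1" by (simp only: i'[symmetric] i[symmetric] mult_1_right)
    finally have "j * i' = 1" using l(1) by (metis mult_left_cancel prime_elem_def)
    then show "is_unit j" by (metis dvdI)
  qed
  have "finite (carrier (hecke_algebra \<nn> Quot eisenstein_ideal \<nn>)) \<and>
      p dvd card (carrier (hecke_algebra \<nn> Quot eisenstein_ideal \<nn>))"
    using hecke_quotient[OF assms(1,2,4) D(1) r(1) D(2,3) refl _ refl refl, where Q = "\<lambda>_. True"]
    by (simp add: hecke_algebra_def eisenstein_ideal_def)
  moreover have "finite (carrier (hecke_algebra0 \<nn> Quot eisenstein_ideal0 \<nn>)) \<and>
      p dvd card (carrier (hecke_algebra0 \<nn> Quot eisenstein_ideal0 \<nn>))"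
    using hecke_quotient[OF assms(1,2,4) D(1) r(1) D(2,3) refl _ refl refl, where Q = "\<lambda>m. coprime m \<nn>"]
    by (simp add: hecke_algebra0_def eisenstein_ideal0_def cop)
  ultimately show ?thesis by blast
qed

end
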